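(* Let $1<p<N$ and let $\phi=\phi(\mathfrak A)$ be the basic determinantal process on $\mathcal N=\{1,\dots,N\}$ associated with orthonormal vectors $\mathfrak A=\{a^1,\dots,a^p\}\subset\mathbb R^N$. Let $\{i_0\},\{j_0\},A_1,A_2$ be pairwise disjoint subsets of $\mathcal N$ with $P\{A_1\not\subset\phi,A_2\not\subset\phi\}>0$, and put $y=a_{i_0}$, $y'=a_{j_0}$. Then, with $q$, $\tilde y,\tilde y'$ and $\Lambda_g(y,y')$ as in the context (in particular such vectors $\tilde y,\tilde y'\in\mathbb R^p$ exist), $$P\{i_0\in\phi\mid A_1\not\subset\phi,A_2\not\subset\phi\}\,P\{j_0\in\phi\mid A_1\not\subset\phi,A_2\not\subset\phi\}-P\{i_0\in\phi,j_0\in\phi\mid A_1\not\subset\phi,A_2\not\subset\phi\}$$ $$=P\{A_1\not\subset\phi,A_2\not\subset\phi\}^{-2}\big(\langle\tilde y,\tilde y'\rangle^2+\Lambda_g(y,y')\big)\ \ge\ 0 .$$ As a consequence, the inequality $$P\{A\not\subset\phi\mid A_i\not\subset\phi,\ i=1,2,3\}\le P\{A\not\subset\phi\mid A_i\not\subset\phi,\ i=1,2\}$$ holds for all pairwise disjoint subsets $A,A_1,A_2,A_3$ of $\mathcal N$ such that $P\{A_i\not\subset\phi,\ i=1,2,3\}>0$.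
   Context: Exterior powers of Euclidean space carry the inner product $\langle x_1\wedge\dots\wedge x_r,\,y_1\wedge\dots\wedge y_r\rangle=\det(\langle x_s,y_t\rangle)$ and the associated norm. Basic determinantal process: for $1<p<N$ and orthonormal vectors $a^k=(a^k_1,\dots,a^k_N)^t\in\mathbb R^N$, $k=1,\dots,p$, put $a_i=(a^1_i,\dots,a^p_i)\in\mathbb R^p$ for $i\in\mathcal N$. The process $\phi(\mathfrak A)$ is the random subset of $\mathcal N$ of cardinality $p$ with $P\{\phi=\{i_1,\dots,i_p\}\}=[\det(a^k_{i_j})_{k,j=1,\dots,p}]^2$; one has $P\{B\subset\phi\}=\|\bigwedge_{i\in B}a_i\|^2$ for every $B\subset\mathcal N$. Put $\omega_l=\bigwedge_{i\in A_l}a_i$ ($l=1,2$) and $\omega_{12}=\omega_1\wedge\omega_2$, so that $P\{A_1\not\subset\phi,A_2\not\subset\phi\}=1-\|\omega_1\|^2-\|\omega_2\|^2+\|\omega_{12}\|^2$. For $y,y'\in\mathbb R^p$ let $$q(y,y')=\langle y,y'\rangle-\langle y\wedge\omega_1,y'\wedge\omega_1\rangle-\langle y\wedge\omega_2,y'\wedge\omega_2\rangle+\langle y\wedge\omega_{12},y'\wedge\omega_{12}\rangle .$$ The vectors $\tilde y,\tilde y'\in\mathbb R^p$ are vectors such that $\langle\tilde y,\tilde y\rangle=q(y,y)$, $\langle\tilde y',\tilde y'\rangle=q(y',y')$, $\langle\tilde y,\tilde y'\rangle=q(y,y')$, and $$\Lambda_g(y,y')=\|\tilde y\wedge\tilde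 y'\|^2-\big(1-\|\omega_1\|^2-\|\omega_2\|^2+\|\omega_{12}\|^2\big)\Big[\|y\wedge y'\|^2-\|y\wedge y'\wedge\omega_1\|^2-\|y\wedge y'\wedge\omega_2\|^2+\|y\wedge y'\wedge\omega_{12}\|^2\Big].$$ *)

theory Defs
  imports
    "HOL-Probability.Probability_Mass_Function"
    "Jordan_Normal_Form.Determinant"
begin

unbundle no vec_syntax
unbundle no inner_syntax
hide_const (open) Finite_Cartesian_Product.vec Finite_Cartesian_Product.mat Determinants.det
  Finite_Cartesian_Product.row

section \<open>Exterior algebra of Euclidean space\<close>

text \<open>An element \<open>u\<close> of the exterior algebra of \<open>\<real>\<^sup>p\<close> (real vectors of dimension \<open>p\<close>, coordinates
  numbered from \<open>0\<close>) is given by its coordinates: \<open>u K\<close> is the coefficient of the basis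
  multivector \<open>e\<^bsub>k\<^esub> \<and> \<dots> \<and> e\<^bsub>l\<^esub>\<close>, where \<open>k < \<dots> < l\<close> are the elements of
  \<open>K \<subseteq> {..<p}\<close>.  \<open>ext_sign I J\<close> is the sign of the permutation that sorts \<open>I\<close> followed by \<open>J\<close>.
  The inner product makes the basis multivectors orthonormal; \<open>ext_inner_list\<close> below shows that
  it is the one given by \<open>\<langle>x\<^sub>1 \<and> \<dots> \<and> x\<^sub>r, y\<^sub>1 \<and> \<dots> \<and> y\<^sub>r\<rangle> = det (\<langle>x\<^sub>s, y\<^sub>t\<rangle>)\<close>.\<close>

definition ext_sign :: "nat set \<Rightarrow> nat set \<Rightarrow> real" where
  "ext_sign I J = (-1) ^ card {(i, j). i \<in> I \<and> j \<in> J \<and> j < i}"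

definition ext_wedge :: "(nat set \<Rightarrow> real) \<Rightarrow> (nat set \<Rightarrow> real) \<Rightarrow> nat set \<Rightarrow> real"
    (infixr "\<and>\<^sub>e" 71) where
  "(u \<and>\<^sub>e v) K = (\<Sum>I\<in>Pow K. ext_sign I (K - I) * u I * v (K - I))"

definition ext_one :: "nat set \<Rightarrow> real" where
  "ext_one K = (if K = {} then 1 else 0)"

definition ext_vec :: "real vec \<Rightarrow> nat set \<Rightarrow> real" where
  "ext_vec x K = (\<Sum>i<dim_vec x. if K = {i} then x $ i else 0)"

text \<open>\<open>ext_list [x\<^sub>1, \<dots>, x\<^sub>r] = x\<^sub>1 \<and> \<dots> \<and> x\<^sub>r\<close>\<close>

definition ext_list :: "real vec list \<Rightarrow> nat set \<Rightarrow> real" where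
  "ext_list xs = foldr (\<lambda>x. ext_wedge (ext_vec x)) xs ext_one"

definition ext_inner :: "nat \<Rightarrow> (nat set \<Rightarrow> real) \<Rightarrow> (nat set \<Rightarrow> real) \<Rightarrow> real" where
  "ext_inner p u v = (\<Sum>K\<in>Pow {..<p}. u K * v K)"

definition ext_norm :: "nat \<Rightarrow> (nat set \<Rightarrow> real) \<Rightarrow> real" where
  "ext_norm p u = sqrt (ext_inner p u u)"

lemma ext_wedge_infinite: "infinite K \<Longrightarrow> (u \<and>\<^sub>e v) K = 0"
  by (simp add: ext_wedge_def finite_Pow_iff)

lemma ext_sign_Un_left:
  assumes "finite I" "finite J" "finite L" "I \<inter> J = {}"
  shows "ext_sign (I \<union> J) L = ext_sign I L * ext_sign J L"
proof -
  let ?S = "\<lambda>I. {(i, j). i \<in> I \<and> j \<in> L \<and> j < i}"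
  have f: "finite (?S X)" if "finite X" for X
    by (rule finite_subset[of _ "X \<times> L"]) (use that assms in auto)
  have "?S (I \<union> J) = ?S I \<union> ?S J" by auto
  moreover have "?S I \<inter> ?S J = {}" using assms(4) by auto
  ultimately have "card (?S (I \<union> J)) = card (?S I) + card (?S J)"
    using f assms by (simp add: card_Un_disjoint)
  then show ?thesis by (simp add: ext_sign_def power_add)
qed

lemma ext_sign_Un_right:
  assumes "finite I" "finite J" "finite L" "J \<inter> L = {}"
  shows "ext_sign I (J \<union> L) = ext_sign I J * ext_sign I L"
proof -
  let ?S = "\<lambda>J. {(i, j). i \<in> I \<and> j \<in> J \<and> j < i}"
  have f: "finite (?S X)" if "finite X" for X
    by (rule finite_subset[of _ "I \<times> X"]) (use that assms in auto)
  have "?S (J \<union> L) = ?S J \<union> ?S L" by auto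
  moreover have "?S J \<inter> ?S L = {}" using assms(4) by auto
  ultimately have "card (?S (J \<union> L)) = card (?S J) + card (?S L)"
    using f assms by (simp add: card_Un_disjoint)
  then show ?thesis by (simp add: ext_sign_def power_add)
qed

lemma ext_wedge_assoc: "(u \<and>\<^sub>e v) \<and>\<^sub>e w = u \<and>\<^sub>e v \<and>\<^sub>e w"
proof
  fix K
  show "((u \<and>\<^sub>e v) \<and>\<^sub>e w) K = (u \<and>\<^sub>e v \<and>\<^sub>e w) K"
  proof (cases "finite K")
    case fK: True
    have "((u \<and>\<^sub>e v) \<and>\<^sub>e w) K = (\<Sum>I\<in>Pow K. \<Sum>J\<in>Pow I.
        ext_sign I (K - I) * ext_sign J (I - J) * u J * v (I - J) * w (K - I))"
      by (simp add: ext_wedge_def sum_distrib_left sum_distrib_right mult.assoc)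
    also have "\<dots> = (\<Sum>(I, J)\<in>Sigma (Pow K) Pow.
        ext_sign I (K - I) * ext_sign J (I - J) * u J * v (I - J) * w (K - I))"
      by (rule sum.Sigma) (use fK in \<open>auto intro: finite_subset\<close>)
    also have "\<dots> = (\<Sum>(J, L)\<in>Sigma (Pow K) (\<lambda>J. Pow (K - J)).
        ext_sign J (K - J) * ext_sign L (K - J - L) * u J * v L * w (K - J - L))"
    proof (rule sum.reindex_bij_witness[where j = "\<lambda>(I, J). (J, I - J)"
          and i = "\<lambda>(J, L). (J \<union> L, J)"], goal_cases)
      case (5 a)
      obtain I J where a: "a = (I, J)" by force
      have sub: "I \<subseteq> K" "J \<subseteq> I" using 5 a by auto
      define L M where "L = I - J" and "M = K - I"
      have fin: "finite J" "finite L" "finite M"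
        unfolding L_def M_def using sub fK finite_subset[of I K] finite_subset[of J I] by simp_all
      have eqs: "I = J \<union> L" "K - J = L \<union> M" "K - J - L = M" "J \<inter> L = {}" "L \<inter> M = {}"
        using sub by (auto simp: L_def M_def)
      have "ext_sign (J \<union> L) M = ext_sign J M * ext_sign L M"
        "ext_sign J (L \<union> M) = ext_sign J L * ext_sign J M"
        using ext_sign_Un_left ext_sign_Un_right fin eqs by auto
      moreover have "L \<union> M - L = M" using eqs(5) by auto
      ultimately show ?case
        unfolding a using \<open>L \<union> M - L = M\<close> by (simp flip: L_def M_def add: eqs(2,3)) (simp add: eqs(1))
    qed auto
    also have "\<dots> = (u \<and>\<^sub>e v \<and>\<^sub>e w) K"
      using fK by (subst sum.Sigma[symmetric])
        (auto simp: ext_wedge_def sum_distrib_left mult.assoc mult.left_commute intro!: sum.cong)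
    finally show ?thesis .
  qed (simp add: ext_wedge_infinite)
qed

lemma ext_sign_singleton: "ext_sign {i} J = (-1) ^ card {j \<in> J. j < i}"
proof -
  have "{(k, j). k \<in> {i} \<and> j \<in> J \<and> j < k} = Pair i ` {j \<in> J. j < i}" by auto
  then show ?thesis unfolding ext_sign_def by (simp add: card_image inj_on_def)
qed

lemma ext_wedge_vec:
  assumes "finite K" "x \<in> carrier_vec p" "K \<subseteq> {..<p}"
  shows "(ext_vec x \<and>\<^sub>e u) K = (\<Sum>i\<in>K. (-1) ^ card {j \<in> K. j < i} * x $ i * u (K - {i}))"
proof -
  have ev: "ext_vec x {i} = x $ i" if "i \<in> K" for i
  proof -
    have "ext_vec x {i} = (\<Sum>j<p. if i = j then x $ j else 0)"
      using assms(2) by (auto simp: ext_vec_def intro!: sum.cong)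
    then show ?thesis using that assms(3) by auto
  qed
  have e0: "ext_vec x I = 0" if "I \<notin> (\<lambda>i. {i}) ` K" "I \<subseteq> K" for I
    using that unfolding ext_vec_def by (intro sum.neutral) auto
  have "(ext_vec x \<and>\<^sub>e u) K =
      (\<Sum>I\<in>(\<lambda>i. {i}) ` K. ext_sign I (K - I) * ext_vec x I * u (K - I))"
    unfolding ext_wedge_def
    by (rule sum.mono_neutral_right) (use assms e0 in auto)
  also have "\<dots> = (\<Sum>i\<in>K. ext_sign {i} (K - {i}) * x $ i * u (K - {i}))"
    by (subst sum.reindex) (auto simp: inj_on_def ev)
  also have "\<dots> = (\<Sum>i\<in>K. (-1) ^ card {j \<in> K. j < i} * x $ i * u (K - {i}))"
  proof (rule sum.cong[OF refl])
    fix i assume "i \<in> K"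
    have "{j \<in> K - {i}. j < i} = {j \<in> K. j < i}" by auto
    then show "ext_sign {i} (K - {i}) * x $ i * u (K - {i}) =
        (-1) ^ card {j \<in> K. j < i} * x $ i * u (K - {i})"
      by (simp add: ext_sign_singleton)
  qed
  finally show ?thesis .
qed

text \<open>Contraction with \<open>x\<close>, the adjoint of \<open>u \<mapsto> x \<and> u\<close>.\<close>

definition ext_contract :: "nat \<Rightarrow> real vec \<Rightarrow> (nat set \<Rightarrow> real) \<Rightarrow> nat set \<Rightarrow> real" where
  "ext_contract p x v K =
     (\<Sum>i\<in>{..<p} - K. (-1) ^ card {j \<in> K. j < i} * x $ i * v (insert i K))"

lemma ext_inner_wedge_vec:
  assumes x: "x \<in> carrier_vec p"
  shows "ext_inner p (ext_vec x \<and>\<^sub>e u) v = ext_inner p u (ext_contract p x v)"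
proof -
  have "ext_inner p (ext_vec x \<and>\<^sub>e u) v =
      (\<Sum>K\<in>Pow {..<p}. \<Sum>i\<in>K. (-1) ^ card {j \<in> K. j < i} * x $ i * u (K - {i}) * v K)"
    unfolding ext_inner_def
    by (rule sum.cong[OF refl])
      (auto simp: ext_wedge_vec[OF _ x] sum_distrib_right finite_subset)
  also have "\<dots> = (\<Sum>(K, i)\<in>Sigma (Pow {..<p}) (\<lambda>K. K).
      (-1) ^ card {j \<in> K. j < i} * x $ i * u (K - {i}) * v K)"
    by (rule sum.Sigma) (auto intro: finite_subset)
  also have "\<dots> = (\<Sum>(K, i)\<in>Sigma (Pow {..<p}) (\<lambda>K. {..<p} - K).
      u K * ((-1) ^ card {j \<in> K. j < i} * x $ i * v (insert i K)))"
  proof (rule sum.reindex_bij_witness[where j = "\<lambda>(K, i). (K - {i}, i)"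
        and i = "\<lambda>(K, i). (insert i K, i)"], goal_cases)
    case (5 a)
    obtain K i where a: "a = (K, i)" by force
    have "{j. (j \<in> K \<and> j \<noteq> i) \<and> j < i} = {j \<in> K. j < i}" by auto
    moreover have "insert i K = K" using 5 a by auto
    ultimately show ?case using 5 a by simp
  qed (auto simp: insert_absorb)
  also have "\<dots> = ext_inner p u (ext_contract p x v)"
    unfolding ext_inner_def ext_contract_def
    by (subst sum.Sigma[symmetric]) (auto simp: sum_distrib_left)
  finally show ?thesis .
qed

lemma ext_contract_wedge:
  assumes x: "x \<in> carrier_vec p" and y: "y \<in> carrier_vec p" and K: "K \<subseteq> {..<p}"
  shows "ext_contract p x (ext_vec y \<and>\<^sub>e v) K =
    (x \<bullet> y) * v K - (ext_vec y \<and>\<^sub>e ext_contract p x v) K"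
proof -
  have fK: "finite K" using K finite_subset by blast
  define s where "s i K = ((-1::real) ^ card {j \<in> K. j < i})" for i :: nat and K
  have ss: "s i L * s i L = 1" for i L
    unfolding s_def by (simp flip: power_add)
  have s_ins: "s j (insert i L) = (if i < j then - s j L else s j L)" if "finite L" "i \<notin> L" for i j L
  proof -
    have "{k \<in> insert i L. k < j} = (if i < j then insert i {k \<in> L. k < j} else {k \<in> L. k < j})"
      by auto
    then show ?thesis using that unfolding s_def by simp
  qed
  have s_self: "s i (insert i L) = s i L" for i L
  proof -
    have "{j \<in> insert i L. j < i} = {j \<in> L. j < i}" by auto
    then show ?thesis unfolding s_def by simp
  qed
  have L: "ext_contract p x (ext_vec y \<and>\<^sub>e v) K =
     (\<Sum>i\<in>{..<p}-K. x $ i * y $ i * v K +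
       (\<Sum>j\<in>K. s i K * s j (insert i K) * x $ i * y $ j * v (insert i K - {j})))"
    unfolding ext_contract_def
  proof (rule sum.cong[OF refl], goal_cases)
    case (1 i)
    then have i: "i < p" "i \<notin> K" by auto
    have w: "(ext_vec y \<and>\<^sub>e v) (insert i K) =
       (\<Sum>j\<in>insert i K. s j (insert i K) * y $ j * v (insert i K - {j}))"
      using ext_wedge_vec[OF _ y, of "insert i K" v] fK i K unfolding s_def by auto
    have "\<dots> = s i K * y $ i * v K
        + (\<Sum>j\<in>K. s j (insert i K) * y $ j * v (insert i K - {j}))"
      using fK i by (simp add: s_self)
    then show ?case
      unfolding w s_def[symmetric] using ss[of i K]
      by (simp add: algebra_simps sum_distrib_left)
  qed
  have cc: "ext_contract p x v (K - {j}) = s j K * x $ j * v K +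
     (\<Sum>i\<in>{..<p}-K. s i (K - {j}) * x $ i * v (insert i (K - {j})))" if j: "j \<in> K" for j
  proof -
    have "{..<p} - (K - {j}) = insert j ({..<p} - K)" using j K by auto
    moreover have "s j (K - {j}) = s j K" using s_self[of j "K - {j}"] j by (simp add: insert_absorb)
    ultimately show ?thesis
      unfolding ext_contract_def s_def[symmetric] using j by (simp add: insert_absorb)
  qed
  have R: "(ext_vec y \<and>\<^sub>e ext_contract p x v) K =
     (\<Sum>j\<in>K. x $ j * y $ j * v K +
       (\<Sum>i\<in>{..<p}-K. s j K * s i (K - {j}) * x $ i * y $ j * v (insert i (K - {j}))))"
    unfolding ext_wedge_vec[OF fK y K] s_def[symmetric]
  proof (rule sum.cong[OF refl], goal_cases)
    case (1 j)
    then show ?case using ss[of j K] 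
      by (simp add: cc algebra_simps sum_distrib_left)
  qed
  have cross: "(\<Sum>i\<in>{..<p}-K. \<Sum>j\<in>K. s i K * s j (insert i K) * x $ i * y $ j * v (insert i K - {j})) =
     - (\<Sum>j\<in>K. \<Sum>i\<in>{..<p}-K. s j K * s i (K - {j}) * x $ i * y $ j * v (insert i (K - {j})))"
    unfolding sum_negf[symmetric]
  proof (subst sum.swap, intro sum.cong refl, goal_cases)
    case (1 j i)
    then have ij: "i \<notin> K" "j \<in> K" "i \<noteq> j" by auto
    have "insert i K - {j} = insert i (K - {j})" using ij by auto
    moreover have "s i K = (if j < i then - s i (K - {j}) else s i (K - {j}))"
      using s_ins[of "K - {j}" j i] ij fK by (simp add: insert_absorb)
    moreover have "s j (insert i K) = (if i < j then - s j K else s j K)"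
      using s_ins[of K i j] ij fK by simp
    ultimately show ?case using ij by (cases "i < j") auto
  qed
  have "x \<bullet> y = (\<Sum>i\<in>{..<p}. x $ i * y $ i)"
    using y by (simp add: scalar_prod_def atLeast0LessThan)
  also have "\<dots> = (\<Sum>i\<in>{..<p}-K. x $ i * y $ i) + (\<Sum>i\<in>K. x $ i * y $ i)"
    using K by (simp add: sum.subset_diff)
  finally have "(x \<bullet> y) * v K =
      (\<Sum>i\<in>{..<p}-K. x $ i * y $ i * v K) + (\<Sum>i\<in>K. x $ i * y $ i * v K)"
    by (simp add: sum_distrib_right distrib_right)
  then show ?thesis
    unfolding L R sum.distrib cross by simp
qed

lemma ext_list_Nil [simp]: "ext_list [] = ext_one"
  and ext_list_Cons [simp]: "ext_list (x # xs) = ext_vec x \<and>\<^sub>e ext_list xs"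
  by (simp_all add: ext_list_def)

lemma ext_contract_list:
  assumes x: "x \<in> carrier_vec p" and ys: "set ys \<subseteq> carrier_vec p" and K: "K \<subseteq> {..<p}"
  shows "ext_contract p x (ext_list ys) K =
    (\<Sum>t<length ys. (-1) ^ t * (x \<bullet> ys ! t) * ext_list (take t ys @ drop (Suc t) ys) K)"
  using ys K
proof (induction ys arbitrary: K)
  case Nil
  then show ?case by (auto simp: ext_contract_def ext_one_def)
next
  case (Cons y ys)
  have y: "y \<in> carrier_vec p" and fK: "finite K" using Cons.prems finite_subset by auto
  let ?d = "\<lambda>t ys. take t ys @ drop (Suc t) ys"
  have "(ext_vec y \<and>\<^sub>e ext_contract p x (ext_list ys)) K =
     (\<Sum>i\<in>K. (-1) ^ card {j \<in> K. j < i} * y $ i *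
       (\<Sum>t<length ys. (-1) ^ t * (x \<bullet> ys ! t) * ext_list (?d t ys) (K - {i})))"
    unfolding ext_wedge_vec[OF fK y Cons.prems(2)]
    by (intro sum.cong refl arg_cong2[where f = "(*)"] Cons.IH) (use Cons.prems in auto)
  also have "\<dots> = (\<Sum>t<length ys. (-1) ^ t * (x \<bullet> ys ! t) *
       (ext_vec y \<and>\<^sub>e ext_list (?d t ys)) K)"
    unfolding ext_wedge_vec[OF fK y Cons.prems(2)] sum_distrib_left
    by (subst sum.swap) (auto intro!: sum.cong)
  finally show ?case
    by (simp add: ext_contract_wedge[OF x y Cons.prems(2)] sum.lessThan_Suc_shift sum_negf
        del: sum.lessThan_Suc)
qed

theorem ext_inner_list:
  assumes "set xs \<subseteq> carrier_vec p" "set ys \<subseteq> carrier_vec p" "length xs = r" "length ys = r"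
  shows "ext_inner p (ext_list xs) (ext_list ys) = det (mat r r (\<lambda>(s, t). xs ! s \<bullet> ys ! t))"
  using assms
proof (induction xs arbitrary: ys r)
  case Nil
  have "Pow {..<p} = insert {} (Pow {..<p} - {{}})" by auto
  then have "ext_inner p ext_one ext_one = 1"
    unfolding ext_inner_def ext_one_def by (subst \<open>Pow {..<p} = _\<close>, subst sum.insert) auto
  then show ?case using Nil by (simp add: det_dim_zero)
next
  case (Cons x xs)
  obtain n where n: "r = Suc n" "length xs = n" using Cons.prems by auto
  have x: "x \<in> carrier_vec p" using Cons.prems by auto
  let ?d = "\<lambda>t. take t ys @ drop (Suc t) ys"
  let ?M = "mat r r (\<lambda>(s, t). (x # xs) ! s \<bullet> ys ! t)"
  have M: "?M \<in> carrier_mat r r" by simp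
  have "ext_inner p (ext_list (x # xs)) (ext_list ys) =
      (\<Sum>K\<in>Pow {..<p}. ext_list xs K *
        (\<Sum>t<r. (-1) ^ t * (x \<bullet> ys ! t) * ext_list (?d t) K))"
    using Cons.prems ext_contract_list[OF x Cons.prems(2)]
    by (simp add: ext_inner_wedge_vec[OF x]) (simp add: ext_inner_def)
  also have "\<dots> = (\<Sum>t<r. (-1) ^ t * (x \<bullet> ys ! t) * ext_inner p (ext_list xs) (ext_list (?d t)))"
    unfolding ext_inner_def sum_distrib_left by (subst sum.swap) (auto intro!: sum.cong)
  also have "\<dots> = (\<Sum>t<r. ?M $$ (0, t) * cofactor ?M 0 t)"
  proof (rule sum.cong[OF refl], goal_cases)
    case (1 t)
    then have t: "t < r" by simp
    have sub: "set (?d t) \<subseteq> carrier_vec p"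
      using Cons.prems set_take_subset[of t ys] set_drop_subset[of "Suc t" ys] by auto
    have "ext_inner p (ext_list xs) (ext_list (?d t)) =
        det (mat n n (\<lambda>(s, u). xs ! s \<bullet> ?d t ! u))"
      by (rule Cons.IH) (use Cons.prems n t sub in auto)
    moreover have "mat n n (\<lambda>(s, u). xs ! s \<bullet> ?d t ! u) = mat_delete ?M 0 t"
      by (rule eq_matI) (use Cons.prems n t in \<open>auto simp: mat_delete_def nth_append\<close>)
    ultimately show ?case using t n by (simp add: cofactor_def)
  qed
  also have "\<dots> = det ?M"
    using laplace_expansion_row[OF M, of 0] n by simp
  finally show ?case .
qed

lemma ext_list_nonzero:
  assumes "set xs \<subseteq> carrier_vec p" "ext_list xs K \<noteq> 0"
  shows "K \<subseteq> {..<p}" "card K = length xs"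
proof -
  have "K \<subseteq> {..<p} \<and> card K = length xs"
    using assms
  proof (induction xs arbitrary: K)
    case Nil
    then show ?case by (auto simp: ext_one_def split: if_splits)
  next
    case (Cons x xs)
    have x: "x \<in> carrier_vec p" using Cons.prems by auto
    obtain I where I: "I \<in> Pow K" "ext_vec x I \<noteq> 0" "ext_list xs (K - I) \<noteq> 0"
      using Cons.prems(2) unfolding ext_list_Cons ext_wedge_def
      by (metis (no_types, lifting) mult_zero_left mult_zero_right sum.neutral)
    obtain i where i: "I = {i}" "i < p"
    proof (rule ccontr)
      assume "\<not> thesis"
      then have "I \<noteq> {i}" if "i < p" for i using that \<open>\<And>i. I = {i} \<Longrightarrow> i < p \<Longrightarrow> thesis\<close> by blast
      then have "ext_vec x I = 0" using x unfolding ext_vec_def by (intro sum.neutral) auto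
      with I(2) show False by simp
    qed
    have "K - I \<subseteq> {..<p} \<and> card (K - I) = length xs"
      by (rule Cons.IH) (use Cons.prems I in auto)
    moreover have "finite (K - I)" using calculation finite_subset by blast
    moreover have "card K = Suc (card (K - {i}))"
      using calculation(2) I(1) i by (subst card_Suc_Diff1) auto
    ultimately show ?case using I(1) i by auto
  qed
  then show "K \<subseteq> {..<p}" "card K = length xs" by auto
qed

lemma ext_list_unit_vec:
  assumes "sorted_wrt (<) l" "set l \<subseteq> {..<p}"
  shows "ext_list (map (unit_vec p) l) K = (if K = set l then 1 else 0)"
  using assms
proof (induction l arbitrary: K)
  case Nil
  then show ?case by (simp add: ext_one_def)
next
  case (Cons i l)
  show ?case
  proof (cases "K \<subseteq> {..<p}")
    case False
    have "ext_list (map (unit_vec p) (i # l)) K = 0"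
    proof (rule ccontr)
      assume nz: "ext_list (map (unit_vec p) (i # l)) K \<noteq> 0"
      have "set (map (unit_vec p) (i # l)) \<subseteq> carrier_vec p" by auto
      from ext_list_nonzero(1)[OF this nz] False show False by simp
    qed
    then show ?thesis using False Cons.prems by auto
  next
    case True
    then have fK: "finite K" using finite_subset by blast
    have il: "i \<notin> set l" "\<And>j. j \<in> set l \<Longrightarrow> i < j" "i < p" using Cons.prems by auto
    have "ext_list (map (unit_vec p) (i # l)) K =
       (\<Sum>j\<in>K. (-1) ^ card {k \<in> K. k < j} * unit_vec p i $ j *
          (if K - {j} = set l then 1 else 0))"
      using Cons by (simp add: ext_wedge_vec[OF fK _ True])
    also have "\<dots> = (\<Sum>j\<in>K. if j = i then (if K = set (i # l) then 1 else 0) else 0)"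
    proof (rule sum.cong[OF refl], goal_cases)
      case (1 j)
      have u: "unit_vec p i $ j = (if j = i then 1 else (0::real))"
        using 1 True il by auto
      show ?case
      proof (cases "j = i")
        case True
        have iff: "K - {i} = set l \<longleftrightarrow> K = set (i # l)" using 1 True il by auto
        have none: "{k \<in> K. k < i} = {}" if "K = set (i # l)" using il(2) that by force
        have card0: "K = set (i # l) \<Longrightarrow> card {k \<in> K. k < i} = 0" using none by (simp only: card.empty)
        show ?thesis
        proof (cases "K = set (i # l)")
          case eq: True
          show ?thesis unfolding True u[unfolded True] card0[OF eq] iff if_P[OF eq] by (simp only: if_True power_0 mult_1 refl)
        next
          case neq: False
          show ?thesis unfolding True iff if_not_P[OF neq] by (simp only: mult_zero_right if_True refl)
        qed
      qed (simp add: u)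
    qed
    also have "\<dots> = (if K = set (i # l) then 1 else 0)" using fK by auto
    finally show ?thesis .
  qed
qed

lemma ext_list_minor:
  assumes xs: "set xs \<subseteq> carrier_vec p" "length xs = r" and K: "K \<subseteq> {..<p}" "card K = r"
  shows "ext_list xs K = det (mat r r (\<lambda>(s, t). xs ! s $ (sorted_list_of_set K ! t)))"
proof -
  have fK: "finite K" using K finite_subset by blast
  let ?l = "sorted_list_of_set K"
  have l: "length ?l = r" "set ?l = K" using K fK by auto
  have "ext_inner p (ext_list xs) (ext_list (map (unit_vec p) ?l)) =
      (\<Sum>L\<in>Pow {..<p}. if L = K then ext_list xs L else 0)"
    unfolding ext_inner_def using K fK
    by (intro sum.cong refl) (simp add: ext_list_unit_vec)
  also have "\<dots> = ext_list xs K" using K by simp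
  finally have "ext_list xs K = ext_inner p (ext_list xs) (ext_list (map (unit_vec p) ?l))" ..
  also have "\<dots> = det (mat r r (\<lambda>(s, t). xs ! s \<bullet> map (unit_vec p) ?l ! t))"
    by (rule ext_inner_list) (use xs l in auto)
  also have "mat r r (\<lambda>(s, t). xs ! s \<bullet> map (unit_vec p) ?l ! t) =
      mat r r (\<lambda>(s, t). xs ! s $ (?l ! t))"
  proof (rule eq_matI)
    fix s t assume "s < dim_row (mat r r (\<lambda>(s, t). xs ! s $ (?l ! t)))"
      "t < dim_col (mat r r (\<lambda>(s, t). xs ! s $ (?l ! t)))"
    then have st: "s < r" "t < r" by auto
    have "?l ! t < p" using st l K nth_mem[of t ?l] by auto
    moreover have "xs ! s \<in> carrier_vec p" using st xs by auto
    ultimately show "mat r r (\<lambda>(s, t). xs ! s \<bullet> map (unit_vec p) ?l ! t) $$ (s, t) =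
        mat r r (\<lambda>(s, t). xs ! s $ (?l ! t)) $$ (s, t)"
      using st l by simp
  qed auto
  finally show ?thesis .
qed

section \<open>The basic determinantal process\<close>

text \<open>The ground set is \<open>{..<N}\<close>, and the vectors \<open>a 0, \<dots>, a (p - 1)\<close> have coordinates
  \<open>a k $ i\<close>, \<open>i < N\<close>.  The process is identified with its law on subsets of the ground set.
  Listing \<open>S\<close> in increasing order is immaterial, as the determinant is squared.\<close>

definition det_process_mass :: "nat \<Rightarrow> nat \<Rightarrow> (nat \<Rightarrow> real vec) \<Rightarrow> nat set \<Rightarrow> real" where
  "det_process_mass N p a S =
     (if S \<subseteq> {..<N} \<and> card S = p
      then (det (mat p p (\<lambda>(k, j). a k $ (sorted_list_of_set S ! j))))\<^sup>2 else 0)"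

text \<open>\<open>embed_pmf\<close> is only meaningful for weights that sum to \<open>1\<close>; for orthonormal vectors this
  is \<open>pmf_det_process\<close> below.\<close>

definition det_process :: "nat \<Rightarrow> nat \<Rightarrow> (nat \<Rightarrow> real vec) \<Rightarrow> nat set pmf" where
  "det_process N p a = embed_pmf (det_process_mass N p a)"

definition orthonormal_vecs :: "nat \<Rightarrow> nat \<Rightarrow> (nat \<Rightarrow> real vec) \<Rightarrow> bool" where
  "orthonormal_vecs N p a \<longleftrightarrow> (\<forall>k<p. a k \<in> carrier_vec N) \<and>
     (\<forall>k<p. \<forall>l<p. a k \<bullet> a l = (if k = l then 1 else 0))"

lemma pmf_det_process:
  assumes "orthonormal_vecs N p a"
  shows "pmf (det_process N p a) S = det_process_mass N p a S"
proof -
  let ?xs = "map a [0..<p]"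
  have xs: "set ?xs \<subseteq> carrier_vec N" using assms by (auto simp: orthonormal_vecs_def)
  have mass: "det_process_mass N p a S = (ext_list ?xs S)\<^sup>2" for S
  proof (cases "S \<subseteq> {..<N} \<and> card S = p")
    case True
    have "mat p p (\<lambda>(k, j). a k $ (sorted_list_of_set S ! j)) =
       mat p p (\<lambda>(k, j). ?xs ! k $ (sorted_list_of_set S ! j))"
      by (rule eq_matI) auto
    then show ?thesis
      using True ext_list_minor[OF xs _ _ , of p S] by (simp add: det_process_mass_def)
  next
    case False
    then have "ext_list ?xs S = 0" using ext_list_nonzero[OF xs, of S] by auto
    moreover have "det_process_mass N p a S = 0"
      unfolding det_process_mass_def using False by (rule if_not_P)
    ultimately show ?thesis by simp
  qed
  have "(\<Sum>S\<in>Pow {..<N}. det_process_mass N p a S) = ext_inner N (ext_list ?xs) (ext_list ?xs)"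
    by (simp add: mass ext_inner_def power2_eq_square)
  also have "\<dots> = det (mat p p (\<lambda>(s, t). ?xs ! s \<bullet> ?xs ! t))"
    by (rule ext_inner_list) (use xs in auto)
  also have "mat p p (\<lambda>(s, t). ?xs ! s \<bullet> ?xs ! t) = 1\<^sub>m p"
    by (rule eq_matI) (use assms in \<open>auto simp: orthonormal_vecs_def\<close>)
  finally have one: "(\<Sum>S\<in>Pow {..<N}. det_process_mass N p a S) = 1" by simp
  have nn: "0 \<le> det_process_mass N p a S" for S by (simp add: det_process_mass_def)
  have "(\<integral>\<^sup>+ S. ennreal (det_process_mass N p a S) \<partial>count_space UNIV) =
      (\<Sum>S\<in>Pow {..<N}. ennreal (det_process_mass N p a S))"
    by (rule nn_integral_count_space'[where A = "Pow {..<N}"])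
      (auto simp: det_process_mass_def split: if_splits)
  also have "\<dots> = 1" using one nn by (simp add: sum_ennreal)
  finally show ?thesis
    unfolding det_process_def using nn by (intro pmf_embed_pmf) auto
qed

section \<open>The vectors, the form and the defect term attached to the process\<close>

text \<open>\<open>proc_vec p a i\<close> is the vector \<open>a\<^sub>i = (a\<^sup>1\<^sub>i, \<dots>, a\<^sup>p\<^sub>i)\<close> of \<open>\<real>\<^sup>p\<close>, and
  \<open>proc_wedge p a A\<close> is \<open>\<And>\<^bsub>i\<in>A\<^esub> a\<^sub>i\<close>, taken in increasing order; another order changes
  at most the sign, which does not affect \<open>q_form\<close> and \<open>Lambda_g\<close>.\<close>

definition proc_vec :: "nat \<Rightarrow> (nat \<Rightarrow> real vec) \<Rightarrow> nat \<Rightarrow> real vec" where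
  "proc_vec p a i = Matrix.vec p (\<lambda>k. a k $ i)"

definition proc_wedge :: "nat \<Rightarrow> (nat \<Rightarrow> real vec) \<Rightarrow> nat set \<Rightarrow> nat set \<Rightarrow> real" where
  "proc_wedge p a A = ext_list (map (proc_vec p a) (sorted_list_of_set A))"

definition q_form ::
  "nat \<Rightarrow> (nat set \<Rightarrow> real) \<Rightarrow> (nat set \<Rightarrow> real) \<Rightarrow> real vec \<Rightarrow> real vec \<Rightarrow> real" where
  "q_form p \<omega>1 \<omega>2 y y' =
     y \<bullet> y'
     - ext_inner p (ext_vec y \<and>\<^sub>e \<omega>1) (ext_vec y' \<and>\<^sub>e \<omega>1)
     - ext_inner p (ext_vec y \<and>\<^sub>e \<omega>2) (ext_vec y' \<and>\<^sub>e \<omega>2)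
     + ext_inner p (ext_vec y \<and>\<^sub>e (\<omega>1 \<and>\<^sub>e \<omega>2)) (ext_vec y' \<and>\<^sub>e (\<omega>1 \<and>\<^sub>e \<omega>2))"

text \<open>\<open>yt\<close> and \<open>yt'\<close> stand for the vectors \<open>y\<close> and \<open>y'\<close> with a tilde.\<close>

definition Lambda_g ::
  "nat \<Rightarrow> (nat set \<Rightarrow> real) \<Rightarrow> (nat set \<Rightarrow> real) \<Rightarrow> real vec \<Rightarrow> real vec \<Rightarrow> real vec \<Rightarrow> real vec \<Rightarrow> real"
where
  "Lambda_g p \<omega>1 \<omega>2 yt yt' y y' =
     (ext_norm p (ext_vec yt \<and>\<^sub>e ext_vec yt'))\<^sup>2
     - (1 - (ext_norm p \<omega>1)\<^sup>2 - (ext_norm p \<omega>2)\<^sup>2 + (ext_norm p (\<omega>1 \<and>\<^sub>e \<omega>2))\<^sup>2)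
       * ((ext_norm p (ext_vec y \<and>\<^sub>e ext_vec y'))\<^sup>2
          - (ext_norm p (ext_vec y \<and>\<^sub>e ext_vec y' \<and>\<^sub>e \<omega>1))\<^sup>2
          - (ext_norm p (ext_vec y \<and>\<^sub>e ext_vec y' \<and>\<^sub>e \<omega>2))\<^sup>2
          + (ext_norm p (ext_vec y \<and>\<^sub>e ext_vec y' \<and>\<^sub>e \<omega>1 \<and>\<^sub>e \<omega>2))\<^sup>2)"

end

theory Submission
  imports Defs "Jordan_Normal_Form.Spectral_Radius"
begin

text \<open>Both probabilities and \<open>q\<close> are alternating combinations of Gram determinants in which \<open>A\<^sub>1\<close> and \<open>A\<^sub>2\<close>
  enter only through \<open>\<omega>\<^sub>1\<close> and \<open>\<omega>\<^sub>2\<close>.  These can be rescaled to wedge products of orthonormal bases of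
  two subspaces, chosen as principal vectors, so that only the cosines \<open>c\<^sub>k\<close> of the principal angles
  matter.  In these coordinates the defect \<open>\<Lambda>\<^sub>g\<close> splits into terms indexed by pairs of principal
  directions, and nonnegativity reduces to an inequality for a single pair plus a diagonal estimate.

  Given that a set \<open>X\<close> is contained in \<open>\<phi>\<close>, the remaining rows are projected to the orthogonal
  complement of the rows of \<open>X\<close>.  Hence the same inequality shows that the map
  \<open>B \<mapsto> P{B \<subseteq> \<phi>, \<not> A\<^sub>1 \<subseteq> \<phi>, \<not> A\<^sub>2 \<subseteq> \<phi>}\<close> is log-submodular, which is the second assertion.\<close>

section \<open>Wedge products and Gram determinants of coordinate functions\<close>

text \<open>The inequality proved for a pair of rows is \<open>Lambda_g\<close> >= 0, stronger than
  the claim by the square of the mixed term. This strength is used: as the product of probabilities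
  that it bounds is nonnegative, it also gives q(y,y')^2 <= q(y,y) q(y',y'), and only this makes the
  two vectors with a tilde exist. The identity itself does not depend on their choice, since the
  squared norm of their wedge product plus the square of their inner product is the product of their
  squared norms.

  The pair inequality is stated for arbitrary lists of vectors with Gram determinants at most 1, and
  not for rows of a process, because the second assertion applies it to rows projected along the
  rows of X. The bound survives the projection: the Gram determinant of the projected rows of A is
  the conditional probability of A being contained in the process, given that X is.

  The squared factors of the rescaling are the squared norms of the two wedge products. They lie in
  [0,1] and are, besides the cosines and the coordinates of the two vectors, the only data
  left.\<close>

definition ip :: "nat \<Rightarrow> (nat \<Rightarrow> real) \<Rightarrow> (nat \<Rightarrow> real) \<Rightarrow> real" where
  "ip p x y = (\<Sum>i<p. x i * y i)"

definition addmul :: "(nat \<Rightarrow> real) \<Rightarrow> real \<Rightarrow> (nat \<Rightarrow> real) \<Rightarrow> nat \<Rightarrow> real" where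
  "addmul x c y = (\<lambda>i. x i + c * y i)"

text \<open>Vectors are total functions cut off at \<open>p\<close> by \<open>Matrix.vec p\<close>,
  so that linear combinations can be formed without \<open>carrier_vec\<close> side
  conditions.\<close>

definition wedge_list :: "nat \<Rightarrow> (nat \<Rightarrow> real) list \<Rightarrow> nat set \<Rightarrow> real" where
  "wedge_list p xs = ext_list (map (Matrix.vec p) xs)"

text \<open>For lists of equal length this is the determinant of the inner products, by
  \<open>ext_inner_list\<close>. Defined through multivectors, it inherits every linear relation
  between wedge products.\<close>

definition gram :: "nat \<Rightarrow> (nat \<Rightarrow> real) list \<Rightarrow> (nat \<Rightarrow> real) list \<Rightarrow> real" where
  "gram p xs ys = ext_inner p (wedge_list p xs) (wedge_list p ys)"

lemma ip_commute: "ip p x y = ip p y x"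
  by (simp add: ip_def mult.commute)

lemma ip_addmul_left [simp]: "ip p (addmul x c y) z = ip p x z + c * ip p y z"
  by (simp add: ip_def addmul_def algebra_simps sum.distrib sum_distrib_left)

lemma ip_addmul_right [simp]: "ip p z (addmul x c y) = ip p z x + c * ip p z y"
  by (simp add: ip_commute[of p z])

lemma ip_ge_0: "0 \<le> ip p x x"
  by (simp add: ip_def sum_nonneg)

lemma ip_eq_0_left:
  assumes "ip p x x = 0" shows "ip p x y = 0"
proof -
  have "x i = 0" if "i < p" for i
    using assms that unfolding ip_def by (subst (asm) sum_nonneg_eq_0_iff) auto
  then show ?thesis by (simp add: ip_def)
qed

lemma ip_eq_0_right: "ip p x x = 0 \<Longrightarrow> ip p y x = 0"
  using ip_eq_0_left ip_commute by metis

lemma scalar_prod_vec: "Matrix.vec p x \<bullet> Matrix.vec p y = ip p x y"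
  by (simp add: scalar_prod_def ip_def atLeast0LessThan)

lemma wedge_list_Nil: "wedge_list p [] = ext_one"
  and wedge_list_Cons: "wedge_list p (x # xs) = ext_vec (Matrix.vec p x) \<and>\<^sub>e wedge_list p xs"
  by (simp_all add: wedge_list_def)

lemma ext_vec_addmul:
  "ext_vec (Matrix.vec p (addmul x c y)) K = ext_vec (Matrix.vec p x) K + c * ext_vec (Matrix.vec p y) K"
  unfolding ext_vec_def addmul_def sum_distrib_left sum.distrib[symmetric] dim_vec
  by (rule sum.cong) auto

lemma ext_wedge_add_left: "(\<lambda>K. u K + c * v K) \<and>\<^sub>e w = (\<lambda>K. (u \<and>\<^sub>e w) K + c * (v \<and>\<^sub>e w) K)"
  by (rule ext) (simp add: ext_wedge_def algebra_simps sum.distrib sum_distrib_left)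

lemma ext_wedge_scale_right: "u \<and>\<^sub>e (\<lambda>K. c * v K) = (\<lambda>K. c * (u \<and>\<^sub>e v) K)"
  by (rule ext) (simp add: ext_wedge_def algebra_simps sum_distrib_left)

lemma ext_wedge_scale_left: "(\<lambda>K. c * u K) \<and>\<^sub>e v = (\<lambda>K. c * (u \<and>\<^sub>e v) K)"
  by (rule ext) (simp add: ext_wedge_def algebra_simps sum_distrib_left)

lemma wedge_list_addmul:
  "wedge_list p (addmul x c y # zs) K = wedge_list p (x # zs) K + c * wedge_list p (y # zs) K"
proof -
  have "ext_vec (Matrix.vec p (addmul x c y)) =
      (\<lambda>K. ext_vec (Matrix.vec p x) K + c * ext_vec (Matrix.vec p y) K)"
    by (rule ext) (rule ext_vec_addmul)
  then show ?thesis by (simp add: wedge_list_Cons ext_wedge_add_left)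
qed

section \<open>Signs of reordering in wedge products\<close>

lemma ext_vec_nonzero: "ext_vec x I \<noteq> 0 \<Longrightarrow> \<exists>i. I = {i}"
  unfolding ext_vec_def by (rule ccontr) (auto simp: sum.neutral)

text \<open>Complementation in \<open>K\<close> matches the summands of both sides. A nonzero
  summand forces \<open>K\<close> to consist of two elements, and exactly one of the two orders has
  an inversion.\<close>

lemma ext_wedge_vec_anticommute:
  "(ext_vec x \<and>\<^sub>e ext_vec y) K = - (ext_vec y \<and>\<^sub>e ext_vec x) K"
  unfolding ext_wedge_def sum_negf[symmetric]
proof (rule sum.reindex_bij_witness[where i = "\<lambda>I. K - I" and j = "\<lambda>I. K - I"], goal_cases)
  case (5 I)
  then have KI: "K - (K - I) = I" by auto
  show ?case
  proof (cases "ext_vec x I \<noteq> 0 \<and> ext_vec y (K - I) \<noteq> 0")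
    case True
    then obtain i j where ij: "I = {i}" "K - I = {j}" using ext_vec_nonzero by metis
    then have "i \<noteq> j" by auto
    moreover have "{k \<in> {m}. k < n} = (if m < n then {m} else {})" for m n :: nat by auto
    ultimately have "ext_sign {i} {j} = - ext_sign {j} {i}"
      unfolding ext_sign_singleton by simp
    then show ?thesis unfolding KI unfolding ij(2) unfolding ij(1) by simp
  qed (auto simp: KI)
qed auto

lemma wedge_list_swap: "wedge_list p (x # y # zs) K = - wedge_list p (y # x # zs) K"
proof -
  have *: "ext_vec (Matrix.vec p x) \<and>\<^sub>e ext_vec (Matrix.vec p y) =
      (\<lambda>K. -1 * (ext_vec (Matrix.vec p y) \<and>\<^sub>e ext_vec (Matrix.vec p x)) K)"
    by (rule ext) (subst ext_wedge_vec_anticommute, simp)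
  show ?thesis
    unfolding wedge_list_Cons ext_wedge_assoc[symmetric] * ext_wedge_scale_left by simp
qed

lemma wedge_list_same: "wedge_list p (x # x # zs) K = 0"
  using wedge_list_swap[of p x x zs K] by simp

lemma ext_one_wedge: "ext_one \<and>\<^sub>e u = (\<lambda>K. if finite K then u K else 0)"
proof
  fix K
  show "(ext_one \<and>\<^sub>e u) K = (if finite K then u K else 0)"
  proof (cases "finite K")
    case True
    have "(ext_one \<and>\<^sub>e u) K = (\<Sum>I\<in>{{}}. ext_sign I (K - I) * ext_one I * u (K - I))"
      unfolding ext_wedge_def by (rule sum.mono_neutral_right) (use True in \<open>auto simp: ext_one_def\<close>)
    then show ?thesis using True by (simp add: ext_one_def ext_sign_def)
  qed (simp add: ext_wedge_infinite)
qed

lemma wedge_list_infinite: "infinite K \<Longrightarrow> wedge_list p xs K = 0"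
  by (cases xs) (auto simp: wedge_list_Nil ext_one_def wedge_list_Cons ext_wedge_infinite)

lemma wedge_list_append: "wedge_list p (xs @ ys) = wedge_list p xs \<and>\<^sub>e wedge_list p ys"
proof (induction xs)
  case Nil
  show ?case by (rule ext) (simp add: wedge_list_Nil ext_one_wedge wedge_list_infinite)
qed (simp add: wedge_list_Cons ext_wedge_assoc)

lemma wedge_list_snoc: "wedge_list p (xs @ x # ys) K = (-1) ^ length xs * wedge_list p (x # xs @ ys) K"
proof (induction xs arbitrary: K)
  case (Cons z xs)
  have "wedge_list p (xs @ x # ys) = (\<lambda>K. (-1) ^ length xs * wedge_list p (x # xs @ ys) K)"
    using Cons.IH by blast
  then have "wedge_list p ((z # xs) @ x # ys) K = (-1) ^ length xs * wedge_list p (z # x # xs @ ys) K"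
    unfolding append_Cons wedge_list_Cons[of p z] by (simp add: ext_wedge_scale_right)
  then show ?case by (simp add: wedge_list_swap[of p z])
qed simp

lemma wedge_list_append_commute:
  "wedge_list p (xs @ ys) K = (-1) ^ (length xs * length ys) * wedge_list p (ys @ xs) K"
proof (induction xs arbitrary: K)
  case (Cons x xs)
  have "wedge_list p (xs @ ys) = (\<lambda>K. (-1) ^ (length xs * length ys) * wedge_list p (ys @ xs) K)"
    using Cons.IH by blast
  then have "wedge_list p ((x # xs) @ ys) K =
      (-1) ^ (length xs * length ys) * wedge_list p (x # ys @ xs) K"
    by (simp add: wedge_list_Cons ext_wedge_scale_right)
  moreover have "(-1::real) ^ length ys * (-1) ^ length ys = 1" by (simp flip: power_add)
  ultimately show ?case by (simp add: wedge_list_snoc power_add algebra_simps)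
qed simp

lemma wedge_list_mset_eq:
  assumes "mset xs = mset ys"
  shows "\<exists>s\<in>{1, -1}. \<forall>K. wedge_list p xs K = s * wedge_list p ys K"
  using assms
proof (induction xs arbitrary: ys)
  case (Cons x xs)
  then have "x \<in> set ys" by (metis list.set_intros(1) set_mset_mset)
  then obtain as bs where ys: "ys = as @ x # bs" by (meson split_list)
  then have "mset xs = mset (as @ bs)" using Cons.prems by simp
  from Cons.IH[OF this] obtain s where s: "s \<in> {1, -1}"
    "wedge_list p xs = (\<lambda>K. s * wedge_list p (as @ bs) K)" by blast
  have sq: "(-1::real) ^ length as * (-1) ^ length as = 1" by (simp flip: power_add)
  have "wedge_list p (x # xs) K = s * (-1) ^ length as * wedge_list p ys K" for K
    using sq unfolding ys wedge_list_snoc by (simp add: wedge_list_Cons s(2) ext_wedge_scale_right)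
  moreover have "s * (-1) ^ length as \<in> {1, -1}"
    using s(1) by (cases "even (length as)") auto
  ultimately show ?case by blast
qed auto

lemma ext_inner_scale:
  "ext_inner p (\<lambda>K. c * u K) (\<lambda>K. d * v K) = c * d * ext_inner p u v"
  by (simp add: ext_inner_def sum_distrib_left algebra_simps)

lemma gram_scale:
  assumes "\<And>K. wedge_list p xs K = c * wedge_list p xs' K"
    and "\<And>K. wedge_list p ys K = d * wedge_list p ys' K"
  shows "gram p xs ys = c * d * gram p xs' ys'"
proof -
  have "wedge_list p xs = (\<lambda>K. c * wedge_list p xs' K)" "wedge_list p ys = (\<lambda>K. d * wedge_list p ys' K)"
    using assms by auto
  then show ?thesis by (simp add: gram_def ext_inner_scale)
qed

text \<open>The sign of the permutation occurs in both arguments and is squared away, so the rows of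
  a set may be listed in any order.\<close>

lemma gram_mset_eq:
  assumes "mset xs = mset ys" shows "gram p xs xs = gram p ys ys"
proof -
  obtain s where s: "s = 1 \<or> s = -1" "\<And>K. wedge_list p xs K = s * wedge_list p ys K"
    using wedge_list_mset_eq[OF assms, of p] by blast
  have "gram p xs xs = s * s * gram p ys ys" by (rule gram_scale) (rule s(2))+
  then show ?thesis using s(1) by auto
qed

text \<open>Here the two arguments differ, so the sign does not occur as a square of one and the
  same factor; blocks of equal length produce equal signs.\<close>

lemma gram_append_commute:
  assumes "length xs = length xs'"
  shows "gram p (xs @ ys) (xs' @ ys) = gram p (ys @ xs) (ys @ xs')"
proof -
  have "gram p (xs @ ys) (xs' @ ys) = (-1) ^ (length xs * length ys) * (-1) ^ (length xs' * length ys)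
      * gram p (ys @ xs) (ys @ xs')"
    by (rule gram_scale) (rule wedge_list_append_commute)+
  then show ?thesis by (simp add: assms flip: power_add)
qed

lemma gram_Nil: "gram p [] [] = 1"
  unfolding gram_def wedge_list_def by (subst ext_inner_list[where r = 0]) (auto simp: det_dim_zero)

lemma gram_single: "gram p [x] [y] = ip p x y"
  unfolding gram_def wedge_list_def
  by (subst ext_inner_list[where r = 1]) (auto simp: det_single scalar_prod_vec)

lemma gram_pair: "gram p [x, y] [x', y'] = ip p x x' * ip p y y' - ip p x y' * ip p y x'"
  unfolding gram_def wedge_list_def
  by (subst ext_inner_list[where r = 2])
    (auto simp: scalar_prod_vec laplace_expansion_row[where n = 2 and i = 0] numeral_2_eq_2
      cofactor_def mat_delete_def det_single)

lemma wedge_list_null_vec: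
  assumes "ip p z z = 0" shows "wedge_list p (z # zs) K = 0"
proof -
  have "z i = 0" if "i < p" for i
    using assms that unfolding ip_def by (subst (asm) sum_nonneg_eq_0_iff) auto
  then have "ext_vec (Matrix.vec p z) I = 0" for I
    unfolding ext_vec_def by (intro sum.neutral) auto
  then show ?thesis by (simp add: wedge_list_Cons ext_wedge_def)
qed

section \<open>Orthogonal reduction of wedge products\<close>

text \<open>If \<open>ip p e e = 0\<close>, then \<open>e\<close> vanishes on the first \<open>p\<close> coordinates, and \<open>x / 0 = 0\<close> makes
  \<open>residual p e\<close> the identity; the Gram formulas below therefore need no exception for null vectors.\<close>

definition residual :: "nat \<Rightarrow> (nat \<Rightarrow> real) \<Rightarrow> (nat \<Rightarrow> real) \<Rightarrow> nat \<Rightarrow> real" where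
  "residual p e z = addmul z (- ip p z e / ip p e e) e"

fun perp :: "nat \<Rightarrow> (nat \<Rightarrow> real) list \<Rightarrow> (nat \<Rightarrow> real) \<Rightarrow> nat \<Rightarrow> real" where
  "perp p [] z = z"
| "perp p (e # es) z = perp p es (residual p e z)"

abbreviation orthogonal_list :: "nat \<Rightarrow> (nat \<Rightarrow> real) list \<Rightarrow> bool" where
  "orthogonal_list p \<equiv> sorted_wrt (\<lambda>x y. ip p x y = 0)"

definition orthonormal_list :: "nat \<Rightarrow> (nat \<Rightarrow> real) list \<Rightarrow> bool" where
  "orthonormal_list p es \<longleftrightarrow> orthogonal_list p es \<and> (\<forall>e\<in>set es. ip p e e = 1)"

text \<open>By double orthogonal complements this says that \<open>es\<close> lies in the span of \<open>zs\<close>.\<close>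

definition in_span_of :: "nat \<Rightarrow> (nat \<Rightarrow> real) list \<Rightarrow> (nat \<Rightarrow> real) list \<Rightarrow> bool" where
  "in_span_of p es zs \<longleftrightarrow>
     (\<forall>x. (\<forall>z\<in>set zs. ip p x z = 0) \<longrightarrow> (\<forall>e\<in>set es. ip p x e = 0))"

lemma ip_zero_left [simp]: "ip p (\<lambda>_. 0) z = 0"
  by (simp add: ip_def)

lemma ip_zero_right [simp]: "ip p z (\<lambda>_. 0) = 0"
  by (simp add: ip_def)

lemma residual_orthogonal: "ip p (residual p e z) e = 0"
  using ip_eq_0_right[of p e z] by (simp add: residual_def)

lemma residual_orthogonal': "ip p e (residual p e z) = 0"
  using residual_orthogonal ip_commute by metis

lemma residual_of_orthogonal: "ip p e z = 0 \<Longrightarrow> residual p e z = z"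
  by (rule ext) (simp add: residual_def addmul_def ip_commute[of p z e])

text \<open>Every residual differs from its vector by a multiple of \<open>e\<close>, and a product
  containing \<open>e\<close> twice vanishes.\<close>

lemma wedge_list_residual: "wedge_list p (e # zs) K = wedge_list p (e # map (residual p e) zs) K"
proof (induction zs arbitrary: K)
  case (Cons z zs)
  have IH: "wedge_list p (e # zs) = wedge_list p (e # map (residual p e) zs)" using Cons.IH by blast
  have "wedge_list p (e # z # zs) K = - wedge_list p (z # e # zs) K" by (rule wedge_list_swap)
  also have "\<dots> = - wedge_list p (z # e # map (residual p e) zs) K"
    unfolding wedge_list_Cons[of p z] IH ..
  also have "\<dots> = - wedge_list p (residual p e z # e # map (residual p e) zs) K"
    unfolding residual_def[of p e z] wedge_list_addmul wedge_list_same by simp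
  also have "\<dots> = wedge_list p (e # residual p e z # map (residual p e) zs) K"
    using wedge_list_swap[of p e "residual p e z" "map (residual p e) zs" K] by simp
  finally show ?case by simp
qed simp

lemma ext_contract_orthogonal:
  assumes "\<And>z. z \<in> set zs \<Longrightarrow> ip p e z = 0" and K: "K \<subseteq> {..<p}"
  shows "ext_contract p (Matrix.vec p e) (wedge_list p zs) K = 0"
  unfolding wedge_list_def
  by (subst ext_contract_list[OF _ _ K]) (use assms in \<open>auto simp: scalar_prod_vec intro!: sum.neutral\<close>)

text \<open>By adjointness \<open>e\<close> moves to the other side as a contraction. Contracting
  \<open>e\<close> wedge w with \<open>e\<close> gives \<open>ip p e e\<close> times w minus
  \<open>e\<close> wedge the contraction of w, and the latter vanishes by orthogonality.\<close>

lemma gram_orthogonal_head: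
  assumes "\<And>z. z \<in> set zs' \<Longrightarrow> ip p e z = 0"
  shows "gram p (e # zs) (e # zs') = ip p e e * gram p zs zs'"
proof -
  have e: "Matrix.vec p e \<in> carrier_vec p" by simp
  have *: "ext_contract p (Matrix.vec p e) (ext_vec (Matrix.vec p e) \<and>\<^sub>e wedge_list p zs') K
      = ip p e e * wedge_list p zs' K" if K: "K \<in> Pow {..<p}" for K
  proof -
    have K': "K \<subseteq> {..<p}" "finite K" using K finite_subset by auto
    have "(ext_vec (Matrix.vec p e) \<and>\<^sub>e ext_contract p (Matrix.vec p e) (wedge_list p zs')) K = 0"
      unfolding ext_wedge_vec[OF K'(2) e K'(1)]
    proof (rule sum.neutral, rule ballI)
      fix i
      have "K - {i} \<subseteq> {..<p}" using K' by auto
      then have "ext_contract p (Matrix.vec p e) (wedge_list p zs') (K - {i}) = 0"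
        using ext_contract_orthogonal[of zs' p e] assms by blast
      then show "(-1) ^ card {j \<in> K. j < i} * Matrix.vec p e $ i *
          ext_contract p (Matrix.vec p e) (wedge_list p zs') (K - {i}) = 0" by simp
    qed
    then show ?thesis by (simp add: ext_contract_wedge[OF e e K'(1)] scalar_prod_vec)
  qed
  have "gram p (e # zs) (e # zs') = (\<Sum>K\<in>Pow {..<p}. wedge_list p zs K * (ip p e e * wedge_list p zs' K))"
    unfolding gram_def wedge_list_Cons ext_inner_wedge_vec[OF e]
    unfolding ext_inner_def by (rule sum.cong[OF refl]) (simp add: *)
  also have "\<dots> = ip p e e * gram p zs zs'"
    by (simp add: gram_def ext_inner_def sum_distrib_left algebra_simps)
  finally show ?thesis .
qed

text \<open>One elimination step on the matrix of inner products: the pivot is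
  \<open>ip p e e\<close>, and the Schur complement consists of the inner products of the
  residuals.\<close>

lemma gram_residual:
  "gram p (e # zs) (e # zs') = ip p e e * gram p (map (residual p e) zs) (map (residual p e) zs')"
proof -
  have "wedge_list p (e # zs) = wedge_list p (e # map (residual p e) zs)" for zs
    by (rule ext) (rule wedge_list_residual)
  then have "gram p (e # zs) (e # zs') =
      gram p (e # map (residual p e) zs) (e # map (residual p e) zs')"
    unfolding gram_def by simp
  also have "\<dots> = ip p e e * gram p (map (residual p e) zs) (map (residual p e) zs')"
    by (rule gram_orthogonal_head) (auto simp: residual_orthogonal')
  finally show ?thesis .
qed

text \<open>Iterates \<open>gram_residual\<close>; by orthogonality, removing the component along
  one vector of \<open>es\<close> does not change the later ones, so the pivots are their own
  squared lengths.\<close>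

lemma gram_perp:
  assumes "orthogonal_list p es"
  shows "gram p (es @ zs) (es @ zs') =
    (\<Prod>e\<leftarrow>es. ip p e e) * gram p (map (perp p es) zs) (map (perp p es) zs')"
  using assms
proof (induction es arbitrary: zs zs')
  case (Cons e es)
  have "map (residual p e) es = es"
    by (rule map_idI) (use Cons.prems in \<open>auto simp: residual_of_orthogonal\<close>)
  then have "gram p ((e # es) @ zs) ((e # es) @ zs') =
      ip p e e * gram p (es @ map (residual p e) zs) (es @ map (residual p e) zs')"
    by (simp add: gram_residual)
  then show ?case using Cons by (simp add: comp_def)
qed (simp add: map_idI)

lemma ip_perp:
  assumes "orthogonal_list p es"
  shows "ip p (perp p es y) (perp p es y') =
    ip p y y' - (\<Sum>e\<leftarrow>es. ip p e y * ip p e y' / ip p e e)"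
  using assms
proof (induction es arbitrary: y y')
  case (Cons e es)
  have *: "ip p x (residual p e z) = ip p x z" if "x \<in> set es" for x z
    using that Cons.prems ip_commute[of p x e] by (simp add: residual_def)
  have "ip p (residual p e y) (residual p e y') = ip p y y' - ip p e y * ip p e y' / ip p e e"
  proof (cases "ip p e e = 0")
    case True
    then have "ip p e y = 0" by (rule ip_eq_0_left)
    with True show ?thesis by (simp add: residual_def)
  next
    case False
    have "ip p y e = ip p e y" "ip p y' e = ip p e y'" by (rule ip_commute)+
    with False show ?thesis by (simp add: residual_def)
  qed
  moreover have "(\<Sum>x\<leftarrow>es. ip p x (residual p e y) * ip p x (residual p e y') / ip p x x) =
      (\<Sum>x\<leftarrow>es. ip p x y * ip p x y' / ip p x x)"
    by (intro arg_cong[where f = sum_list] map_cong refl) (simp add: *)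
  ultimately show ?case using Cons by simp
qed simp

section \<open>Spans and orthonormal representatives of wedge products\<close>

lemma in_span_ofD:
  "in_span_of p es zs \<Longrightarrow> (\<And>z. z \<in> set zs \<Longrightarrow> ip p x z = 0) \<Longrightarrow> e \<in> set es \<Longrightarrow> ip p x e = 0"
  unfolding in_span_of_def by blast

lemma in_span_ofI:
  "(\<And>x e. (\<And>z. z \<in> set zs \<Longrightarrow> ip p x z = 0) \<Longrightarrow> e \<in> set es \<Longrightarrow> ip p x e = 0) \<Longrightarrow> in_span_of p es zs"
  unfolding in_span_of_def by blast

lemma in_span_of_refl: "in_span_of p xs xs"
  unfolding in_span_of_def by blast

lemma wedge_list_zero: "wedge_list p ((\<lambda>_. 0) # zs) K = 0"
  by (rule wedge_list_null_vec) simp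

text \<open>A null vector met on the way makes the wedge product 0, and the list is then cut off
  with factor 0. Hence \<open>es\<close> may span less than \<open>zs\<close>; later only the wedge
  product and the inclusion of spans matter.\<close>

lemma gram_schmidt:
  "\<exists>lam es. orthonormal_list p es \<and> length es \<le> length zs \<and> in_span_of p es zs
     \<and> (\<forall>K. wedge_list p zs K = lam * wedge_list p es K)"
proof (induction "length zs" arbitrary: zs)
  case 0
  then show ?case by (intro exI[of _ 1] exI[of _ "[]"]) (auto simp: orthonormal_list_def in_span_of_def)
next
  case (Suc n)
  then obtain z zs' where zs: "zs = z # zs'" "n = length zs'" by (cases zs) auto
  show ?case
  proof (cases "ip p z z = 0")
    case True
    then show ?thesis unfolding zs
      by (intro exI[of _ 0] exI[of _ "[]"])
        (auto simp: orthonormal_list_def in_span_of_def wedge_list_null_vec)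
  next
    case False
    define t where "t = sqrt (ip p z z)"
    have t: "t \<noteq> 0" "t * t = ip p z z" using False ip_ge_0[of p z] by (auto simp: t_def)
    \<comment> \<open>The multiple is written as an \<open>addmul\<close> of the zero function so
      that \<open>wedge_list_addmul\<close> applies to it.\<close>
    define e where "e = addmul (\<lambda>_. 0) (1 / t) z"
    have ee: "ip p e e = 1" unfolding e_def using t(1) by (simp flip: t(2))
    have we: "wedge_list p (z # ys) K = t * wedge_list p (e # ys) K" for ys K
      unfolding e_def wedge_list_addmul wedge_list_zero using t by simp
    obtain lam es where IH: "orthonormal_list p es" "length es \<le> length zs'"
      "in_span_of p es (map (residual p e) zs')"
      "\<And>K. wedge_list p (map (residual p e) zs') K = lam * wedge_list p es K"
      using Suc.hyps(1)[of "map (residual p e) zs'"] zs(2) by auto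
    have perp: "ip p e x = 0" if "x \<in> set es" for x
      by (rule in_span_ofD[OF IH(3) _ that]) (auto simp: residual_orthogonal')
    have "wedge_list p zs K = t * lam * wedge_list p (e # es) K" for K
    proof -
      have "wedge_list p (map (residual p e) zs') = (\<lambda>K. lam * wedge_list p es K)"
        using IH(4) by blast
      then have "wedge_list p (e # map (residual p e) zs') K = lam * wedge_list p (e # es) K"
        by (simp add: wedge_list_Cons ext_wedge_scale_right)
      then show ?thesis unfolding zs(1) we using wedge_list_residual[of p e zs' K] by simp
    qed
    moreover have "orthonormal_list p (e # es)" using IH(1) perp ee by (simp add: orthonormal_list_def)
    moreover have "in_span_of p (e # es) zs"
    proof (rule in_span_ofI)
      fix x y assume x: "\<And>y. y \<in> set zs \<Longrightarrow> ip p x y = 0" and y: "y \<in> set (e # es)"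
      have xe: "ip p x e = 0" using x[of z] by (simp add: e_def zs(1))
      then have "ip p x w = 0" if "w \<in> set (map (residual p e) zs')" for w
        using that x by (auto simp: residual_def zs(1))
      from in_span_ofD[OF IH(3) this] show "ip p x y = 0" using y xe by auto
    qed
    ultimately show ?thesis using IH(2) zs by (intro exI[of _ "t * lam"] exI[of _ "e # es"]) auto
  qed
qed

lemma wedge_list_repeat:
  assumes "y \<in> set zs" shows "wedge_list p (y # zs) K = 0"
proof -
  obtain as bs where zs: "zs = as @ y # bs" using assms by (meson split_list)
  have "wedge_list p (as @ y # bs) = (\<lambda>K. (-1) ^ length as * wedge_list p (y # as @ bs) K)"
    by (rule ext) (rule wedge_list_snoc)
  then have "wedge_list p (y # zs) K = (-1) ^ length as * wedge_list p (y # y # as @ bs) K"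
    unfolding zs wedge_list_Cons[of p y "as @ y # bs"] by (simp add: ext_wedge_scale_right wedge_list_Cons)
  then show ?thesis by (simp add: wedge_list_same)
qed

lemma wedge_list_sum:
  assumes "finite A"
  shows "wedge_list p ((\<lambda>i. \<Sum>j\<in>A. x j * y j i) # zs) K = (\<Sum>j\<in>A. x j * wedge_list p (y j # zs) K)"
  using assms
proof (induction A rule: finite_induct)
  case empty
  then show ?case by (simp add: wedge_list_zero)
next
  case (insert a A)
  have "(\<lambda>i. \<Sum>j\<in>insert a A. x j * y j i) = addmul (\<lambda>i. \<Sum>j\<in>A. x j * y j i) (x a) (y a)"
    using insert.hyps by (simp add: addmul_def add.commute)
  then show ?case using insert by (simp add: wedge_list_addmul)
qed

lemma ip_sum_left: "ip p (\<lambda>i. \<Sum>j\<in>A. x j * y j i) z = (\<Sum>j\<in>A. x j * ip p (y j) z)"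
  unfolding ip_def sum_distrib_left sum_distrib_right by (subst sum.swap) (simp add: mult.assoc)

lemma ip_sum_right: "ip p z (\<lambda>i. \<Sum>j\<in>A. x j * y j i) = (\<Sum>j\<in>A. x j * ip p z (y j))"
  using ip_sum_left[of p x y A z] by (simp add: ip_commute)

text \<open>An exchange argument: in the wedge product of \<open>v\<close> with all
  \<open>es ! l\<close> other than \<open>es ! j\<close>, each other summand of \<open>v\<close>
  repeats a factor, so \<open>x j\<close> times the old product survives. Gram-Schmidt on the
  residuals completes \<open>v\<close> to an orthonormal list; the strict bound on the length drives
  the induction that splits off principal vectors.\<close>

lemma orthonormal_list_replace_head:
  assumes x: "j < length es" "x j \<noteq> 0"
    and v: "v = (\<lambda>i. \<Sum>l<length es. x l * (es ! l) i)" "ip p v v = 1"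
  shows "\<exists>lam rest. orthonormal_list p (v # rest) \<and> length rest < length es
     \<and> in_span_of p (v # rest) es \<and> (\<forall>K. wedge_list p es K = lam * wedge_list p (v # rest) K)"
proof -
  define zs where "zs = take j es @ drop (Suc j) es"
  have es: "es = take j es @ es ! j # drop (Suc j) es" using id_take_nth_drop[OF x(1)] .
  have wes: "wedge_list p es K = (-1) ^ j * wedge_list p (es ! j # zs) K" for K
    using wedge_list_snoc[of p "take j es" "es ! j" "drop (Suc j) es" K] es x(1) by (simp add: zs_def)
  have mem: "es ! l \<in> set zs" if "l < length es" "l \<noteq> j" for l
  proof (cases "l < j")
    case True
    then have "take j es ! l = es ! l" by simp
    moreover have "l < length (take j es)" using True x(1) by simp
    ultimately show ?thesis unfolding zs_def by (metis UnCI nth_mem set_append)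
  next
    case False
    then have "drop (Suc j) es ! (l - Suc j) = es ! l" "l - Suc j < length (drop (Suc j) es)"
      using that by simp_all
    then show ?thesis unfolding zs_def by (metis UnCI nth_mem set_append)
  qed
  have "wedge_list p (v # zs) K = (\<Sum>l<length es. if l = j then x j * wedge_list p (es ! j # zs) K else 0)" for K
    unfolding v(1) wedge_list_sum[OF finite_lessThan]
    by (rule sum.cong) (simp_all add: wedge_list_repeat mem)
  then have wv: "wedge_list p (v # zs) K = x j * wedge_list p (es ! j # zs) K" for K
    using x(1) by simp
  obtain lam rest where gs: "orthonormal_list p rest" "length rest \<le> length zs"
    "in_span_of p rest (map (residual p v) zs)"
    "\<And>K. wedge_list p (map (residual p v) zs) K = lam * wedge_list p rest K"
    using gram_schmidt[of p "map (residual p v) zs"] by auto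
  have perp: "ip p v y = 0" if "y \<in> set rest" for y
    by (rule in_span_ofD[OF gs(3) _ that]) (auto simp: residual_orthogonal')
  have "wedge_list p es K = (-1) ^ j / x j * lam * wedge_list p (v # rest) K" for K
  proof -
    have "wedge_list p (map (residual p v) zs) = (\<lambda>K. lam * wedge_list p rest K)"
      using gs(4) by blast
    then have "wedge_list p (v # map (residual p v) zs) K = lam * wedge_list p (v # rest) K"
      by (simp add: wedge_list_Cons ext_wedge_scale_right)
    then have "x j * wedge_list p (es ! j # zs) K = lam * wedge_list p (v # rest) K"
      using wv[of K] wedge_list_residual[of p v zs K] by simp
    then show ?thesis unfolding wes using x(2) by (simp add: field_simps)
  qed
  moreover have "orthonormal_list p (v # rest)" using gs(1) perp v(2) by (simp add: orthonormal_list_def)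
  moreover have "length rest < length es" using gs(2) x(1) by (simp add: zs_def)
  moreover have "in_span_of p (v # rest) es"
  proof (rule in_span_ofI)
    fix z e assume z: "\<And>e. e \<in> set es \<Longrightarrow> ip p z e = 0" and e: "e \<in> set (v # rest)"
    have zv: "ip p z v = 0" unfolding v(1) ip_sum_right using z by (auto intro!: sum.neutral)
    have "set zs \<subseteq> set es" unfolding zs_def using set_take_subset set_drop_subset by fastforce
    then have "ip p z y = 0" if "y \<in> set (map (residual p v) zs)" for y
      using that z zv by (auto simp: residual_def)
    from in_span_ofD[OF gs(3) this] show "ip p z e = 0" using e zv by auto
  qed
  ultimately show ?thesis by blast
qed

section \<open>Principal vectors of two subspaces\<close>

text \<open>A complex eigenvector exists. Its Hermitian form \<open>Q\<close> is real by symmetry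
  and equals the eigenvalue times the positive number \<open>M\<close>, so the eigenvalue is real;
  real and imaginary parts then satisfy the equation separately, and one of them is nonzero.\<close>

lemma real_symmetric_eigenvector:
  fixes S :: "nat \<Rightarrow> nat \<Rightarrow> real"
  assumes sym: "\<And>i j. i < n \<Longrightarrow> j < n \<Longrightarrow> S i j = S j i" and n: "0 < n"
  shows "\<exists>x \<theta>. (\<exists>i<n. x i \<noteq> 0) \<and> (\<forall>i<n. (\<Sum>j<n. S i j * x j) = \<theta> * x i)"
proof -
  define A :: "complex mat" where "A = mat n n (\<lambda>(i, j). complex_of_real (S i j))"
  have A: "A \<in> carrier_mat n n" by (simp add: A_def)
  obtain \<theta> where "\<theta> \<in> spectrum A" using spectrum_non_empty[OF A n] by blast
  then obtain v where v: "v \<in> carrier_vec n" "v \<noteq> 0\<^sub>v n" "A *\<^sub>v v = \<theta> \<cdot>\<^sub>v v"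
    using A unfolding spectrum_def eigenvalue_def eigenvector_def by auto
  have eq: "(\<Sum>j<n. of_real (S i j) * v $ j) = \<theta> * v $ i" if i: "i < n" for i
  proof -
    have "(A *\<^sub>v v) $ i = (\<theta> \<cdot>\<^sub>v v) $ i" using v(3) by simp
    then show ?thesis
      using i v(1) by (simp add: A_def scalar_prod_def atLeast0LessThan)
  qed
  have "\<exists>m<n. v $ m \<noteq> 0"
  proof (rule ccontr)
    assume "\<not> (\<exists>m<n. v $ m \<noteq> 0)"
    then have "v = 0\<^sub>v n" using v(1) by (intro eq_vecI) auto
    with v(2) show False by simp
  qed
  then obtain m where m: "m < n" "v $ m \<noteq> 0" by blast
  define Q where "Q = (\<Sum>i<n. \<Sum>j<n. of_real (S i j) * (cnj (v $ i) * v $ j))"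
  define M where "M = (\<Sum>i<n. (cmod (v $ i))\<^sup>2)"
  have "Q = (\<Sum>i<n. cnj (v $ i) * (\<theta> * v $ i))"
    unfolding Q_def by (intro sum.cong refl) (simp add: eq[symmetric] sum_distrib_left mult.left_commute)
  also have "\<dots> = \<theta> * of_real M"
    unfolding M_def of_real_sum sum_distrib_left
    by (intro sum.cong refl) (simp add: complex_norm_square[symmetric] mult.commute mult.left_commute)
  finally have Q: "Q = \<theta> * of_real M" .
  have "cnj Q = (\<Sum>i<n. \<Sum>j<n. of_real (S j i) * (cnj (v $ j) * v $ i))"
    unfolding Q_def cnj_sum by (intro sum.cong refl) (simp add: sym mult.commute)
  also have "\<dots> = Q" unfolding Q_def by (rule sum.swap)
  finally have "cnj \<theta> * of_real M = \<theta> * of_real M" unfolding Q by simp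
  moreover have "0 < M" unfolding M_def by (rule sum_pos2[OF _ _ _ zero_le_power2]) (use m in auto)
  ultimately have "cnj \<theta> = \<theta>" by simp
  then have im: "Im \<theta> = 0" by (simp add: complex_eq_iff)
  have re: "(\<Sum>j<n. S i j * Re (v $ j)) = Re \<theta> * Re (v $ i)"
    and im': "(\<Sum>j<n. S i j * Im (v $ j)) = Re \<theta> * Im (v $ i)" if "i < n" for i
    using arg_cong[OF eq[OF that], of Re] arg_cong[OF eq[OF that], of Im] im by auto
  show ?thesis
  proof (cases "Re (v $ m) = 0")
    case True
    then have "Im (v $ m) \<noteq> 0" using m(2) by (simp add: complex_eq_iff)
    then show ?thesis using m(1) im' by (intro exI[of _ "\<lambda>i. Im (v $ i)"] exI[of _ "Re \<theta>"]) auto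
  next
    case False
    then show ?thesis using m(1) re by (intro exI[of _ "\<lambda>i. Re (v $ i)"] exI[of _ "Re \<theta>"]) auto
  qed
qed

lemma orthonormal_list_nth:
  assumes "orthonormal_list p es" "i < length es" "j < length es"
  shows "ip p (es ! i) (es ! j) = (if i = j then 1 else 0)"
proof (cases i j rule: linorder_cases)
  case less
  then show ?thesis using assms sorted_wrt_nth_less[of "\<lambda>x y. ip p x y = 0" es i j]
    by (simp add: orthonormal_list_def)
next
  case greater
  then show ?thesis using assms
    using sorted_wrt_nth_less[of "\<lambda>x y. ip p x y = 0" es j i] ip_commute[of p "es ! i" "es ! j"]
    by (simp add: orthonormal_list_def)
qed (use assms in \<open>simp add: orthonormal_list_def\<close>)

lemma ip_nth_orthonormal_sum:
  assumes "orthonormal_list p es" "i < length es"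
  shows "ip p (es ! i) (\<lambda>k. \<Sum>j<length es. x j * (es ! j) k) = x i"
proof -
  have "(\<Sum>j<length es. x j * ip p (es ! i) (es ! j)) = (\<Sum>j<length es. if j = i then x i else 0)"
    using orthonormal_list_nth[OF assms] by (intro sum.cong refl) auto
  then show ?thesis using assms(2) by (simp add: ip_sum_right)
qed

lemma ip_orthonormal_sum:
  assumes "orthonormal_list p es"
  shows "ip p (\<lambda>k. \<Sum>j<length es. x j * (es ! j) k) (\<lambda>k. \<Sum>j<length es. x j * (es ! j) k)
    = (\<Sum>j<length es. (x j)\<^sup>2)"
  unfolding ip_sum_left using ip_nth_orthonormal_sum[OF assms]
  by (intro sum.cong refl) (simp add: power2_eq_square)

lemma wedge_list_Cons_scale:
  assumes "\<And>K. wedge_list p zs K = c * wedge_list p zs' K"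
  shows "wedge_list p (z # zs) K = c * wedge_list p (z # zs') K"
proof -
  have "wedge_list p zs = (\<lambda>K. c * wedge_list p zs' K)" using assms by blast
  then show ?thesis by (simp add: wedge_list_Cons ext_wedge_scale_right)
qed

text \<open>Principal vectors of two subspaces are matched by position. The inner products at equal
  positions stay free: they are the cosines of the principal angles. Surplus vectors of the longer
  list have no partner.\<close>

definition biorthogonal :: "nat \<Rightarrow> (nat \<Rightarrow> real) list \<Rightarrow> (nat \<Rightarrow> real) list \<Rightarrow> bool" where
  "biorthogonal p es fs \<longleftrightarrow>
     (\<forall>k<length es. \<forall>l<length fs. k \<noteq> l \<longrightarrow> ip p (es ! k) (fs ! l) = 0)"

text \<open>A singular value decomposition of the matrix of inner products: a unit vector of the first
  span which is an eigenvector of the compression of the projection to the second span is split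
  off, together with its normalised projection.\<close>

lemma orthonormal_lists_biorthogonal:
  assumes "orthonormal_list p es" "orthonormal_list p fs"
  shows "\<exists>es' fs' lam mu. orthonormal_list p es' \<and> orthonormal_list p fs'
     \<and> in_span_of p es' es \<and> in_span_of p fs' fs \<and> biorthogonal p es' fs'
     \<and> (\<forall>K. wedge_list p es K = lam * wedge_list p es' K)
     \<and> (\<forall>K. wedge_list p fs K = mu * wedge_list p fs' K)"
  using assms
proof (induction "length es" arbitrary: es fs rule: less_induct)
  case less
  show ?case
  proof (cases "es = []")
    case True
    then show ?thesis using less.prems
      by (intro exI[of _ "[]"] exI[of _ fs] exI[of _ 1])
        (simp add: biorthogonal_def in_span_of_refl)
  next
    case False
    define m where "m = length fs"
    \<comment> \<open>With C the matrix of inner products of \<open>es\<close> and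
      \<open>fs\<close>, this is C times its transpose: the projection to the span of
      \<open>fs\<close>, compressed to the span of \<open>es\<close>.\<close>
    define S where "S i j = (\<Sum>l<m. ip p (es ! i) (fs ! l) * ip p (es ! j) (fs ! l))" for i j
    have "S i j = S j i" for i j by (simp add: S_def mult.commute)
    then obtain x0 \<theta> i0 where x0: "i0 < length es" "x0 i0 \<noteq> 0"
      "\<And>i. i < length es \<Longrightarrow> (\<Sum>j<length es. S i j * x0 j) = \<theta> * x0 i"
      using real_symmetric_eigenvector[of "length es" S] False by blast
    define r where "r = sqrt (\<Sum>j<length es. (x0 j)\<^sup>2)"
    have "0 < (\<Sum>j<length es. (x0 j)\<^sup>2)"
      by (rule sum_pos2[OF _ _ _ zero_le_power2]) (use x0 in auto)
    then have r: "0 < r" "r\<^sup>2 = (\<Sum>j<length es. (x0 j)\<^sup>2)" by (auto simp: r_def)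
    define x where "x j = x0 j / r" for j
    have x: "x i0 \<noteq> 0" "(\<Sum>j<length es. (x j)\<^sup>2) = 1"
      using x0(2) r by (auto simp: x_def power_divide simp flip: sum_divide_distrib)
    have xe: "(\<Sum>j<length es. S i j * x j) = \<theta> * x i" if "i < length es" for i
      using x0(3)[OF that] by (simp add: x_def flip: sum_divide_distrib)
    define v where "v = (\<lambda>k. \<Sum>j<length es. x j * (es ! j) k)"
    have vv: "ip p v v = 1" unfolding v_def ip_orthonormal_sum[OF less.prems(1)] by (rule x(2))
    have ve: "ip p (es ! i) v = x i" if "i < length es" for i
      unfolding v_def by (rule ip_nth_orthonormal_sum[OF less.prems(1) that])
    obtain lam1 rest1 where r1: "orthonormal_list p (v # rest1)" "length rest1 < length es"
      "in_span_of p (v # rest1) es" "\<And>K. wedge_list p es K = lam1 * wedge_list p (v # rest1) K"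
      using orthonormal_list_replace_head[OF x0(1), of x v p, OF x(1) v_def vv] by blast
    have r1v: "ip p v e = 0" if "e \<in> set rest1" for e using r1(1) that by (simp add: orthonormal_list_def)
    have o1: "orthonormal_list p rest1" using r1(1) by (simp add: orthonormal_list_def)
    \<comment> \<open>The length of the projection of \<open>v\<close> to the span of
      \<open>fs\<close>; if it is 0, then \<open>v\<close> has no partner.\<close>
    define t where "t = sqrt (\<Sum>l<m. (ip p v (fs ! l))\<^sup>2)"
    have t0: "0 \<le> t" and t2: "t\<^sup>2 = (\<Sum>l<m. (ip p v (fs ! l))\<^sup>2)"
      by (auto simp: t_def sum_nonneg)
    show ?thesis
    proof (cases "t = 0")
      case True
      then have "(\<Sum>l<m. (ip p v (fs ! l))\<^sup>2) = 0" using t2 by simp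
      then have "\<forall>l\<in>{..<m}. (ip p v (fs ! l))\<^sup>2 = 0"
        by (subst (asm) sum_nonneg_eq_0_iff) auto
      then have vf: "ip p v f = 0" if "f \<in> set fs" for f
        using that by (auto simp: in_set_conv_nth m_def)
      obtain es' fs' lam mu where IH: "orthonormal_list p es'" "orthonormal_list p fs'"
        "in_span_of p es' rest1" "in_span_of p fs' fs" "biorthogonal p es' fs'"
        "\<And>K. wedge_list p rest1 K = lam * wedge_list p es' K"
        "\<And>K. wedge_list p fs K = mu * wedge_list p fs' K"
        using less.hyps[OF r1(2) o1 less.prems(2)] by blast
      have ve': "ip p v e = 0" if "e \<in> set es'" for e by (rule in_span_ofD[OF IH(3) r1v that])
      have vf': "ip p v f = 0" if "f \<in> set fs'" for f by (rule in_span_ofD[OF IH(4) vf that])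
      have "ip p e v = 0" if "e \<in> set es'" for e using ve'[OF that] ip_commute[of p e v] by simp
      \<comment> \<open>\<open>v\<close> goes to the end, so that the positions of the pairs found
        by induction do not shift.\<close>
      then have "orthonormal_list p (es' @ [v])"
        using IH(1) vv unfolding orthonormal_list_def
        by (auto simp: sorted_wrt_append)
      moreover have "in_span_of p (es' @ [v]) es"
      proof (rule in_span_ofI)
        fix z e assume z: "\<And>e. e \<in> set es \<Longrightarrow> ip p z e = 0" and e: "e \<in> set (es' @ [v])"
        have zr: "ip p z y = 0" if "y \<in> set (v # rest1)" for y by (rule in_span_ofD[OF r1(3) z that])
        have "ip p z y = 0" if "y \<in> set es'" for y by (rule in_span_ofD[OF IH(3) _ that]) (use zr in auto)
        then show "ip p z e = 0" using e zr by auto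
      qed
      moreover have "biorthogonal p (es' @ [v]) fs'"
        using IH(5) vf' unfolding biorthogonal_def by (auto simp: nth_append)
      moreover have "wedge_list p es K = lam1 * lam * (-1) ^ length es' * wedge_list p (es' @ [v]) K" for K
      proof -
        have sq: "(-1::real) ^ length es' * (-1) ^ length es' = 1" by (simp flip: power_add)
        have "wedge_list p es K = lam1 * (lam * wedge_list p (v # es') K)"
          using r1(4) wedge_list_Cons_scale[OF IH(6)] by simp
        moreover have "wedge_list p (es' @ [v]) K = (-1) ^ length es' * wedge_list p (v # es') K"
          using wedge_list_snoc[of p es' v "[]" K] by simp
        moreover have "(-1) ^ length es' * ((-1) ^ length es' * w) = w" for w :: real
          using sq by (simp flip: mult.assoc)
        ultimately show ?thesis by (simp add: mult.assoc)
      qed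
      ultimately show ?thesis using IH(2,4,7) by blast
    next
      case False
      define y where "y l = ip p v (fs ! l) / t" for l
      have y1: "(\<Sum>l<m. (y l)\<^sup>2) = 1"
        using False t2 by (auto simp: y_def power_divide simp flip: sum_divide_distrib)
      have "\<exists>l<m. y l \<noteq> 0"
      proof (rule ccontr)
        assume "\<not> (\<exists>l<m. y l \<noteq> 0)"
        then have "(\<Sum>l<m. (y l)\<^sup>2) = 0" by (intro sum.neutral) auto
        with y1 show False by simp
      qed
      then obtain l0 where l0: "l0 < length fs" "y l0 \<noteq> 0" unfolding m_def by blast
      define f where "f = (\<lambda>k. \<Sum>j<length fs. y j * (fs ! j) k)"
      have ff: "ip p f f = 1" unfolding f_def ip_orthonormal_sum[OF less.prems(2)] using y1 by (simp add: m_def)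
      have fe: "ip p (fs ! l) f = y l" if "l < m" for l
        unfolding f_def by (rule ip_nth_orthonormal_sum) (use less.prems(2) that m_def in auto)
      obtain mu1 rest2 where r2: "orthonormal_list p (f # rest2)" "length rest2 < length fs"
        "in_span_of p (f # rest2) fs" "\<And>K. wedge_list p fs K = mu1 * wedge_list p (f # rest2) K"
        using orthonormal_list_replace_head[OF l0(1), of y f p, OF l0(2) f_def ff] by blast
      have r2f: "ip p f e = 0" if "e \<in> set rest2" for e using r2(1) that by (simp add: orthonormal_list_def)
      have o2: "orthonormal_list p rest2" using r2(1) by (simp add: orthonormal_list_def)
      have vr2: "ip p v z = 0" if "z \<in> set rest2" for z
      proof -
        \<comment> \<open>\<open>t\<close> times \<open>f\<close> is the projection of
          \<open>v\<close> to the span of \<open>fs\<close>, so the difference is orthogonal to that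
          span.\<close>
        have "ip p (addmul v (- t) f) w = 0" if w: "w \<in> set fs" for w
        proof -
          obtain l where "l < m" "w = fs ! l" using w unfolding in_set_conv_nth m_def by blast
          then show ?thesis using fe[of l] False ip_commute[of p f "fs ! l"] by (simp add: y_def)
        qed
        from in_span_ofD[OF r2(3) this, of z] show ?thesis using r2f that by simp
      qed
      have fr1: "ip p f z = 0" if "z \<in> set rest1" for z
      proof -
        \<comment> \<open>This is where the eigenvalue equation enters: projecting \<open>f\<close>
          back to the span of \<open>es\<close> gives a multiple of \<open>v\<close>, so
          \<open>f\<close> is orthogonal to the rest of that span.\<close>
        have "ip p (addmul f (- \<theta> / t) v) w = 0" if w: "w \<in> set es" for w
        proof -
          obtain i where i: "i < length es" "w = es ! i" using w unfolding in_set_conv_nth by blast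
          have "ip p (es ! i) f = (\<Sum>l<m. y l * ip p (es ! i) (fs ! l))"
            unfolding f_def ip_sum_right m_def ..
          also have "\<dots> = (\<Sum>l<m. \<Sum>j<length es. ip p (es ! i) (fs ! l) * ip p (es ! j) (fs ! l) * x j / t)"
            unfolding y_def v_def ip_sum_left
            by (intro sum.cong refl) (simp add: sum_divide_distrib sum_distrib_left sum_distrib_right mult_ac)
          also have "\<dots> = (\<Sum>j<length es. S i j * x j) / t"
            unfolding S_def by (subst sum.swap) (simp add: sum_divide_distrib sum_distrib_right)
          also have "\<dots> = \<theta> / t * ip p (es ! i) v" using xe[OF i(1)] ve[OF i(1)] by simp
          finally show ?thesis using i(2) ip_commute[of p f "es ! i"] ip_commute[of p v "es ! i"] by simp
        qed
        from in_span_ofD[OF r1(3) this, of z] show ?thesis using r1v that by simp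
      qed
      obtain es' fs' lam mu where IH: "orthonormal_list p es'" "orthonormal_list p fs'"
        "in_span_of p es' rest1" "in_span_of p fs' rest2" "biorthogonal p es' fs'"
        "\<And>K. wedge_list p rest1 K = lam * wedge_list p es' K"
        "\<And>K. wedge_list p rest2 K = mu * wedge_list p fs' K"
        using less.hyps[OF r1(2) o1 o2] by blast
      have ve': "ip p v e = 0" if "e \<in> set es'" for e by (rule in_span_ofD[OF IH(3) r1v that])
      have vf': "ip p v e = 0" if "e \<in> set fs'" for e by (rule in_span_ofD[OF IH(4) vr2 that])
      have fe': "ip p f e = 0" if "e \<in> set es'" for e by (rule in_span_ofD[OF IH(3) fr1 that])
      have ff': "ip p f e = 0" if "e \<in> set fs'" for e by (rule in_span_ofD[OF IH(4) r2f that])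
      have "orthonormal_list p (v # es')" "orthonormal_list p (f # fs')"
        using IH(1,2) ve' ff' vv ff by (simp_all add: orthonormal_list_def)
      moreover have sp: "in_span_of p (a # bs) cs"
        if "in_span_of p bs as" "in_span_of p (a # as) cs" for a as bs cs
      proof (rule in_span_ofI)
        fix z e assume z: "\<And>e. e \<in> set cs \<Longrightarrow> ip p z e = 0" and e: "e \<in> set (a # bs)"
        have zr: "ip p z y = 0" if "y \<in> set (a # as)" for y
          by (rule in_span_ofD[OF \<open>in_span_of p (a # as) cs\<close> z that])
        have "ip p z y = 0" if "y \<in> set bs" for y
          by (rule in_span_ofD[OF \<open>in_span_of p bs as\<close> _ that]) (use zr in auto)
        then show "ip p z e = 0" using e zr by auto
      qed
      have "in_span_of p (v # es') es" "in_span_of p (f # fs') fs"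
        using sp[OF IH(3) r1(3)] sp[OF IH(4) r2(3)] by auto
      moreover have "biorthogonal p (v # es') (f # fs')"
        unfolding biorthogonal_def
      proof (intro allI impI)
        fix k l assume kl: "k < length (v # es')" "l < length (f # fs')" "k \<noteq> l"
        have *: "ip p e f = 0" if "e \<in> set es'" for e
          using fe'[OF that] ip_commute[of p e f] by simp
        show "ip p ((v # es') ! k) ((f # fs') ! l) = 0"
          using kl IH(5) vf' * unfolding biorthogonal_def by (cases k; cases l) auto
      qed
      moreover have "wedge_list p es K = lam1 * lam * wedge_list p (v # es') K" for K
        using r1(4) wedge_list_Cons_scale[OF IH(6)] by simp
      moreover have "wedge_list p fs K = mu1 * mu * wedge_list p (f # fs') K" for K
        using r2(4) wedge_list_Cons_scale[OF IH(7)] by simp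
      ultimately show ?thesis by blast
    qed
  qed
qed

lemma principal_vectors:
  obtains es fs lam mu where "orthonormal_list p es" "orthonormal_list p fs" "biorthogonal p es fs"
    "\<And>K. wedge_list p xs K = lam * wedge_list p es K"
    "\<And>K. wedge_list p ys K = mu * wedge_list p fs K"
proof -
  obtain lam1 es1 where 1: "orthonormal_list p es1"
    "\<And>K. wedge_list p xs K = lam1 * wedge_list p es1 K" using gram_schmidt[of p xs] by blast
  obtain mu1 fs1 where 2: "orthonormal_list p fs1"
    "\<And>K. wedge_list p ys K = mu1 * wedge_list p fs1 K" using gram_schmidt[of p ys] by blast
  obtain es fs lam mu where 3: "orthonormal_list p es" "orthonormal_list p fs" "biorthogonal p es fs"
    "\<And>K. wedge_list p es1 K = lam * wedge_list p es K"
    "\<And>K. wedge_list p fs1 K = mu * wedge_list p fs K"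
    using orthonormal_lists_biorthogonal[OF 1(1) 2(1)] by blast
  show ?thesis
    by (rule that[OF 3(1-3), of "lam1 * lam" "mu1 * mu"]) (simp_all add: 1(2) 2(2) 3(4,5))
qed

section \<open>The quadratic inequality behind the defect term\<close>

definition cr :: "real \<times> real \<Rightarrow> real \<times> real \<Rightarrow> real" where
  "cr x y = fst x * snd y - snd x * fst y"

text \<open>The expression is affine in \<open>\<rho>\<close>, and a sum of squares both at \<open>\<rho> = 0\<close> and, by the Pluecker
  relation \<open>pl\<close>, at \<open>\<rho> = 1\<close>.\<close>

lemma defect_pair_nonneg:
  fixes a1 a2 c d p q r r' dc dd \<rho> :: real
  assumes a: "0 \<le> a1" "a1 \<le> 1" "0 \<le> a2" "a2 \<le> 1" and \<rho>: "0 \<le> \<rho>" "\<rho> \<le> 1"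
    and pl: "p * q - r * r' = dc * dd"
  defines "H \<equiv> q - d * r' - c * r + c * d * p" and "K \<equiv> p - d * r - c * r' + c * d * q"
  shows "0 \<le> a1 * p\<^sup>2 + a2 * q\<^sup>2 - a1 * a2 * (p\<^sup>2 + q\<^sup>2 - r\<^sup>2 - r'\<^sup>2)
    - a1 * a2 * \<rho> * ((1 - c\<^sup>2) * (1 - d\<^sup>2) * p\<^sup>2 + (1 - c\<^sup>2) * (r - d * p)\<^sup>2
        + (1 - d\<^sup>2) * (r' - c * p)\<^sup>2 + H\<^sup>2)
    + a1\<^sup>2 * a2 * \<rho> * H\<^sup>2 + a1 * a2\<^sup>2 * \<rho> * K\<^sup>2 + a1 * a2 * \<rho> * (dc\<^sup>2 * d\<^sup>2 + dd\<^sup>2 * c\<^sup>2)"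
    (is "0 \<le> ?F")
proof -
  \<comment> \<open>The values at \<open>\<rho>\<close> = 0 and \<open>\<rho>\<close> = 1. In the
    application \<open>p\<close>, \<open>q\<close>, \<open>r\<close>, \<open>r'\<close> are the
    minors \<open>cr\<close> of the pairs (u k, u l), (v k, v l), (u k, v l), (v k, u l), while
    \<open>dc\<close> and \<open>dd\<close> are those of (u k, v k) and (u l, v l).\<close>
  define E0 where "E0 = a1 * (1 - a2) * p\<^sup>2 + a2 * (1 - a1) * q\<^sup>2 + a1 * a2 * (r\<^sup>2 + r'\<^sup>2)"
  define E1 where "E1 = a1 * (p - a2 * K)\<^sup>2 + a2 * (q - a1 * H)\<^sup>2 + a1 * a2 * (dc * d + dd * c)\<^sup>2"
  have "(dc * d + dd * c)\<^sup>2 = dc\<^sup>2 * d\<^sup>2 + dd\<^sup>2 * c\<^sup>2 + 2 * c * d * (p * q - r * r')"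
    unfolding pl by (simp add: power2_eq_square algebra_simps)
  then have "?F = (1 - \<rho>) * E0 + \<rho> * E1"
    unfolding E0_def E1_def H_def K_def by (simp only:) (simp add: power2_eq_square algebra_simps)
  moreover have "0 \<le> E0" "0 \<le> E1" using a by (auto simp: E0_def E1_def)
  ultimately show ?thesis using \<rho> by simp
qed

lemma prod_one_plus_ge:
  fixes t :: "'a \<Rightarrow> real"
  assumes "finite A" "\<And>i. i \<in> A \<Longrightarrow> 0 \<le> t i"
  shows "1 + (\<Sum>i\<in>A. t i) \<le> (\<Prod>i\<in>A. 1 + t i)"
  using assms
proof (induction A rule: finite_induct)
  case (insert x A)
  then have IH: "1 + (\<Sum>i\<in>A. t i) \<le> (\<Prod>i\<in>A. 1 + t i)" and tx: "0 \<le> t x" by auto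
  have "1 + (\<Sum>i\<in>A. t i) + t x \<le> (1 + t x) * (1 + (\<Sum>i\<in>A. t i))"
    using tx insert.prems by (simp add: algebra_simps sum_nonneg)
  also have "\<dots> \<le> (1 + t x) * (\<Prod>i\<in>A. 1 + t i)"
    using IH tx by (intro mult_left_mono) auto
  finally show ?case using insert.hyps by (simp add: add.commute)
qed simp

text \<open>Lagrange's identity in polarised form. The left side is the mixed discriminant of two
  weighted sums of rank-one 2 by 2 matrices; when both sums agree it is twice the
  determinant.\<close>

lemma det_weighted_sum:
  fixes x y :: "'a \<Rightarrow> real \<times> real"
  shows "(\<Sum>k\<in>A. f k * (fst (x k))\<^sup>2) * (\<Sum>l\<in>B. g l * (snd (y l))\<^sup>2)
     + (\<Sum>k\<in>A. f k * (snd (x k))\<^sup>2) * (\<Sum>l\<in>B. g l * (fst (y l))\<^sup>2)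
     - 2 * ((\<Sum>k\<in>A. f k * (fst (x k) * snd (x k))) * (\<Sum>l\<in>B. g l * (fst (y l) * snd (y l))))
     = (\<Sum>k\<in>A. \<Sum>l\<in>B. f k * g l * (cr (x k) (y l))\<^sup>2)"
  unfolding sum_product
  unfolding sum_distrib_left sum.distrib[symmetric] sum_subtractf[symmetric]
  by (intro sum.cong refl) (simp add: cr_def power2_eq_square algebra_simps)

definition det2 :: "real \<Rightarrow> real \<Rightarrow> real \<Rightarrow> real" where
  "det2 a b c = a * b - c\<^sup>2"

text \<open>Writing each determinant as a double sum over \<open>k\<close> and \<open>l\<close>, the pairs \<open>k \<noteq> l\<close> are nonnegative after
  adding the terms \<open>R k l\<close>; these are paid for by the diagonal, because
  \<open>\<Prod>(1 + t\<^sub>l) \<ge> 1 + \<Sum>t\<^sub>l\<close> for \<open>t\<^sub>l = c\<^sub>l\<^sup>2 / s\<^sub>l\<close>.\<close>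

lemma defect_nonneg:
  fixes a1 a2 :: real and c u1 u2 v1 v2 :: "nat \<Rightarrow> real"
  assumes a: "0 \<le> a1" "a1 \<le> 1" "0 \<le> a2" "a2 \<le> 1" and c: "\<And>k. k < n \<Longrightarrow> (c k)\<^sup>2 \<le> 1"
  defines "s \<equiv> \<lambda>k. 1 - (c k)\<^sup>2"
  defines "h1 \<equiv> \<lambda>k. v1 k - c k * u1 k" and "h2 \<equiv> \<lambda>k. v2 k - c k * u2 k"
  defines "P \<equiv> (\<Prod>k<n. s k)"
  defines "U11 \<equiv> (\<Sum>k<n. (u1 k)\<^sup>2)" and "U22 \<equiv> (\<Sum>k<n. (u2 k)\<^sup>2)" and "U12 \<equiv> (\<Sum>k<n. u1 k * u2 k)"
  defines "V11 \<equiv> (\<Sum>k<n. (v1 k)\<^sup>2)" and "V22 \<equiv> (\<Sum>k<n. (v2 k)\<^sup>2)" and "V12 \<equiv> (\<Sum>k<n. v1 k * v2 k)"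
  defines "H11 \<equiv> (\<Sum>k<n. (h1 k)\<^sup>2 / s k)" and "H22 \<equiv> (\<Sum>k<n. (h2 k)\<^sup>2 / s k)"
    and "H12 \<equiv> (\<Sum>k<n. h1 k * h2 k / s k)"
  shows "0 \<le> a1 * det2 U11 U22 U12 + a2 * det2 V11 V22 V12
    - a1 * a2 * P * det2 (U11 + H11) (U22 + H22) (U12 + H12)
    - a1 * a2 * det2 (V11 - U11) (V22 - U22) (V12 - U12)
    + a1\<^sup>2 * a2 * P * det2 H11 H22 H12
    + a1 * a2\<^sup>2 * P * det2 (U11 + H11 - V11) (U22 + H22 - V22) (U12 + H12 - V12)"
    (is "0 \<le> ?L")
proof -
  define u where "u k = (u1 k, u2 k)" for k
  define v where "v k = (v1 k, v2 k)" for k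
  define h where "h k = (h1 k, h2 k)" for k
  define g where "g k = (u1 k - c k * v1 k, u2 k - c k * v2 k)" for k
  define G11 where "G11 = (\<Sum>k<n. (fst (g k))\<^sup>2 / s k)"
  define G22 where "G22 = (\<Sum>k<n. (snd (g k))\<^sup>2 / s k)"
  define G12 where "G12 = (\<Sum>k<n. fst (g k) * snd (g k) / s k)"
  have s0: "0 \<le> s k" "s k \<le> 1" if "k < n" for k using c[OF that] by (auto simp: s_def)
  have P: "0 \<le> P" unfolding P_def using s0 by (intro prod_nonneg) auto
  let ?SS = "\<lambda>F :: nat \<Rightarrow> nat \<Rightarrow> real. \<Sum>k<n. \<Sum>l<n. F k l"
  have dUU: "2 * det2 U11 U22 U12 = ?SS (\<lambda>k l. (cr (u k) (u l))\<^sup>2)"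
    using det_weighted_sum[where f = "\<lambda>_. 1" and g = "\<lambda>_. 1" and x = u and y = u and A = "{..<n}" and B = "{..<n}"]
    by (simp add: det2_def u_def U11_def U22_def U12_def algebra_simps power2_eq_square)
  have dVV: "2 * det2 V11 V22 V12 = ?SS (\<lambda>k l. (cr (v k) (v l))\<^sup>2)"
    using det_weighted_sum[where f = "\<lambda>_. 1" and g = "\<lambda>_. 1" and x = v and y = v and A = "{..<n}" and B = "{..<n}"]
    by (simp add: det2_def v_def V11_def V22_def V12_def algebra_simps power2_eq_square)
  have mUV: "U11 * V22 + U22 * V11 - 2 * (U12 * V12) = ?SS (\<lambda>k l. (cr (u k) (v l))\<^sup>2)"
    using det_weighted_sum[where f = "\<lambda>_. 1" and g = "\<lambda>_. 1" and x = u and y = v and A = "{..<n}" and B = "{..<n}"]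
    by (simp add: u_def v_def U11_def U22_def U12_def V11_def V22_def V12_def)
  have mUH: "U11 * H22 + U22 * H11 - 2 * (U12 * H12) = ?SS (\<lambda>k l. (cr (u k) (h l))\<^sup>2 / s l)"
    using det_weighted_sum[where f = "\<lambda>_. 1" and g = "\<lambda>k. 1 / s k" and x = u and y = h and A = "{..<n}" and B = "{..<n}"]
    by (simp add: u_def h_def U11_def U22_def U12_def H11_def H22_def H12_def)
  have dHH: "2 * det2 H11 H22 H12 = ?SS (\<lambda>k l. (cr (h k) (h l))\<^sup>2 / (s k * s l))"
    using det_weighted_sum[where f = "\<lambda>k. 1 / s k" and g = "\<lambda>k. 1 / s k" and x = h and y = h and A = "{..<n}" and B = "{..<n}"]
    by (simp add: det2_def h_def H11_def H22_def H12_def power2_eq_square)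
  have dGG: "2 * det2 G11 G22 G12 = ?SS (\<lambda>k l. (cr (g k) (g l))\<^sup>2 / (s k * s l))"
    using det_weighted_sum[where f = "\<lambda>k. 1 / s k" and g = "\<lambda>k. 1 / s k" and x = g and y = g and A = "{..<n}" and B = "{..<n}"]
    by (simp add: det2_def G11_def G22_def G12_def power2_eq_square)
  have SS0: "0 \<le> ?SS F" if "\<And>k l. k < n \<Longrightarrow> l < n \<Longrightarrow> 0 \<le> F k l" for F
    by (intro sum_nonneg) (use that in auto)
  have expU: "det2 (V11 - U11) (V22 - U22) (V12 - U12) = det2 V11 V22 V12 + det2 U11 U22 U12
      - (U11 * V22 + U22 * V11 - 2 * (U12 * V12))"
    by (simp add: det2_def power2_eq_square algebra_simps)
  have expH: "det2 (U11 + H11) (U22 + H22) (U12 + H12) = det2 U11 U22 U12 + det2 H11 H22 H12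
      + (U11 * H22 + U22 * H11 - 2 * (U12 * H12))"
    by (simp add: det2_def power2_eq_square algebra_simps)
  show ?thesis
  \<comment> \<open>If \<open>P\<close> is 0, some \<open>s k\<close> is 0 and the quotients by it
    are mere default values. They occur only in terms with the factor \<open>P\<close>, and what
    remains is visibly nonnegative.\<close>
  proof (cases "P = 0")
    case True
    have "?L = a1 * (1 - a2) * det2 U11 U22 U12 + a2 * (1 - a1) * det2 V11 V22 V12
        + a1 * a2 * (U11 * V22 + U22 * V11 - 2 * (U12 * V12))"
      unfolding expU True by (simp add: algebra_simps)
    moreover have "0 \<le> det2 U11 U22 U12" "0 \<le> det2 V11 V22 V12"
      "0 \<le> U11 * V22 + U22 * V11 - 2 * (U12 * V12)"
      using SS0[of "\<lambda>k l. (cr (u k) (u l))\<^sup>2"] SS0[of "\<lambda>k l. (cr (v k) (v l))\<^sup>2"]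
        SS0[of "\<lambda>k l. (cr (u k) (v l))\<^sup>2"] dUU dVV mUV by auto
    ultimately show ?thesis using a by simp
  next
    case False
    have sp: "0 < s k" if "k < n" for k
    proof -
      have "s k \<noteq> 0" using False that by (auto simp: P_def)
      then show ?thesis using s0[OF that] by simp
    qed
    \<comment> \<open>\<open>U + H\<close> is symmetric in \<open>u\<close> and \<open>v\<close>:
      orthogonalising the two families in either order gives the same form.\<close>
    have K: "U11 + H11 - V11 = G11" "U22 + H22 - V22 = G22" "U12 + H12 - V12 = G12"
      unfolding U11_def U22_def U12_def H11_def H22_def H12_def V11_def V22_def V12_def
        G11_def G22_def G12_def sum.distrib[symmetric] sum_subtractf[symmetric]
      using sp by (auto intro!: sum.cong simp: g_def h1_def h2_def field_simps s_def power2_eq_square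
          less_imp_neq[THEN not_sym])
    \<comment> \<open>The summands of the doubled expression. The mixed terms make \<open>T\<close>
      unsymmetric, so below it is always \<open>T k l + T l k\<close> that is estimated.\<close>
    define T where "T k l = a1 * (cr (u k) (u l))\<^sup>2 + a2 * (cr (v k) (v l))\<^sup>2
      - a1 * a2 * P * ((cr (u k) (u l))\<^sup>2 + 2 * ((cr (u k) (h l))\<^sup>2 / s l) + (cr (h k) (h l))\<^sup>2 / (s k * s l))
      - a1 * a2 * ((cr (v k) (v l))\<^sup>2 + (cr (u k) (u l))\<^sup>2 - 2 * (cr (u k) (v l))\<^sup>2)
      + a1\<^sup>2 * a2 * P * ((cr (h k) (h l))\<^sup>2 / (s k * s l))
      + a1 * a2\<^sup>2 * P * ((cr (g k) (g l))\<^sup>2 / (s k * s l))" for k l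
    have L2: "2 * ?L = ?SS T"
    proof -
      have "2 * ?L = a1 * (2 * det2 U11 U22 U12) + a2 * (2 * det2 V11 V22 V12)
        - a1 * a2 * P * (2 * det2 U11 U22 U12 + 2 * (U11 * H22 + U22 * H11 - 2 * (U12 * H12)) + 2 * det2 H11 H22 H12)
        - a1 * a2 * (2 * det2 V11 V22 V12 + 2 * det2 U11 U22 U12 - 2 * (U11 * V22 + U22 * V11 - 2 * (U12 * V12)))
        + a1\<^sup>2 * a2 * P * (2 * det2 H11 H22 H12) + a1 * a2\<^sup>2 * P * (2 * det2 G11 G22 G12)"
        unfolding expU expH K by (simp add: algebra_simps)
      also have "\<dots> = ?SS T"
        unfolding dUU dVV mUV mUH dHH dGG T_def
        by (simp only: sum.distrib sum_subtractf sum_distrib_left[symmetric])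
      finally show ?thesis .
    qed
    define d where "d k = cr (u k) (v k)" for k
    define R where "R k l = a1 * a2 * (P / (s k * s l)) * ((d k)\<^sup>2 * (c l)\<^sup>2 + (d l)\<^sup>2 * (c k)\<^sup>2)" for k l
    have Pfac: "P = s k * prod s ({..<n} - {k})" if "k < n" for k
      unfolding P_def using that by (subst prod.remove[of _ k]) auto
    have off: "0 \<le> T k l + T l k + 2 * R k l" if kl: "k < n" "l < n" "k \<noteq> l" for k l
    proof -
      \<comment> \<open>This is the product of \<open>s\<close> over the indices other than
        \<open>k\<close> and \<open>l\<close>, hence a number in [0,1] as the pair inequality
        requires.\<close>
      define \<rho> where "\<rho> = P / (s k * s l)"
      have "prod s ({..<n} - {k}) = s l * prod s ({..<n} - {k} - {l})"
        using kl by (subst prod.remove[of _ l]) auto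
      then have \<rho>': "\<rho> = prod s ({..<n} - {k} - {l})"
        unfolding \<rho>_def Pfac[OF kl(1)] using sp[OF kl(1)] sp[OF kl(2)] by simp
      have \<rho>: "0 \<le> \<rho>" "\<rho> \<le> 1" unfolding \<rho>'
        using s0 by (auto intro!: prod_nonneg prod_le_1)
      have P\<rho>: "P = \<rho> * s k * s l" unfolding \<rho>_def using sp[OF kl(1)] sp[OF kl(2)] by simp
      have "0 \<le> a1 * (cr (u k) (u l))\<^sup>2 + a2 * (cr (v k) (v l))\<^sup>2
          - a1 * a2 * ((cr (u k) (u l))\<^sup>2 + (cr (v k) (v l))\<^sup>2 - (cr (u k) (v l))\<^sup>2 - (cr (v k) (u l))\<^sup>2)
          - a1 * a2 * \<rho> * ((1 - (c k)\<^sup>2) * (1 - (c l)\<^sup>2) * (cr (u k) (u l))\<^sup>2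
             + (1 - (c k)\<^sup>2) * (cr (u k) (v l) - c l * cr (u k) (u l))\<^sup>2
             + (1 - (c l)\<^sup>2) * (cr (v k) (u l) - c k * cr (u k) (u l))\<^sup>2
             + (cr (v k) (v l) - c l * cr (v k) (u l) - c k * cr (u k) (v l) + c k * c l * cr (u k) (u l))\<^sup>2)
          + a1\<^sup>2 * a2 * \<rho> * (cr (v k) (v l) - c l * cr (v k) (u l) - c k * cr (u k) (v l) + c k * c l * cr (u k) (u l))\<^sup>2
          + a1 * a2\<^sup>2 * \<rho> * (cr (u k) (u l) - c l * cr (u k) (v l) - c k * cr (v k) (u l) + c k * c l * cr (v k) (v l))\<^sup>2
          + a1 * a2 * \<rho> * ((d k)\<^sup>2 * (c l)\<^sup>2 + (d l)\<^sup>2 * (c k)\<^sup>2)" (is "0 \<le> ?F")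
        by (rule defect_pair_nonneg[OF a \<rho>]) (simp add: d_def cr_def algebra_simps)
      moreover have "T k l + T l k + 2 * R k l = 2 * ?F"
      proof -
        have e1: "cr (h k) (h l) = cr (v k) (v l) - c l * cr (v k) (u l) - c k * cr (u k) (v l) + c k * c l * cr (u k) (u l)"
          "cr (g k) (g l) = cr (u k) (u l) - c l * cr (u k) (v l) - c k * cr (v k) (u l) + c k * c l * cr (v k) (v l)"
          "cr (u k) (h l) = cr (u k) (v l) - c l * cr (u k) (u l)"
          "cr (u l) (h k) = - (cr (v k) (u l) - c k * cr (u k) (u l))"
          by (simp_all add: cr_def h_def g_def u_def v_def h1_def h2_def algebra_simps)
        have e2: "cr (h l) (h k) = - cr (h k) (h l)" "cr (g l) (g k) = - cr (g k) (g l)"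
          "cr (u l) (u k) = - cr (u k) (u l)" "cr (v l) (v k) = - cr (v k) (v l)"
          "cr (u l) (v k) = - cr (v k) (u l)"
          by (simp_all add: cr_def algebra_simps)
        have Pd: "P * (X / (s k * s l)) = \<rho> * X" "P * (X / (s l * s k)) = \<rho> * X"
          "P * (X / s l) = \<rho> * s k * X" "P * (X / s k) = \<rho> * s l * X" for X
          using sp[OF kl(1)] sp[OF kl(2)] by (simp_all add: P\<rho>)
        have Tk: "T k l = a1 * (cr (u k) (u l))\<^sup>2 + a2 * (cr (v k) (v l))\<^sup>2
          - a1 * a2 * (P * (cr (u k) (u l))\<^sup>2 + 2 * (P * ((cr (u k) (h l))\<^sup>2 / s l)) + P * ((cr (h k) (h l))\<^sup>2 / (s k * s l)))
          - a1 * a2 * ((cr (v k) (v l))\<^sup>2 + (cr (u k) (u l))\<^sup>2 - 2 * (cr (u k) (v l))\<^sup>2)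
          + a1\<^sup>2 * a2 * (P * ((cr (h k) (h l))\<^sup>2 / (s k * s l)))
          + a1 * a2\<^sup>2 * (P * ((cr (g k) (g l))\<^sup>2 / (s k * s l)))" for k l
          unfolding T_def by (simp add: algebra_simps)
        show ?thesis
          unfolding Tk R_def Pd \<rho>_def[symmetric] e2 e1(3,4) unfolding e1(1,2)
          unfolding P\<rho> s_def power2_minus by (simp only: algebra_simps)
      qed
      ultimately show ?thesis by simp
    qed
    \<comment> \<open>The cost \<open>R k l\<close> is divided: its summand with
      \<open>(d k)\<^sup>2\<close> is charged to the diagonal term of \<open>k\<close>, the other
      one to that of \<open>l\<close>. The factor 2 arises because the sum of \<open>R\<close> over
      ordered pairs collects each share twice.\<close>
    have diag: "0 \<le> T k k - 2 * (\<Sum>l\<in>{..<n}-{k}. a1 * a2 * (P / (s k * s l)) * ((d k)\<^sup>2 * (c l)\<^sup>2))"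
      if k: "k < n" for k
    proof -
      define Q where "Q = prod s ({..<n} - {k})"
      have Q: "0 < Q" unfolding Q_def using sp by (auto intro!: prod_pos)
      have PQ: "P = s k * Q" using Pfac[OF k] by (simp add: Q_def)
      have crz: "cr x x = 0" for x by (simp add: cr_def)
      have uh: "cr (u k) (h k) = d k" by (simp add: d_def cr_def u_def v_def h_def h1_def h2_def algebra_simps)
      have Tkk: "T k k = 2 * (a1 * a2 * (d k)\<^sup>2) * (1 - Q)"
        unfolding T_def crz uh d_def[symmetric] PQ using sp[OF k] by (simp add: field_simps)
      have "1 + (\<Sum>l\<in>{..<n}-{k}. (c l)\<^sup>2 / s l) \<le> (\<Prod>l\<in>{..<n}-{k}. 1 + (c l)\<^sup>2 / s l)"
        using s0 by (intro prod_one_plus_ge) auto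
      also have "\<dots> = (\<Prod>l\<in>{..<n}-{k}. 1 / s l)"
        using sp by (intro prod.cong refl) (auto simp: field_simps s_def less_imp_neq[THEN not_sym])
      also have "\<dots> = 1 / Q" by (simp add: Q_def prod_dividef)
      finally have "Q * (1 + (\<Sum>l\<in>{..<n}-{k}. (c l)\<^sup>2 / s l)) \<le> 1"
        using Q by (simp add: field_simps)
      then have *: "0 \<le> 1 - Q - Q * (\<Sum>l\<in>{..<n}-{k}. (c l)\<^sup>2 / s l)" by (simp add: algebra_simps)
      have "(\<Sum>l\<in>{..<n}-{k}. a1 * a2 * (P / (s k * s l)) * ((d k)\<^sup>2 * (c l)\<^sup>2))
          = a1 * a2 * (d k)\<^sup>2 * (Q * (\<Sum>l\<in>{..<n}-{k}. (c l)\<^sup>2 / s l))"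
        unfolding sum_distrib_left PQ using sp[OF k] by (intro sum.cong refl) simp
      then have "T k k - 2 * (\<Sum>l\<in>{..<n}-{k}. a1 * a2 * (P / (s k * s l)) * ((d k)\<^sup>2 * (c l)\<^sup>2))
        = 2 * (a1 * a2 * (d k)\<^sup>2) * (1 - Q - Q * (\<Sum>l\<in>{..<n}-{k}. (c l)\<^sup>2 / s l))"
        unfolding Tkk by (simp only:) (simp add: algebra_simps)
      then show ?thesis using * a by simp
    qed
    let ?D = "\<lambda>k l. if k = l then T k k else 0"
    define S where "S k l = (if k = l then 0 else a1 * a2 * (P / (s k * s l)) * ((d k)\<^sup>2 * (c l)\<^sup>2))" for k l
    define O' where "O' k l = (if k = l then 0 else T k l)" for k l
    have "?SS O' + ?SS O' = ?SS O' + ?SS (\<lambda>k l. O' l k)"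
      by (subst (2) sum.swap) (rule refl)
    moreover have "?SS S + ?SS S = ?SS S + ?SS (\<lambda>k l. S l k)"
      by (subst (2) sum.swap) (rule refl)
    ultimately have "2 * (?SS O' + 2 * ?SS S) = ?SS (\<lambda>k l. O' k l + O' l k + 2 * (S k l + S l k))"
      by (simp add: sum.distrib sum_distrib_left[symmetric])
    also have "\<dots> \<ge> 0"
    proof (rule SS0)
      fix k l assume kl: "k < n" "l < n"
      show "0 \<le> O' k l + O' l k + 2 * (S k l + S l k)"
      proof (cases "k = l")
        case False
        have "S k l + S l k = R k l"
          using False by (simp add: S_def R_def algebra_simps)
        then show ?thesis using off[OF kl False] False by (simp add: O'_def)
      qed (simp add: O'_def S_def)
    qed
    finally have off': "0 \<le> ?SS O' + 2 * ?SS S" by simp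
    have "0 \<le> (\<Sum>k<n. T k k - 2 * (\<Sum>l<n. S k l))"
    proof (rule sum_nonneg)
      fix k assume "k \<in> {..<n}"
      then have k: "k < n" by simp
      have "(\<Sum>l<n. S k l) = (\<Sum>l\<in>{..<n}-{k}. a1 * a2 * (P / (s k * s l)) * ((d k)\<^sup>2 * (c l)\<^sup>2))"
        by (rule sum.mono_neutral_cong_right) (auto simp: S_def)
      then show "0 \<le> T k k - 2 * (\<Sum>l<n. S k l)" using diag[OF k] by simp
    qed
    then have "0 \<le> (\<Sum>k<n. T k k) - 2 * ?SS S"
      by (simp add: sum_subtractf sum_distrib_left)
    moreover have "?SS T = (\<Sum>k<n. T k k) + ?SS O'"
    proof -
      have "?SS T = ?SS (\<lambda>k l. ?D k l + O' k l)"
        by (intro sum.cong refl) (auto simp: O'_def)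
      also have "\<dots> = ?SS ?D + ?SS O'" by (simp only: sum.distrib)
      also have "?SS ?D = (\<Sum>k<n. T k k)" by (intro sum.cong refl) (simp add: sum.delta)
      finally show ?thesis .
    qed
    ultimately have "0 \<le> ?SS T" using off' by linarith
    then have "0 \<le> 2 * ?L" unfolding L2 .
    then show ?thesis unfolding zero_le_mult_iff by simp
  qed
qed

section \<open>The excluded Gram form\<close>

text \<open>Padding by the zero vector lets both lists be indexed by one range. A padded pair has
  cosine 0, hence contributes the factor 1 to the product of the
  \<open>1 - (c k)\<^sup>2\<close>.\<close>

definition nth0 :: "(nat \<Rightarrow> real) list \<Rightarrow> nat \<Rightarrow> nat \<Rightarrow> real" where
  "nth0 es k = (if k < length es then es ! k else (\<lambda>_. 0))"

lemma sum_list_nth0: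
  fixes g :: "(nat \<Rightarrow> real) \<Rightarrow> real"
  assumes "length es \<le> n" "g (\<lambda>_. 0) = 0"
  shows "(\<Sum>e\<leftarrow>es. g e) = (\<Sum>k<n. g (nth0 es k))"
proof -
  have "(\<Sum>e\<leftarrow>es. g e) = (\<Sum>k<length es. g (es ! k))"
    by (simp add: sum_list_sum_nth atLeast0LessThan)
  also have "\<dots> = (\<Sum>k<n. g (nth0 es k))"
    by (rule sum.mono_neutral_cong_left) (use assms in \<open>auto simp: nth0_def\<close>)
  finally show ?thesis .
qed

lemma prod_list_nth0:
  fixes g :: "(nat \<Rightarrow> real) \<Rightarrow> real"
  assumes "length es \<le> n"
  shows "(\<Prod>e\<leftarrow>es. g e) = (\<Prod>k<n. if k < length es then g (nth0 es k) else 1)"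
proof -
  have "(\<Prod>e\<leftarrow>es. g e) = (\<Prod>k<length es. g (es ! k))"
    by (simp add: prod.list_conv_set_nth atLeast0LessThan)
  also have "\<dots> = (\<Prod>k<n. if k < length es then g (nth0 es k) else 1)"
    by (rule prod.mono_neutral_cong_left) (use assms in \<open>auto simp: nth0_def\<close>)
  finally show ?thesis .
qed

lemma gram_orthonormal:
  assumes "orthonormal_list p es"
  shows "gram p (es @ zs) (es @ zs') = gram p (map (perp p es) zs) (map (perp p es) zs')"
proof -
  have "(\<Prod>e\<leftarrow>es. ip p e e) = (\<Prod>e\<leftarrow>es. 1)"
    using assms by (intro arg_cong[where f = prod_list] map_cong) (auto simp: orthonormal_list_def)
  also have "\<dots> = 1" by (induction es) auto
  finally show ?thesis
    using assms gram_perp[of p es zs zs'] by (simp add: orthonormal_list_def)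
qed

lemma ip_perp_orthonormal:
  assumes "orthonormal_list p es" "length es \<le> n"
  shows "ip p (perp p es y) (perp p es y')
    = ip p y y' - (\<Sum>k<n. ip p (nth0 es k) y * ip p (nth0 es k) y')"
proof -
  have "(\<Sum>e\<leftarrow>es. ip p e y * ip p e y' / ip p e e) = (\<Sum>e\<leftarrow>es. ip p e y * ip p e y')"
    using assms by (intro arg_cong[where f = sum_list] map_cong) (auto simp: orthonormal_list_def)
  also have "\<dots> = (\<Sum>k<n. ip p (nth0 es k) y * ip p (nth0 es k) y')"
    by (rule sum_list_nth0[OF assms(2)]) simp
  finally show ?thesis
    using assms ip_perp[of p es y y'] by (simp add: orthonormal_list_def)
qed

lemma biorthogonal_nth0:
  assumes "biorthogonal p es fs" "k \<noteq> l"
  shows "ip p (nth0 es k) (nth0 fs l) = 0"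
  using assms by (auto simp: biorthogonal_def nth0_def)

text \<open>The projected vectors \<open>perp p es f\<close> are again orthogonal, with squared lengths
  \<open>1 - c\<^sup>2\<close> for the principal cosines \<open>c\<close>.\<close>

lemma gram_biorthogonal:
  assumes on: "orthonormal_list p es" "orthonormal_list p fs" and bi: "biorthogonal p es fs"
    and n: "length es \<le> n" "length fs \<le> n"
  defines "c \<equiv> \<lambda>k. ip p (nth0 es k) (nth0 fs k)"
  defines "h \<equiv> \<lambda>k y. ip p (nth0 fs k) y - c k * ip p (nth0 es k) y"
  shows "\<exists>Z. (\<forall>zs zs'. gram p (es @ fs @ zs) (es @ fs @ zs')
        = (\<Prod>k<n. 1 - (c k)\<^sup>2) * gram p (map Z zs) (map Z zs'))
    \<and> (\<forall>y y'. ip p (Z y) (Z y') = ip p y y'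
        - (\<Sum>k<n. ip p (nth0 es k) y * ip p (nth0 es k) y') - (\<Sum>k<n. h k y * h k y' / (1 - (c k)\<^sup>2)))"
    and "\<And>k. k < n \<Longrightarrow> (c k)\<^sup>2 \<le> 1"
proof -
  let ?P = "perp p es"
  define gs where "gs = map ?P fs"
  have sum1: "(\<Sum>j<n. ip p (nth0 es j) (nth0 fs k) * x j) = c k * x k" if "k < n" for k x
  proof -
    have "(\<Sum>j<n. ip p (nth0 es j) (nth0 fs k) * x j) = (\<Sum>j<n. if j = k then c k * x k else 0)"
      using biorthogonal_nth0[OF bi] by (intro sum.cong refl) (auto simp: c_def)
    then show ?thesis using that by simp
  qed
  have gy: "ip p (?P (nth0 fs k)) (?P y) = h k y" if "k < n" for k y
    unfolding ip_perp_orthonormal[OF on(1) n(1)] sum1[OF that] h_def ..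
  have gsk: "gs ! k = ?P (nth0 fs k)" if "k < length fs" for k
    using that by (simp add: gs_def nth0_def)
  have hf: "h k (nth0 fs l) = (if k = l then 1 - (c k)\<^sup>2 else 0)"
    if "k < length fs" "l < length fs" for k l
  proof (cases "k = l")
    case True
    then show ?thesis using that orthonormal_list_nth[OF on(2)]
      by (simp add: h_def c_def nth0_def power2_eq_square)
  next
    case False
      then have "ip p (nth0 fs k) (nth0 fs l) = 0"
      using that orthonormal_list_nth[OF on(2)] by (simp add: nth0_def)
    then show ?thesis using False biorthogonal_nth0[OF bi] by (simp add: h_def)
  qed
  have orth: "orthogonal_list p gs"
    unfolding sorted_wrt_iff_nth_less
  proof (intro allI impI)
    fix i j assume ij: "i < j" "j < length gs"
    then have l: "i < length fs" "j < length fs" by (auto simp: gs_def)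
    then show "ip p (gs ! i) (gs ! j) = 0"
      using hf[OF l] ij(1) gy[of i] n(2) by (simp add: gsk)
  qed
  have norms: "ip p (?P (nth0 fs k)) (?P (nth0 fs k)) = 1 - (c k)\<^sup>2" if "k < length fs" for k
    using hf[OF that that] gy[of k] that n(2) by simp
  have c0: "c k = 0" if "\<not> k < length fs" for k
    using that by (simp add: c_def nth0_def)
  have "(c k)\<^sup>2 \<le> 1" for k
  proof (cases "k < length fs")
    case True
    then show ?thesis using norms[OF True] ip_ge_0[of p "?P (nth0 fs k)"] by simp
  qed (simp add: c0)
  then show "\<And>k. k < n \<Longrightarrow> (c k)\<^sup>2 \<le> 1" by simp
  \<comment> \<open>First \<open>es\<close> is projected out, then what is left of
    \<open>fs\<close>. If \<open>(c k)\<^sup>2\<close> = 1, the projected vector is null, the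
    residual along it is the identity, and the matching quotient by 0 is 0 as well.\<close>
  define Z where "Z = (\<lambda>y. perp p gs (?P y))"
  have "(\<Prod>g\<leftarrow>gs. ip p g g) = (\<Prod>f\<leftarrow>fs. ip p (?P f) (?P f))"
    by (simp add: gs_def comp_def)
  also have "\<dots> = (\<Prod>k<n. if k < length fs then ip p (?P (nth0 fs k)) (?P (nth0 fs k)) else 1)"
    by (rule prod_list_nth0[OF n(2)])
  also have "\<dots> = (\<Prod>k<n. 1 - (c k)\<^sup>2)"
    by (intro prod.cong refl) (auto simp: norms c0)
  finally have prod: "(\<Prod>g\<leftarrow>gs. ip p g g) = (\<Prod>k<n. 1 - (c k)\<^sup>2)" .
  have "gram p (es @ fs @ zs) (es @ fs @ zs')
        = (\<Prod>k<n. 1 - (c k)\<^sup>2) * gram p (map Z zs) (map Z zs')" for zs zs'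
  proof -
    have "gram p (es @ fs @ zs) (es @ fs @ zs') = gram p (gs @ map ?P zs) (gs @ map ?P zs')"
      by (simp add: gram_orthonormal[OF on(1)] gs_def)
    then show ?thesis by (simp add: gram_perp[OF orth] prod Z_def comp_def)
  qed
  moreover have "ip p (Z y) (Z y') = ip p y y'
        - (\<Sum>k<n. ip p (nth0 es k) y * ip p (nth0 es k) y') - (\<Sum>k<n. h k y * h k y' / (1 - (c k)\<^sup>2))" for y y'
  proof -
    have "(\<Sum>g\<leftarrow>gs. ip p g (?P y) * ip p g (?P y') / ip p g g)
        = (\<Sum>f\<leftarrow>fs. ip p (?P f) (?P y) * ip p (?P f) (?P y') / ip p (?P f) (?P f))"
      by (simp add: gs_def comp_def)
    also have "\<dots> = (\<Sum>k<length fs. ip p (?P (fs ! k)) (?P y) * ip p (?P (fs ! k)) (?P y')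
        / ip p (?P (fs ! k)) (?P (fs ! k)))"
      by (simp add: sum_list_sum_nth atLeast0LessThan)
    also have "\<dots> = (\<Sum>k<n. h k y * h k y' / (1 - (c k)\<^sup>2))"
    proof (rule sum.mono_neutral_cong_left)
      show "\<forall>k\<in>{..<n} - {..<length fs}. h k y * h k y' / (1 - (c k)\<^sup>2) = 0"
        by (auto simp: h_def c0 nth0_def)
      fix k assume k: "k \<in> {..<length fs}"
      then have "fs ! k = nth0 fs k" by (simp add: nth0_def)
      then show "ip p (?P (fs ! k)) (?P y) * ip p (?P (fs ! k)) (?P y') / ip p (?P (fs ! k)) (?P (fs ! k))
          = h k y * h k y' / (1 - (c k)\<^sup>2)"
        using k n(2) norms[of k] gy[of k] by simp
    qed (use n in auto)
    finally show ?thesis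
      unfolding Z_def ip_perp[OF orth] ip_perp_orthonormal[OF on(1) n(1)] by simp
  qed
  ultimately show "\<exists>Z. (\<forall>zs zs'. gram p (es @ fs @ zs) (es @ fs @ zs')
        = (\<Prod>k<n. 1 - (c k)\<^sup>2) * gram p (map Z zs) (map Z zs'))
    \<and> (\<forall>y y'. ip p (Z y) (Z y') = ip p y y'
        - (\<Sum>k<n. ip p (nth0 es k) y * ip p (nth0 es k) y') - (\<Sum>k<n. h k y * h k y' / (1 - (c k)\<^sup>2)))"
    by blast
qed

text \<open>For \<open>zs = zs'\<close> consisting of rows of the process this is the probability that the rows of \<open>zs\<close>
  are all selected, but neither all of \<open>xs\<close> nor all of \<open>ys\<close>; for singletons it is \<open>q_form\<close>.\<close>

definition excl :: "nat \<Rightarrow> (nat \<Rightarrow> real) list \<Rightarrow> (nat \<Rightarrow> real) list \<Rightarrow>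
    (nat \<Rightarrow> real) list \<Rightarrow> (nat \<Rightarrow> real) list \<Rightarrow> real" where
  "excl p xs ys zs zs' = gram p zs zs' - gram p (xs @ zs) (xs @ zs') - gram p (ys @ zs) (ys @ zs')
     + gram p (xs @ ys @ zs) (xs @ ys @ zs')"

text \<open>On the plane of \<open>y\<close> and \<open>y'\<close> the form \<open>q\<close> is \<open>\<Sum>c\<^sub>i M\<^sub>i\<close> with \<open>c\<^sub>0 = 1\<close> and projections \<open>M\<^sub>i\<close>, while
  \<open>excl p xs ys [y, y'] [y, y']\<close> is \<open>\<Sum>c\<^sub>i det M\<^sub>i\<close>; this identity turns their comparison into determinants
  of differences of projections.\<close>

lemma det2_combination:
  "det2 (x0 + c1 * x1 + c2 * x2 + c3 * x3) (y0 + c1 * y1 + c2 * y2 + c3 * y3)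
      (z0 + c1 * z1 + c2 * z2 + c3 * z3)
    - (1 + c1 + c2 + c3) * (det2 x0 y0 z0 + c1 * det2 x1 y1 z1 + c2 * det2 x2 y2 z2 + c3 * det2 x3 y3 z3)
   = - (c1 * det2 (x0 - x1) (y0 - y1) (z0 - z1) + c2 * det2 (x0 - x2) (y0 - y2) (z0 - z2)
      + c3 * det2 (x0 - x3) (y0 - y3) (z0 - z3) + c1 * c2 * det2 (x1 - x2) (y1 - y2) (z1 - z2)
      + c1 * c3 * det2 (x1 - x3) (y1 - y3) (z1 - z3) + c2 * c3 * det2 (x2 - x3) (y2 - y3) (z2 - z3))"
  by (simp add: det2_def power2_eq_square algebra_simps)

text \<open>For rows \<open>y\<close>, \<open>y'\<close> of the process this is
  \<open>Lambda_g\<close> >= 0. The two hypotheses bound the squared scaling factors by 1, which is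
  the range covered by \<open>defect_nonneg\<close>.\<close>

theorem excl_pair_inequality:
  assumes "gram p xs xs \<le> 1" "gram p ys ys \<le> 1"
  shows "excl p xs ys [] [] * excl p xs ys [y, y'] [y, y']
    \<le> excl p xs ys [y] [y] * excl p xs ys [y'] [y'] - (excl p xs ys [y] [y'])\<^sup>2"
proof -
  obtain es fs lam mu where on: "orthonormal_list p es" "orthonormal_list p fs"
    and bi: "biorthogonal p es fs"
    and wx: "\<And>K. wedge_list p xs K = lam * wedge_list p es K"
    and wy: "\<And>K. wedge_list p ys K = mu * wedge_list p fs K"
    using principal_vectors by blast
  \<comment> \<open>These are the squared norms of the wedge products of \<open>xs\<close> and
    \<open>ys\<close>, because those of \<open>es\<close> and \<open>fs\<close> are 1.\<close>
  define a1 a2 where "a1 = lam\<^sup>2" and "a2 = mu\<^sup>2"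
  have wap: "wedge_list p (as @ zs) K = t * wedge_list p (bs @ zs) K"
    if "\<And>K. wedge_list p as K = t * wedge_list p bs K" for as bs zs t K
  proof -
    have "wedge_list p as = (\<lambda>K. t * wedge_list p bs K)" using that by blast
    then show ?thesis by (simp add: wedge_list_append ext_wedge_scale_left)
  qed
  have gx: "gram p (xs @ zs) (xs @ zs') = a1 * gram p (es @ zs) (es @ zs')" for zs zs'
    unfolding a1_def power2_eq_square by (rule gram_scale) (rule wap[OF wx])+
  have gy: "gram p (ys @ zs) (ys @ zs') = a2 * gram p (fs @ zs) (fs @ zs')" for zs zs'
    unfolding a2_def power2_eq_square by (rule gram_scale) (rule wap[OF wy])+
  have gxy: "gram p (xs @ ys @ zs) (xs @ ys @ zs') = a1 * a2 * gram p (es @ fs @ zs) (es @ fs @ zs')" for zs zs'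
  proof -
    have "wedge_list p (xs @ ys @ zs) K = lam * mu * wedge_list p (es @ fs @ zs) K" for zs K
    proof -
      have "wedge_list p (ys @ zs) = (\<lambda>K. mu * wedge_list p (fs @ zs) K)" using wap[OF wy] by blast
      then have "wedge_list p (es @ ys @ zs) K = mu * wedge_list p (es @ fs @ zs) K"
        by (simp add: wedge_list_append[of p es] ext_wedge_scale_right)
      then show ?thesis using wap[OF wx, of "ys @ zs" K] by simp
    qed
    then have "gram p (xs @ ys @ zs) (xs @ ys @ zs') = (lam * mu) * (lam * mu) * gram p (es @ fs @ zs) (es @ fs @ zs')"
      by (intro gram_scale)
    then show ?thesis by (simp add: a1_def a2_def power2_eq_square)
  qed
  have "gram p es es = 1" "gram p fs fs = 1"
    using gram_orthonormal[OF on(1), of "[]" "[]"] gram_orthonormal[OF on(2), of "[]" "[]"]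
    by (simp_all add: gram_Nil)
  then have a: "0 \<le> a1" "a1 \<le> 1" "0 \<le> a2" "a2 \<le> 1"
    using assms gx[of "[]" "[]"] gy[of "[]" "[]"] by (auto simp: a1_def a2_def)
  define n where "n = max (length es) (length fs)"
  have n: "length es \<le> n" "length fs \<le> n" by (auto simp: n_def)
  define c where "c k = ip p (nth0 es k) (nth0 fs k)" for k
  define P where "P = (\<Prod>k<n. 1 - (c k)\<^sup>2)"
  define H where "H y y' = (\<Sum>k<n. (ip p (nth0 fs k) y - c k * ip p (nth0 es k) y)
      * (ip p (nth0 fs k) y' - c k * ip p (nth0 es k) y') / (1 - (c k)\<^sup>2))" for y y'
  define U where "U y y' = (\<Sum>k<n. ip p (nth0 es k) y * ip p (nth0 es k) y')" for y y'
  define V where "V y y' = (\<Sum>k<n. ip p (nth0 fs k) y * ip p (nth0 fs k) y')" for y y'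
  note bio = gram_biorthogonal[OF on bi n, folded c_def]
  have c1: "\<And>k. k < n \<Longrightarrow> (c k)\<^sup>2 \<le> 1" by (rule bio(2))
  obtain Z where Z: "\<And>zs zs'. gram p (es @ fs @ zs) (es @ fs @ zs') = P * gram p (map Z zs) (map Z zs')"
    "\<And>y y'. ip p (Z y) (Z y') = ip p y y' - U y y' - H y y'"
    using bio(1) unfolding P_def U_def H_def by blast
  have E: "ip p (perp p es y) (perp p es y') = ip p y y' - U y y'"
    "ip p (perp p fs y) (perp p fs y') = ip p y y' - V y y'" for y y'
    unfolding U_def V_def by (rule ip_perp_orthonormal on n)+
  have sym: "ip p y' y = ip p y y'" "U y' y = U y y'" "V y' y = V y y'" "H y' y = H y y'"
    by (simp_all add: ip_commute[of p y' y] U_def V_def H_def mult.commute)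
  have exclE: "excl p xs ys zs zs' = gram p zs zs' - a1 * gram p (map (perp p es) zs) (map (perp p es) zs')
      - a2 * gram p (map (perp p fs) zs) (map (perp p fs) zs')
      + a1 * a2 * (P * gram p (map Z zs) (map Z zs'))" for zs zs'
    unfolding excl_def gxy Z(1)
    unfolding gx gy gram_orthonormal[OF on(1)] gram_orthonormal[OF on(2)] ..
  have e0: "excl p xs ys [] [] = 1 + (- a1) + (- a2) + a1 * a2 * P"
    unfolding exclE
    by (simp add: gram_Nil)
  have e1: "excl p xs ys [y] [y'] = ip p y y' + (- a1) * (ip p y y' - U y y')
      + (- a2) * (ip p y y' - V y y') + a1 * a2 * P * (ip p y y' - U y y' - H y y')" for y y'
    unfolding exclE
    by (simp add: gram_single E Z(2))
  have e2: "excl p xs ys [y, y'] [y, y'] = det2 (ip p y y) (ip p y' y') (ip p y y')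
      + (- a1) * det2 (ip p y y - U y y) (ip p y' y' - U y' y') (ip p y y' - U y y')
      + (- a2) * det2 (ip p y y - V y y) (ip p y' y' - V y' y') (ip p y y' - V y y')
      + a1 * a2 * P * det2 (ip p y y - U y y - H y y) (ip p y' y' - U y' y' - H y' y') (ip p y y' - U y y' - H y y')"
    unfolding exclE
    by (simp add: gram_pair E Z(2) det2_def power2_eq_square sym)
  \<comment> \<open>The six determinants belong to the pairwise differences of the forms
    \<open>ip\<close>, \<open>ip - U\<close>, \<open>ip - V\<close>, \<open>ip - U - H\<close>; the
    coefficients are the negatives of those in \<open>det2_combination\<close> for the weights 1,
    -a1, -a2 and a1 a2 P, with its outer minus sign taken in.\<close>
  have "0 \<le> a1 * det2 (U y y) (U y' y') (U y y') + a2 * det2 (V y y) (V y' y') (V y y')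
    - a1 * a2 * P * det2 (U y y + H y y) (U y' y' + H y' y') (U y y' + H y y')
    - a1 * a2 * det2 (V y y - U y y) (V y' y' - U y' y') (V y y' - U y y')
    + a1\<^sup>2 * a2 * P * det2 (H y y) (H y' y') (H y y')
    + a1 * a2\<^sup>2 * P * det2 (U y y + H y y - V y y) (U y' y' + H y' y' - V y' y') (U y y' + H y y' - V y y')"
    using defect_nonneg[OF a c1, where n = n and ?v1.0 = "\<lambda>k. ip p (nth0 fs k) y" and ?u1.0 = "\<lambda>k. ip p (nth0 es k) y"
        and ?v2.0 = "\<lambda>k. ip p (nth0 fs k) y'" and ?u2.0 = "\<lambda>k. ip p (nth0 es k) y'"]
    unfolding P_def U_def V_def H_def power2_eq_square by simp
  moreover have "det2 (excl p xs ys [y] [y]) (excl p xs ys [y'] [y']) (excl p xs ys [y] [y'])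
      - excl p xs ys [] [] * excl p xs ys [y, y'] [y, y'] = \<dots>"
    unfolding e0 e1 e2 det2_combination by (simp add: det2_def power2_eq_square algebra_simps)
  ultimately show ?thesis by (simp add: det2_def)
qed

section \<open>Inclusion probabilities\<close>

definition coords :: "(nat \<Rightarrow> real vec) \<Rightarrow> nat \<Rightarrow> nat \<Rightarrow> real" where
  "coords a i = (\<lambda>k. a k $ i)"

definition row_list :: "(nat \<Rightarrow> real vec) \<Rightarrow> nat set \<Rightarrow> (nat \<Rightarrow> real) list" where
  "row_list a B = map (coords a) (sorted_list_of_set B)"

lemma proc_vec_coords: "proc_vec p a i = Matrix.vec p (coords a i)"
  by (simp add: proc_vec_def coords_def)

lemma proc_wedge_row_list: "proc_wedge p a A = wedge_list p (row_list a A)"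
  by (simp add: proc_wedge_def wedge_list_def row_list_def proc_vec_coords cong: map_cong)

lemma wedge_list_nonzero:
  assumes "wedge_list p xs K \<noteq> 0" shows "K \<subseteq> {..<p}" "card K = length xs"
proof -
  have "set (map (Matrix.vec p) xs) \<subseteq> carrier_vec p" by auto
  from ext_list_nonzero[OF this, of K] assms
  show "K \<subseteq> {..<p}" "card K = length xs" by (simp_all add: wedge_list_def)
qed

text \<open>This is the recursion \<open>(p - |B|) P{B \<subseteq> \<phi>} = \<Sum> P{B \<union> {i} \<subseteq> \<phi>}\<close> on the side of Gram determinants.\<close>

lemma sum_ext_inner_tight_frame:
  fixes x :: "nat \<Rightarrow> nat \<Rightarrow> real"
  assumes frame: "\<And>k l. k < p \<Longrightarrow> l < p \<Longrightarrow> (\<Sum>i\<in>I. x i k * x i l) = (if k = l then 1 else 0)"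
    and u: "\<And>K. u K \<noteq> 0 \<Longrightarrow> card K = r" and r: "r \<le> p"
  shows "(\<Sum>i\<in>I. ext_inner p (ext_vec (Matrix.vec p (x i)) \<and>\<^sub>e u) (ext_vec (Matrix.vec p (x i)) \<and>\<^sub>e u))
    = (real p - real r) * ext_inner p u u"
proof -
  define g where "g k K = (-1) ^ card {j \<in> K. j < k} * u (K - {k})" for k K
  have gsq: "g k K * g k K = (u (K - {k}))\<^sup>2" for k K
  proof -
    have "(-1::real) ^ m * (-1) ^ m = 1" for m by (simp flip: power_add)
    then have "(-1::real) ^ m * z * ((-1) ^ m * z) = z * z" for m z
      by (metis mult.assoc mult.commute mult_1)
    then show ?thesis by (simp add: g_def power2_eq_square)
  qed
  have w: "(ext_vec (Matrix.vec p (x i)) \<and>\<^sub>e u) K = (\<Sum>k\<in>K. x i k * g k K)" if K: "K \<in> Pow {..<p}" for i K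
  proof -
    have "finite K" "K \<subseteq> {..<p}" using K finite_subset by auto
    then have "(ext_vec (Matrix.vec p (x i)) \<and>\<^sub>e u) K =
        (\<Sum>k\<in>K. (-1) ^ card {j \<in> K. j < k} * Matrix.vec p (x i) $ k * u (K - {k}))"
      by (intro ext_wedge_vec) auto
    also have "\<dots> = (\<Sum>k\<in>K. x i k * g k K)"
      using \<open>K \<subseteq> {..<p}\<close> by (intro sum.cong refl) (auto simp: g_def)
    finally show ?thesis .
  qed
  have K: "(\<Sum>i\<in>I. (\<Sum>k\<in>K. x i k * g k K) * (\<Sum>k\<in>K. x i k * g k K)) = (\<Sum>k\<in>K. (u (K - {k}))\<^sup>2)"
    if K: "K \<in> Pow {..<p}" for K
  proof -
    have fK: "finite K" using K finite_subset by auto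
    have "(\<Sum>i\<in>I. (\<Sum>k\<in>K. x i k * g k K) * (\<Sum>k\<in>K. x i k * g k K))
        = (\<Sum>i\<in>I. \<Sum>k\<in>K. \<Sum>l\<in>K. g k K * g l K * (x i k * x i l))"
      unfolding sum_product by (simp add: mult_ac)
    also have "\<dots> = (\<Sum>k\<in>K. \<Sum>l\<in>K. \<Sum>i\<in>I. g k K * g l K * (x i k * x i l))"
      by (subst sum.swap) (intro sum.cong refl sum.swap)
    \<comment> \<open>The frame identity removes the products of different coordinates, after which
      all signs occur squared.\<close>
    also have "\<dots> = (\<Sum>k\<in>K. \<Sum>l\<in>K. if k = l then g k K * g k K else 0)"
      unfolding sum_distrib_left[symmetric] using K frame by (intro sum.cong refl) (auto simp: subset_iff)
    also have "\<dots> = (\<Sum>k\<in>K. (u (K - {k}))\<^sup>2)"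
      using fK by (intro sum.cong refl) (simp add: gsq)
    finally show ?thesis .
  qed
  have "(\<Sum>i\<in>I. ext_inner p (ext_vec (Matrix.vec p (x i)) \<and>\<^sub>e u) (ext_vec (Matrix.vec p (x i)) \<and>\<^sub>e u))
     = (\<Sum>i\<in>I. \<Sum>K\<in>Pow {..<p}. (\<Sum>k\<in>K. x i k * g k K) * (\<Sum>k\<in>K. x i k * g k K))"
    unfolding ext_inner_def by (intro sum.cong refl) (simp add: w)
  also have "\<dots> = (\<Sum>K\<in>Pow {..<p}. \<Sum>k\<in>K. (u (K - {k}))\<^sup>2)"
    by (subst sum.swap) (intro sum.cong refl K)
  also have "\<dots> = (\<Sum>(K, k)\<in>Sigma (Pow {..<p}) (\<lambda>K. K). (u (K - {k}))\<^sup>2)"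
    by (rule sum.Sigma) (auto intro: finite_subset)
  also have "\<dots> = (\<Sum>(J, k)\<in>Sigma (Pow {..<p}) (\<lambda>J. {..<p} - J). (u J)\<^sup>2)"
    by (rule sum.reindex_bij_witness[where j = "\<lambda>(K, k). (K - {k}, k)" and i = "\<lambda>(J, k). (insert k J, k)"])
      (auto simp: insert_absorb)
  also have "\<dots> = (\<Sum>J\<in>Pow {..<p}. \<Sum>k\<in>{..<p} - J. (u J)\<^sup>2)"
    by (rule sum.Sigma[symmetric]) auto
  also have "\<dots> = (\<Sum>J\<in>Pow {..<p}. (real p - real r) * (u J * u J))"
  proof (rule sum.cong[OF refl])
    fix J assume J: "J \<in> Pow {..<p}"
    show "(\<Sum>k\<in>{..<p} - J. (u J)\<^sup>2) = (real p - real r) * (u J * u J)"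
    proof (cases "u J = 0")
      case False
      have "card ({..<p} - J) = p - r"
        using J u[OF False] by (subst card_Diff_subset) (auto intro: finite_subset)
      then show ?thesis using r by (simp add: power2_eq_square of_nat_diff)
    qed simp
  qed
  finally show ?thesis by (simp add: ext_inner_def sum_distrib_left)
qed

text \<open>A product of \<open>p\<close> vectors in dimension \<open>p\<close> has a single
  coordinate, at \<open>{..<p}\<close>, namely the determinant of the transposed matrix.\<close>

lemma det_process_mass_eq_gram:
  assumes B: "B \<subseteq> {..<N}" "card B = p"
  shows "det_process_mass N p a B = gram p (row_list a B) (row_list a B)"
proof -
  have fB: "finite B" using B finite_subset by blast
  let ?l = "sorted_list_of_set B"
  let ?xs = "row_list a B"
  have len: "length ?l = p" "length ?xs = p" using B fB by (auto simp: row_list_def)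
  have "wedge_list p ?xs {..<p} =
      det (mat p p (\<lambda>(s, t). map (Matrix.vec p) ?xs ! s $ (sorted_list_of_set {..<p} ! t)))"
    unfolding wedge_list_def by (rule ext_list_minor) (use len in auto)
  also have "mat p p (\<lambda>(s, t). map (Matrix.vec p) ?xs ! s $ (sorted_list_of_set {..<p} ! t))
      = transpose_mat (mat p p (\<lambda>(k, j). a k $ (?l ! j)))"
    by (rule eq_matI) (use len in \<open>auto simp: row_list_def coords_def lessThan_atLeast0\<close>)
  also have "det \<dots> = det (mat p p (\<lambda>(k, j). a k $ (?l ! j)))"
    by (rule det_transpose[where n = p]) simp
  finally have d: "wedge_list p ?xs {..<p} = det (mat p p (\<lambda>(k, j). a k $ (?l ! j)))" .
  have "gram p ?xs ?xs = (\<Sum>K\<in>{{..<p}}. wedge_list p ?xs K * wedge_list p ?xs K)"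
    unfolding gram_def ext_inner_def
  proof (rule sum.mono_neutral_right)
    show "\<forall>K\<in>Pow {..<p} - {{..<p}}. wedge_list p ?xs K * wedge_list p ?xs K = 0"
    proof
      fix K assume K: "K \<in> Pow {..<p} - {{..<p}}"
      then have "card K < card {..<p}" by (intro psubset_card_mono) auto
      then show "wedge_list p ?xs K * wedge_list p ?xs K = 0"
        using wedge_list_nonzero(2)[of p ?xs K] len by auto
    qed
  qed auto
  then show ?thesis using B d by (simp add: det_process_mass_def power2_eq_square)
qed

lemma row_list_insert:
  assumes "finite B" "i \<notin> B"
  shows "mset (row_list a (insert i B)) = mset (coords a i # row_list a B)"
  using assms by (simp add: row_list_def sorted_list_of_set_insert_remove mset_insort)

lemma row_list_distinct:
  assumes "distinct bs" shows "mset (row_list a (set bs)) = mset (map (coords a) bs)"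
proof -
  have "mset (sorted_list_of_set (set bs)) = mset bs"
    using assms by (simp add: sorted_list_of_set_sort_remdups distinct_remdups_id)
  then show ?thesis by (simp add: row_list_def)
qed

text \<open>Descending induction on the cardinality of \<open>B\<close>. Summing over
  \<open>i\<close> outside \<open>B\<close>, both sides satisfy the same recursion: for the process
  because each \<open>S\<close> of size \<open>p\<close> containing \<open>B\<close> has
  \<open>p - card B\<close> further elements, for Gram determinants by
  \<open>sum_ext_inner_tight_frame\<close>.\<close>

lemma prob_superset:
  assumes on: "orthonormal_vecs N p a" and B: "B \<subseteq> {..<N}"
  shows "measure_pmf.prob (det_process N p a) {\<phi>. B \<subseteq> \<phi>} = gram p (row_list a B) (row_list a B)"
proof -
  let ?M = "det_process N p a"
  define F where "F = {S. S \<subseteq> {..<N} \<and> card S = p}"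
  have F: "finite F" by (rule finite_subset[of _ "Pow {..<N}"]) (auto simp: F_def)
  have pmf: "pmf ?M S = det_process_mass N p a S" for S by (rule pmf_det_process[OF on])
  have sup: "set_pmf ?M \<subseteq> F"
    unfolding F_def by (auto simp: set_pmf_eq pmf det_process_mass_def split: if_splits)
  define Pr where "Pr B = measure_pmf.prob ?M {\<phi>. B \<subseteq> \<phi>}" for B
  have Pr: "Pr B = (\<Sum>S\<in>F. if B \<subseteq> S then pmf ?M S else 0)" for B
  proof -
    have "Pr B = measure_pmf.prob ?M {S \<in> F. B \<subseteq> S}"
      unfolding Pr_def by (rule measure_eq_AE) (use sup in \<open>auto simp: AE_measure_pmf_iff\<close>)
    also have "\<dots> = (\<Sum>S\<in>{S \<in> F. B \<subseteq> S}. pmf ?M S)"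
      using F by (intro measure_measure_pmf_finite) auto
    finally show ?thesis using F by (simp add: sum.inter_filter)
  qed
  let ?g = "\<lambda>B. gram p (row_list a B) (row_list a B)"
  have len: "length (row_list a B) = card B" if "finite B" for B using that by (simp add: row_list_def)
  \<comment> \<open>Orthonormality of the vectors \<open>a k\<close>, read in terms of the rows: the
    sum of the rank-one matrices of all rows is the identity.\<close>
  have frame: "(\<Sum>i<N. coords a i k * coords a i l) = (if k = l then 1 else 0)" if "k < p" "l < p" for k l
  proof -
    have "a k \<bullet> a l = (if k = l then 1 else 0)" "a l \<in> carrier_vec N"
      using on that by (auto simp: orthonormal_vecs_def)
    then show ?thesis by (auto simp: coords_def scalar_prod_def atLeast0LessThan)
  qed
  have "Pr B = ?g B" if "B \<subseteq> {..<N}" for B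
    using that
  \<comment> \<open>Subtraction is truncated, so the base case also contains the sets with more than
    \<open>p\<close> elements, for which both sides are 0.\<close>
  proof (induction "p - card B" arbitrary: B)
    case 0
    have fB: "finite B" using 0 finite_subset by blast
    show ?case
    proof (cases "card B = p")
      case True
      have eq: "S = B" if "S \<in> F" "B \<subseteq> S" for S
        using that True by (metis (mono_tags, lifting) F_def card_subset_eq finite_lessThan finite_subset mem_Collect_eq)
      have "B \<in> F" using True 0 by (simp add: F_def)
      have "Pr B = (\<Sum>S\<in>F. if S = B then pmf ?M B else 0)"
        unfolding Pr by (intro sum.cong refl) (use eq in auto)
      also have "\<dots> = pmf ?M B" using F \<open>B \<in> F\<close> by simp
      finally show ?thesis using True 0 by (simp add: pmf det_process_mass_eq_gram)
    next
      case False
      then have lt: "p < card B" using 0 by simp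
      have "\<not> B \<subseteq> S" if "S \<in> F" for S
      proof
        assume "B \<subseteq> S"
        moreover have "finite S" "card S = p" using that finite_subset by (auto simp: F_def)
        ultimately show False using card_mono[of S B] lt by simp
      qed
      then have "Pr B = 0" unfolding Pr by (intro sum.neutral) auto
      moreover have "wedge_list p (row_list a B) K = 0" if "K \<subseteq> {..<p}" for K
      proof (rule ccontr)
        assume "wedge_list p (row_list a B) K \<noteq> 0"
        then have "card K = card B" using wedge_list_nonzero(2) len[OF fB] by metis
        moreover have "card K \<le> p" using card_mono[OF _ that] by simp
        ultimately show False using lt by simp
      qed
      then have "?g B = 0" unfolding gram_def ext_inner_def by (intro sum.neutral) auto
      ultimately show ?thesis by simp
    qed
  next
    case (Suc n)
    have fB: "finite B" using Suc.prems finite_subset by blast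
    have lt: "card B < p" using Suc.hyps(2) by simp
    have ins: "Pr (insert i B) = gram p (coords a i # row_list a B) (coords a i # row_list a B)"
      if i: "i \<in> {..<N} - B" for i
    proof -
      have "Pr (insert i B) = ?g (insert i B)"
        by (rule Suc.hyps(1)) (use i Suc fB in auto)
      also have "\<dots> = gram p (coords a i # row_list a B) (coords a i # row_list a B)"
        by (rule gram_mset_eq, rule row_list_insert) (use i fB in auto)
      finally show ?thesis .
    qed
    have "(\<Sum>i\<in>{..<N} - B. Pr (insert i B))
        = (\<Sum>S\<in>F. \<Sum>i\<in>{..<N} - B. if insert i B \<subseteq> S then pmf ?M S else 0)"
      unfolding Pr by (rule sum.swap)
    also have "\<dots> = (\<Sum>S\<in>F. (real p - real (card B)) * (if B \<subseteq> S then pmf ?M S else 0))"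
    proof (rule sum.cong[OF refl])
      fix S assume S: "S \<in> F"
      show "(\<Sum>i\<in>{..<N} - B. if insert i B \<subseteq> S then pmf ?M S else 0)
          = (real p - real (card B)) * (if B \<subseteq> S then pmf ?M S else 0)"
      proof (cases "B \<subseteq> S")
        case True
        have "(\<Sum>i\<in>{..<N} - B. if insert i B \<subseteq> S then pmf ?M S else 0) = (\<Sum>i\<in>S - B. pmf ?M S)"
          by (rule sum.mono_neutral_cong_right) (use S True in \<open>auto simp: F_def\<close>)
        moreover have "card (S - B) = p - card B"
          using True S fB by (subst card_Diff_subset) (auto simp: F_def)
        ultimately show ?thesis using True lt by (simp add: of_nat_diff)
      qed simp
    qed
    finally have 1: "(\<Sum>i\<in>{..<N} - B. Pr (insert i B)) = (real p - real (card B)) * Pr B"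
      by (simp add: Pr sum_distrib_left)
    \<comment> \<open>For \<open>i\<close> in \<open>B\<close> a row is repeated and the Gram term
      vanishes; the sum may thus run over all \<open>i\<close>, as the frame identity
      demands.\<close>
    have "(\<Sum>i\<in>{..<N} - B. Pr (insert i B))
        = (\<Sum>i<N. gram p (coords a i # row_list a B) (coords a i # row_list a B))"
    proof (rule sum.mono_neutral_cong_left)
      show "\<forall>i\<in>{..<N} - ({..<N} - B). gram p (coords a i # row_list a B) (coords a i # row_list a B) = 0"
      proof
        fix i assume "i \<in> {..<N} - ({..<N} - B)"
        then have "coords a i \<in> set (row_list a B)" using fB by (auto simp: row_list_def)
        then have "wedge_list p (coords a i # row_list a B) K = 0" for K by (rule wedge_list_repeat)
        then show "gram p (coords a i # row_list a B) (coords a i # row_list a B) = 0"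
          by (simp add: gram_def ext_inner_def)
      qed
    qed (auto simp: ins)
    also have "\<dots> = (real p - real (card B)) * ?g B"
      unfolding gram_def wedge_list_Cons
      by (rule sum_ext_inner_tight_frame[OF frame])
        (use lt len[OF fB] wedge_list_nonzero(2)[of p "row_list a B"] in auto)
    finally show ?case using 1 lt by simp
  qed
  then show ?thesis using B unfolding Pr_def by blast
qed

section \<open>Conditional negative correlation\<close>

lemma prob_excl:
  assumes on: "orthonormal_vecs N p a" and A: "A1 \<subseteq> {..<N}" "A2 \<subseteq> {..<N}" "A1 \<inter> A2 = {}"
    and bs: "distinct bs" "set bs \<subseteq> {..<N}" "set bs \<inter> A1 = {}" "set bs \<inter> A2 = {}"
  shows "measure_pmf.prob (det_process N p a) {\<phi>. set bs \<subseteq> \<phi> \<and> \<not> A1 \<subseteq> \<phi> \<and> \<not> A2 \<subseteq> \<phi>}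
    = excl p (row_list a A1) (row_list a A2) (map (coords a) bs) (map (coords a) bs)"
proof -
  let ?M = "measure_pmf (det_process N p a)"
  let ?r = "row_list a" and ?b = "map (coords a) bs"
  let ?X = "\<lambda>B. {\<phi>. B \<subseteq> \<phi>}"
  have f: "finite A1" "finite A2" using A finite_subset[OF _ finite_lessThan] by blast+
  have mu: "mset (?r (B \<union> C)) = mset (?r B) + mset (?r C)"
    if "finite B" "finite C" "B \<inter> C = {}" for B C
  proof -
    have "mset (?r (set (sorted_list_of_set B @ sorted_list_of_set C)))
        = mset (map (coords a) (sorted_list_of_set B @ sorted_list_of_set C))"
      by (rule row_list_distinct) (use that in auto)
    then show ?thesis using that by (simp add: row_list_def)
  qed
  have P: "measure_pmf.prob (det_process N p a) (?X B) = gram p xs xs"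
    if "B \<subseteq> {..<N}" "mset (?r B) = mset xs" for B xs
    unfolding prob_superset[OF on that(1)] by (rule gram_mset_eq[OF that(2)])
  let ?B = "set bs"
  have p0: "measure ?M (?X ?B) = gram p ?b ?b"
    using bs by (intro P row_list_distinct)
  have p1: "measure ?M (?X (A1 \<union> ?B)) = gram p (?r A1 @ ?b) (?r A1 @ ?b)"
    by (rule P) (use A bs f row_list_distinct[OF bs(1), of a] in \<open>auto simp: mu Int_commute\<close>)
  have p2: "measure ?M (?X (A2 \<union> ?B)) = gram p (?r A2 @ ?b) (?r A2 @ ?b)"
    by (rule P) (use A bs f row_list_distinct[OF bs(1), of a] in \<open>auto simp: mu Int_commute\<close>)
  have "A1 \<inter> (A2 \<union> ?B) = {}" "A2 \<inter> ?B = {}" using A bs by auto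
  then have p12: "measure ?M (?X (A1 \<union> (A2 \<union> ?B))) = gram p (?r A1 @ ?r A2 @ ?b) (?r A1 @ ?r A2 @ ?b)"
    by (intro P) (use A bs f row_list_distinct[OF bs(1), of a] in \<open>auto simp: mu\<close>)
  have "measure ?M (?X ?B) = measure ?M {\<phi>. ?B \<subseteq> \<phi> \<and> \<not> A1 \<subseteq> \<phi> \<and> \<not> A2 \<subseteq> \<phi>}
      + measure ?M (?X (A1 \<union> ?B) \<union> ?X (A2 \<union> ?B))"
    by (subst measure_pmf.finite_measure_Union[symmetric]) (auto intro!: arg_cong[where f = "measure ?M"])
  moreover have "measure ?M (?X (A1 \<union> ?B) \<union> ?X (A2 \<union> ?B))
      = measure ?M (?X (A1 \<union> ?B)) + measure ?M (?X (A2 \<union> ?B)) - measure ?M (?X (A1 \<union> ?B) \<inter> ?X (A2 \<union> ?B))"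
    by (rule measure_Un3) (simp_all add: measure_pmf.fmeasurable_eq_sets)
  moreover have "?X (A1 \<union> ?B) \<inter> ?X (A2 \<union> ?B) = ?X (A1 \<union> (A2 \<union> ?B))" by auto
  then have "measure ?M (?X (A1 \<union> ?B) \<inter> ?X (A2 \<union> ?B)) = gram p (?r A1 @ ?r A2 @ ?b) (?r A1 @ ?r A2 @ ?b)"
    using p12 by (simp only:)
  ultimately show ?thesis unfolding excl_def p0 p1 p2 by (simp only:)
qed

text \<open>The algebraic form of conditioning: in each of the four Gram determinants the block
  \<open>xs\<close> is moved to the front and split off by projection.\<close>

lemma excl_append_orthonormal:
  assumes "orthonormal_list p es" "\<And>K. wedge_list p xs K = lam * wedge_list p es K"
  shows "excl p us vs (xs @ zs) (xs @ zs) = lam\<^sup>2 * excl p (map (perp p es) us) (map (perp p es) vs)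
      (map (perp p es) zs) (map (perp p es) zs)"
proof -
  have *: "gram p (us @ xs @ ws) (us @ xs @ ws)
      = lam\<^sup>2 * gram p (map (perp p es) (us @ ws)) (map (perp p es) (us @ ws))" for us ws
  proof -
    have "wedge_list p xs = (\<lambda>K. lam * wedge_list p es K)" using assms(2) by blast
    then have w: "wedge_list p (xs @ us @ ws) K = lam * wedge_list p (es @ us @ ws) K" for K
      by (simp add: wedge_list_append[of p xs] wedge_list_append[of p es] ext_wedge_scale_left)
    have "gram p (us @ xs @ ws) (us @ xs @ ws) = gram p (xs @ us @ ws) (xs @ us @ ws)"
      by (rule gram_mset_eq) simp
    also have "\<dots> = lam * lam * gram p (es @ us @ ws) (es @ us @ ws)"
      by (rule gram_scale) (rule w)+
    finally show ?thesis by (simp add: gram_orthonormal[OF assms(1)] power2_eq_square)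
  qed
  from *[of "[]" zs] *[of us zs] *[of vs zs] *[of "us @ vs" zs]
  show ?thesis by (simp add: excl_def algebra_simps)
qed

text \<open>All four weights carry the factor \<open>lam\<^sup>2\<close>, the probability that
  \<open>X\<close> is contained in the process; without it they are excluded Gram forms of projected
  rows, and \<open>excl_pair_inequality\<close> applies after its mixed square is dropped.\<close>

lemma prob_excl_log_submodular:
  fixes N p :: nat and a :: "nat \<Rightarrow> real vec"
  defines "w \<equiv> \<lambda>A1 A2 B. measure_pmf.prob (det_process N p a) {\<phi>. B \<subseteq> \<phi> \<and> \<not> A1 \<subseteq> \<phi> \<and> \<not> A2 \<subseteq> \<phi>}"
  assumes on: "orthonormal_vecs N p a" and A: "A1 \<subseteq> {..<N}" "A2 \<subseteq> {..<N}" "A1 \<inter> A2 = {}"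
    and X: "X \<subseteq> {..<N} - A1 - A2" and ij: "i \<in> {..<N} - A1 - A2 - X" "j \<in> {..<N} - A1 - A2 - X" "i \<noteq> j"
  shows "w A1 A2 (insert i (insert j X)) * w A1 A2 X \<le> w A1 A2 (insert i X) * w A1 A2 (insert j X)"
proof -
  have XN: "X \<subseteq> {..<N}" using X by blast
  have fX: "finite X" using X finite_subset by blast
  define l where "l = sorted_list_of_set X"
  have l: "distinct l" "set l = X" using fX by (auto simp: l_def)
  let ?c = "coords a"
  obtain lam es where es: "orthonormal_list p es"
    "\<And>K. wedge_list p (map ?c l) K = lam * wedge_list p es K"
    using gram_schmidt[of p "map ?c l"] by blast
  let ?R = "map (perp p es)"
  let ?e = "excl p (?R (row_list a A1)) (?R (row_list a A2))"
  have W: "w A1 A2 (set bs \<union> X) = lam\<^sup>2 * ?e (?R (map ?c bs)) (?R (map ?c bs))"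
    if "distinct bs" "set bs \<subseteq> {..<N} - A1 - A2 - X" for bs
  proof -
    have "w A1 A2 (set (l @ bs)) = excl p (row_list a A1) (row_list a A2) (map ?c (l @ bs)) (map ?c (l @ bs))"
      unfolding w_def by (rule prob_excl[OF on A]) (use that l X in auto)
    then show ?thesis using l by (simp only: map_append excl_append_orthonormal[OF es] set_append Un_commute)
  qed
  \<comment> \<open>Multiplied by \<open>lam\<^sup>2\<close>, the Gram determinant is the
    probability of containing \<open>X \<union> A\<close>, which is at most that of containing
    \<open>X\<close>, that is, \<open>lam\<^sup>2\<close>.\<close>
  have small: "gram p (?R (row_list a A)) (?R (row_list a A)) \<le> 1"
    if AN: "A \<subseteq> {..<N}" "A \<inter> X = {}" and lam: "lam \<noteq> 0" for A
  proof -
    have fA: "finite A" using AN finite_subset by blast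
    have "gram p (map ?c l @ ys) (map ?c l @ ys) = lam\<^sup>2 * gram p (?R ys) (?R ys)" for ys
    proof -
      have "wedge_list p (map ?c l) = (\<lambda>K. lam * wedge_list p es K)" using es(2) by blast
      then have w: "wedge_list p (map ?c l @ ys) K = lam * wedge_list p (es @ ys) K" for K
        by (simp add: wedge_list_append ext_wedge_scale_left)
      have "gram p (map ?c l @ ys) (map ?c l @ ys) = lam * lam * gram p (es @ ys) (es @ ys)"
        by (rule gram_scale) (rule w)+
      then show ?thesis by (simp add: gram_orthonormal[OF es(1)] power2_eq_square)
    qed
    note g = this[of "row_list a A"] this[of "[]"]
    have "mset (row_list a (set (l @ sorted_list_of_set A))) = mset (map ?c (l @ sorted_list_of_set A))"
      by (rule row_list_distinct) (use AN fA l in auto)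
    then have m: "mset (row_list a (X \<union> A)) = mset (map ?c l @ row_list a A)"
      using fA l by (simp add: row_list_def)
    have "lam\<^sup>2 * gram p (?R (row_list a A)) (?R (row_list a A))
        = measure_pmf.prob (det_process N p a) {\<phi>. X \<union> A \<subseteq> \<phi>}"
      using prob_superset[OF on, of "X \<union> A"] gram_mset_eq[OF m, of p] AN(1) XN g(1) by simp
    also have "\<dots> \<le> measure_pmf.prob (det_process N p a) {\<phi>. X \<subseteq> \<phi>}"
      by (intro measure_pmf.finite_measure_mono) auto
    also have "\<dots> = lam\<^sup>2"
      using prob_superset[OF on XN] g(2) by (simp add: row_list_def l_def gram_Nil)
    finally show ?thesis using lam by simp
  qed
  have i: "w A1 A2 (insert i X) = lam\<^sup>2 * ?e [perp p es (?c i)] [perp p es (?c i)]"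
    and j: "w A1 A2 (insert j X) = lam\<^sup>2 * ?e [perp p es (?c j)] [perp p es (?c j)]"
    and ij': "w A1 A2 (insert i (insert j X)) = lam\<^sup>2 * ?e [perp p es (?c i), perp p es (?c j)] [perp p es (?c i), perp p es (?c j)]"
    and e: "w A1 A2 X = lam\<^sup>2 * ?e [] []"
    using W[of "[i]"] W[of "[j]"] W[of "[i, j]"] W[of "[]"] ij by simp_all
  show ?thesis
  proof (cases "lam = 0")
    case True
    then show ?thesis unfolding i j ij' e by simp
  next
    case False
    have "A1 \<inter> X = {}" "A2 \<inter> X = {}" using X by auto
    from excl_pair_inequality[OF small[OF A(1) this(1) False] small[OF A(2) this(2) False],
        of "perp p es (?c i)" "perp p es (?c j)"]
    have "?e [] [] * ?e [perp p es (?c i), perp p es (?c j)] [perp p es (?c i), perp p es (?c j)]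
      \<le> ?e [perp p es (?c i)] [perp p es (?c i)] * ?e [perp p es (?c j)] [perp p es (?c j)]"
      by (rule order_trans) simp
    from mult_left_mono[OF this, of "lam\<^sup>2 * lam\<^sup>2"] show ?thesis
      unfolding i j ij' e by (simp add: mult_ac)
  qed
qed

text \<open>Passes from single elements to sets by adding elements one at a time, first to the
  context \<open>C\<close> of a fixed \<open>i\<close>, then to \<open>A\<close>. Each step
  multiplies two inequalities and cancels a common weight; if that weight is 0, monotonicity makes
  the left side 0.\<close>

lemma log_submodular_disjoint:
  fixes w :: "'a set \<Rightarrow> real"
  assumes nonneg: "\<And>X. 0 \<le> w X" and anti: "\<And>X Y. X \<subseteq> Y \<Longrightarrow> w Y \<le> w X"
    and loc: "\<And>X i j. X \<subseteq> U \<Longrightarrow> i \<in> U - X \<Longrightarrow> j \<in> U - X \<Longrightarrow> i \<noteq> j \<Longrightarrow>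
      w (insert i (insert j X)) * w X \<le> w (insert i X) * w (insert j X)"
    and AB: "finite A" "finite B" "A \<subseteq> U" "B \<subseteq> U" "A \<inter> B = {}"
  shows "w (A \<union> B) * w {} \<le> w A * w B"
proof -
  have zero: "w Y = 0" if "w X = 0" "X \<subseteq> Y" for X Y
    using nonneg[of Y] anti[OF that(2)] that(1) by simp
  have one: "w (insert i (X \<union> C)) * w X \<le> w (insert i X) * w (X \<union> C)"
    if "finite C" "C \<subseteq> U - X" "X \<subseteq> U" "i \<in> U - X - C" for i X C
    using that
  proof (induction C rule: finite_induct)
    case (insert b C)
    let ?Y = "X \<union> C"
    have IH: "w (insert i ?Y) * w X \<le> w (insert i X) * w ?Y" using insert by auto
    have L: "w (insert i (insert b ?Y)) * w ?Y \<le> w (insert i ?Y) * w (insert b ?Y)"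
      by (rule loc) (use insert in auto)
    show ?case
    proof (cases "w ?Y = 0")
      case True
      have "w (insert i (X \<union> insert b C)) = 0" by (rule zero[OF True]) auto
      then show ?thesis using nonneg by simp
    next
      case False
      have "w (insert i (insert b ?Y)) * w ?Y * w X \<le> w (insert i ?Y) * w (insert b ?Y) * w X"
        by (rule mult_right_mono[OF L nonneg])
      also have "\<dots> = w (insert i ?Y) * w X * w (insert b ?Y)" by simp
      also have "\<dots> \<le> w (insert i X) * w ?Y * w (insert b ?Y)"
        by (rule mult_right_mono[OF IH nonneg])
      finally have "(w (insert i (insert b ?Y)) * w X) * w ?Y \<le> (w (insert i X) * w (insert b ?Y)) * w ?Y"
        by (simp add: mult_ac)
      moreover have "0 < w ?Y" using False nonneg[of ?Y] by simp
      ultimately show ?thesis by simp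
    qed
  qed simp
  show ?thesis using AB(1,3,5)
  proof (induction A rule: finite_induct)
    case (insert i A)
    have IH: "w (A \<union> B) * w {} \<le> w A * w B" using insert by auto
    have L: "w (insert i (A \<union> B)) * w A \<le> w (insert i A) * w (A \<union> B)"
      by (rule one) (use insert AB in auto)
    show ?case
    proof (cases "w A = 0")
      case True
      have "w (insert i A \<union> B) = 0" by (rule zero[OF True]) auto
      then show ?thesis using nonneg by simp
    next
      case False
      have "w (insert i (A \<union> B)) * w A * w {} \<le> w (insert i A) * w (A \<union> B) * w {}"
        by (rule mult_right_mono[OF L nonneg])
      also have "\<dots> = w (A \<union> B) * w {} * w (insert i A)" by simp
      also have "\<dots> \<le> w A * w B * w (insert i A)"
        by (rule mult_right_mono[OF IH nonneg])
      finally have "(w (insert i (A \<union> B)) * w {}) * w A \<le> (w (insert i A) * w B) * w A"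
        by (simp add: mult_ac)
      moreover have "0 < w A" using False nonneg[of A] by simp
      ultimately show ?thesis by simp
    qed
  qed simp
qed

section \<open>Translation of \<open>q_form\<close> and \<open>Lambda_g\<close> into the excluded
  Gram form\<close>

lemma ext_wedge_one: "(u \<and>\<^sub>e ext_one) K = (if finite K then u K else 0)"
proof (cases "finite K")
  case True
  have "(u \<and>\<^sub>e ext_one) K = (\<Sum>I\<in>{K}. ext_sign I (K - I) * u I * ext_one (K - I))"
    unfolding ext_wedge_def by (rule sum.mono_neutral_right) (use True in \<open>auto simp: ext_one_def\<close>)
  then show ?thesis using True by (simp add: ext_one_def ext_sign_def)
qed (simp add: ext_wedge_infinite)

lemma wedge_list_single: "wedge_list p [x] = ext_vec (Matrix.vec p x)"
proof
  fix K
  show "wedge_list p [x] K = ext_vec (Matrix.vec p x) K"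
    using ext_vec_nonzero[of "Matrix.vec p x" K]
    by (auto simp: wedge_list_Cons wedge_list_Nil ext_wedge_one)
qed

lemma ext_norm_power2: "(ext_norm p u)\<^sup>2 = ext_inner p u u"
  by (simp add: ext_norm_def ext_inner_def sum_nonneg)

text \<open>The vector stands before the wedge product in \<open>q_form\<close> and after it in
  \<open>excl\<close>; moving it produces the same sign in both arguments.\<close>

lemma q_form_eq_excl:
  "q_form p (wedge_list p xs) (wedge_list p ys) (Matrix.vec p y) (Matrix.vec p y') = excl p xs ys [y] [y']"
proof -
  have "gram p (zs @ [y]) (zs @ [y']) = gram p (y # zs) (y' # zs)" for zs
    using gram_append_commute[of "[y]" "[y']" p zs] by simp
  from this[of xs] this[of ys] this[of "xs @ ys"] show ?thesis
    unfolding q_form_def excl_def wedge_list_append[symmetric] wedge_list_Cons[symmetric] gram_def[symmetric]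
    by (simp add: scalar_prod_vec gram_single)
qed

text \<open>The squared norm of the product of \<open>yt\<close> and \<open>yt'\<close> is their 2
  by 2 Gram determinant, whose negative square cancels the one added on the left.\<close>

lemma Lambda_g_eq_excl:
  assumes "yt \<in> carrier_vec p" "yt' \<in> carrier_vec p"
  shows "(yt \<bullet> yt')\<^sup>2 + Lambda_g p (wedge_list p xs) (wedge_list p ys) yt yt' (Matrix.vec p y) (Matrix.vec p y')
    = (yt \<bullet> yt) * (yt' \<bullet> yt') - excl p xs ys [] [] * excl p xs ys [y, y'] [y, y']"
proof -
  define z z' where "z = ($) yt" and "z' = ($) yt'"
  have z: "yt = Matrix.vec p z" "yt' = Matrix.vec p z'" using assms by (auto simp: z_def z'_def)
  have c: "gram p (zs @ [y, y']) (zs @ [y, y']) = gram p (y # y' # zs) (y # y' # zs)" for zs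
    by (rule gram_mset_eq) simp
  have *: "(ext_norm p (wedge_list p zs))\<^sup>2 = gram p zs zs" for zs
    by (simp add: ext_norm_power2 gram_def)
  have "Lambda_g p (wedge_list p xs) (wedge_list p ys) yt yt' (Matrix.vec p y) (Matrix.vec p y')
    = gram p [z, z'] [z, z'] - (1 - gram p xs xs - gram p ys ys + gram p (xs @ ys) (xs @ ys))
      * (gram p [y, y'] [y, y'] - gram p (y # y' # xs) (y # y' # xs) - gram p (y # y' # ys) (y # y' # ys)
        + gram p (y # y' # xs @ ys) (y # y' # xs @ ys))"
    unfolding Lambda_g_def z wedge_list_single[symmetric] wedge_list_append[symmetric] * by simp
  then show ?thesis using c[of xs] c[of ys] c[of "xs @ ys"]
    by (simp add: excl_def gram_Nil gram_pair z scalar_prod_vec power2_eq_square ip_commute[of p z' z])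
qed

text \<open>A Cholesky factorisation of the 2 by 2 matrix, placed in the first two coordinates,
  which exist since \<open>p\<close> exceeds 1. If \<open>q11\<close> = 0, the determinant condition
  forces \<open>q12\<close> = 0.\<close>

lemma two_vectors_with_gram:
  fixes q11 q22 q12 :: real
  assumes "1 < p" "0 \<le> q11" "0 \<le> q22" "q12\<^sup>2 \<le> q11 * q22"
  obtains yt yt' where "yt \<in> carrier_vec p" "yt' \<in> carrier_vec p"
    "yt \<bullet> yt = q11" "yt' \<bullet> yt' = q22" "yt \<bullet> yt' = q12"
proof -
  have ex: "\<exists>r s t. r\<^sup>2 = q11 \<and> r * s = q12 \<and> s\<^sup>2 + t\<^sup>2 = q22"
  proof (cases "q11 = 0")
    case True
    then have "q12 = 0" using assms by simp
    then show ?thesis using True assms(3)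
      by (intro exI[of _ 0] exI[of _ "sqrt q22"]) simp
  next
    case False
    then have q: "0 < q11" using assms by simp
    have "q12\<^sup>2 / q11 \<le> q22" using q assms(4) by (simp add: field_simps)
    then show ?thesis using q
      by (intro exI[of _ "sqrt q11"] exI[of _ "q12 / sqrt q11"] exI[of _ "sqrt (q22 - q12\<^sup>2 / q11)"])
        (simp add: power_divide)
  qed
  then obtain r s t where rst: "r\<^sup>2 = q11" "r * s = q12" "s\<^sup>2 + t\<^sup>2 = q22" by blast
  let ?v = "\<lambda>x y. Matrix.vec p (\<lambda>i. if i = 0 then x else if i = Suc 0 then y else 0)"
  define m where "m = p - 2"
  have m: "p = Suc (Suc m)" using assms(1) by (simp add: m_def)
  have "?v x y \<bullet> ?v x' y' = x * x' + y * y'" for x y x' y' :: real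
    unfolding scalar_prod_vec ip_def m sum.lessThan_Suc_shift by simp
  then show ?thesis using rst
    by (intro that[of "?v r 0" "?v s t"]) (auto simp: power2_eq_square)
qed

theorem theorem3:
  fixes N p :: nat and a :: "nat \<Rightarrow> real vec"
  assumes "1 < p" and "p < N"
    and "orthonormal_vecs N p a"
  shows
    "(\<forall>i0 j0 A1 A2.
        i0 \<in> {..<N} \<and> j0 \<in> {..<N} \<and> A1 \<subseteq> {..<N} \<and> A2 \<subseteq> {..<N}
        \<and> {i0} \<inter> {j0} = {} \<and> {i0} \<inter> A1 = {} \<and> {i0} \<inter> A2 = {}
        \<and> {j0} \<inter> A1 = {} \<and> {j0} \<inter> A2 = {} \<and> A1 \<inter> A2 = {}
        \<and> \<P>(\<phi> in det_process N p a. \<not> A1 \<subseteq> \<phi> \<and> \<not> A2 \<subseteq> \<phi>) > 0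
        \<longrightarrow>
        (let y = proc_vec p a i0; y' = proc_vec p a j0;
             \<omega>1 = proc_wedge p a A1; \<omega>2 = proc_wedge p a A2;
             q = q_form p \<omega>1 \<omega>2;
             gram = (\<lambda>yt yt'. yt \<in> carrier_vec p \<and> yt' \<in> carrier_vec p
               \<and> yt \<bullet> yt = q y y \<and> yt' \<bullet> yt' = q y' y' \<and> yt \<bullet> yt' = q y y')
         in (\<exists>yt yt'. gram yt yt')
          \<and> (\<forall>yt yt'. gram yt yt' \<longrightarrow>
                \<P>(\<phi> in det_process N p a. i0 \<in> \<phi> \<bar> \<not> A1 \<subseteq> \<phi> \<and> \<not> A2 \<subseteq> \<phi>)
                * \<P>(\<phi> in det_process N p a. j0 \<in> \<phi> \<bar> \<not> A1 \<subseteq> \<phi> \<and> \<not> A2 \<subseteq> \<phi>)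
                - \<P>(\<phi> in det_process N p a. i0 \<in> \<phi> \<and> j0 \<in> \<phi> \<bar> \<not> A1 \<subseteq> \<phi> \<and> \<not> A2 \<subseteq> \<phi>)
                = \<P>(\<phi> in det_process N p a. \<not> A1 \<subseteq> \<phi> \<and> \<not> A2 \<subseteq> \<phi>) powi (-2)
                  * ((yt \<bullet> yt')\<^sup>2 + Lambda_g p \<omega>1 \<omega>2 yt yt' y y')
              \<and> \<P>(\<phi> in det_process N p a. \<not> A1 \<subseteq> \<phi> \<and> \<not> A2 \<subseteq> \<phi>) powi (-2)
                  * ((yt \<bullet> yt')\<^sup>2 + Lambda_g p \<omega>1 \<omega>2 yt yt' y y') \<ge> 0)))
     \<and>
     (\<forall>A A1 A2 A3.
        A \<subseteq> {..<N} \<and> A1 \<subseteq> {..<N} \<and> A2 \<subseteq> {..<N} \<and> A3 \<subseteq> {..<N}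
        \<and> A \<inter> A1 = {} \<and> A \<inter> A2 = {} \<and> A \<inter> A3 = {}
        \<and> A1 \<inter> A2 = {} \<and> A1 \<inter> A3 = {} \<and> A2 \<inter> A3 = {}
        \<and> \<P>(\<phi> in det_process N p a. \<not> A1 \<subseteq> \<phi> \<and> \<not> A2 \<subseteq> \<phi> \<and> \<not> A3 \<subseteq> \<phi>) > 0
        \<longrightarrow>
        \<P>(\<phi> in det_process N p a. \<not> A \<subseteq> \<phi> \<bar> \<not> A1 \<subseteq> \<phi> \<and> \<not> A2 \<subseteq> \<phi> \<and> \<not> A3 \<subseteq> \<phi>)
        \<le> \<P>(\<phi> in det_process N p a. \<not> A \<subseteq> \<phi> \<bar> \<not> A1 \<subseteq> \<phi> \<and> \<not> A2 \<subseteq> \<phi>))"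
proof (intro conjI allI impI)
  fix i0 j0 A1 A2
  let ?M = "det_process N p a"
  assume H: "i0 \<in> {..<N} \<and> j0 \<in> {..<N} \<and> A1 \<subseteq> {..<N} \<and> A2 \<subseteq> {..<N}
        \<and> {i0} \<inter> {j0} = {} \<and> {i0} \<inter> A1 = {} \<and> {i0} \<inter> A2 = {}
        \<and> {j0} \<inter> A1 = {} \<and> {j0} \<inter> A2 = {} \<and> A1 \<inter> A2 = {}
        \<and> \<P>(\<phi> in ?M. \<not> A1 \<subseteq> \<phi> \<and> \<not> A2 \<subseteq> \<phi>) > 0"
  define c where "c = coords a"
  define ex where "ex = excl p (row_list a A1) (row_list a A2)"
  define W w2 q11 q22 q12 where "W = ex [] []" and "w2 = ex [c i0, c j0] [c i0, c j0]"
    and "q11 = ex [c i0] [c i0]" and "q22 = ex [c j0] [c j0]" and "q12 = ex [c i0] [c j0]"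
  note defs = W_def w2_def q11_def q22_def q12_def ex_def c_def
  have pr: "measure_pmf.prob ?M {\<phi>. set bs \<subseteq> \<phi> \<and> \<not> A1 \<subseteq> \<phi> \<and> \<not> A2 \<subseteq> \<phi>} = ex (map c bs) (map c bs)"
    if "distinct bs" "set bs \<subseteq> {i0, j0}" for bs
    unfolding ex_def c_def by (rule prob_excl[OF assms(3)]) (use that H in auto)
  have PW: "\<P>(\<phi> in ?M. \<not> A1 \<subseteq> \<phi> \<and> \<not> A2 \<subseteq> \<phi>) = W"
    and Pi: "measure_pmf.prob ?M {\<phi>. i0 \<in> \<phi> \<and> \<not> A1 \<subseteq> \<phi> \<and> \<not> A2 \<subseteq> \<phi>} = q11"
    and Pj: "measure_pmf.prob ?M {\<phi>. j0 \<in> \<phi> \<and> \<not> A1 \<subseteq> \<phi> \<and> \<not> A2 \<subseteq> \<phi>} = q22"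
    and Pij: "measure_pmf.prob ?M {\<phi>. i0 \<in> \<phi> \<and> j0 \<in> \<phi> \<and> \<not> A1 \<subseteq> \<phi> \<and> \<not> A2 \<subseteq> \<phi>} = w2"
    using pr[of "[]"] pr[of "[i0]"] pr[of "[j0]"] pr[of "[i0, j0]"] H
    by (auto simp: W_def q11_def q22_def w2_def)
  have W: "0 < W" using H unfolding PW by blast
  have nonneg: "0 \<le> q11" "0 \<le> q22" "0 \<le> w2" using Pi Pj Pij measure_nonneg by metis+
  have small: "gram p (row_list a A) (row_list a A) \<le> 1" if "A \<subseteq> {..<N}" for A
    using prob_superset[OF assms(3) that] measure_pmf.prob_le_1 by metis
  have key: "W * w2 \<le> q11 * q22 - q12\<^sup>2"
    unfolding defs by (rule excl_pair_inequality) (use small H in auto)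
  have q: "q_form p (proc_wedge p a A1) (proc_wedge p a A2) (proc_vec p a i) (proc_vec p a j) = ex [c i] [c j]" for i j
    unfolding proc_wedge_row_list proc_vec_coords q_form_eq_excl ex_def c_def ..
  have cond: "\<P>(\<phi> in ?M. i0 \<in> \<phi> \<bar> \<not> A1 \<subseteq> \<phi> \<and> \<not> A2 \<subseteq> \<phi>) = q11 / W"
    "\<P>(\<phi> in ?M. j0 \<in> \<phi> \<bar> \<not> A1 \<subseteq> \<phi> \<and> \<not> A2 \<subseteq> \<phi>) = q22 / W"
    "\<P>(\<phi> in ?M. i0 \<in> \<phi> \<and> j0 \<in> \<phi> \<bar> \<not> A1 \<subseteq> \<phi> \<and> \<not> A2 \<subseteq> \<phi>) = w2 / W"
    unfolding cond_prob_def PW using Pi Pj Pij by simp_all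
  have powi: "W powi (-2) = 1 / W\<^sup>2" by (simp add: power_int_minus divide_inverse)
  have L: "(yt \<bullet> yt')\<^sup>2 + Lambda_g p (proc_wedge p a A1) (proc_wedge p a A2) yt yt' (proc_vec p a i0) (proc_vec p a j0)
      = q11 * q22 - W * w2"
    if "yt \<in> carrier_vec p" "yt' \<in> carrier_vec p" "yt \<bullet> yt = q11" "yt' \<bullet> yt' = q22" for yt yt'
    unfolding proc_wedge_row_list proc_vec_coords Lambda_g_eq_excl[OF that(1,2)] that(3,4)
    unfolding W_def w2_def ex_def c_def ..
  show "let y = proc_vec p a i0; y' = proc_vec p a j0;
             \<omega>1 = proc_wedge p a A1; \<omega>2 = proc_wedge p a A2;
             q = q_form p \<omega>1 \<omega>2;
             gram = (\<lambda>yt yt'. yt \<in> carrier_vec p \<and> yt' \<in> carrier_vec p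
               \<and> yt \<bullet> yt = q y y \<and> yt' \<bullet> yt' = q y' y' \<and> yt \<bullet> yt' = q y y')
         in (\<exists>yt yt'. gram yt yt')
          \<and> (\<forall>yt yt'. gram yt yt' \<longrightarrow>
                \<P>(\<phi> in det_process N p a. i0 \<in> \<phi> \<bar> \<not> A1 \<subseteq> \<phi> \<and> \<not> A2 \<subseteq> \<phi>)
                * \<P>(\<phi> in det_process N p a. j0 \<in> \<phi> \<bar> \<not> A1 \<subseteq> \<phi> \<and> \<not> A2 \<subseteq> \<phi>)
                - \<P>(\<phi> in det_process N p a. i0 \<in> \<phi> \<and> j0 \<in> \<phi> \<bar> \<not> A1 \<subseteq> \<phi> \<and> \<not> A2 \<subseteq> \<phi>)
                = \<P>(\<phi> in det_process N p a. \<not> A1 \<subseteq> \<phi> \<and> \<not> A2 \<subseteq> \<phi>) powi (-2)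
                  * ((yt \<bullet> yt')\<^sup>2 + Lambda_g p \<omega>1 \<omega>2 yt yt' y y')
              \<and> \<P>(\<phi> in det_process N p a. \<not> A1 \<subseteq> \<phi> \<and> \<not> A2 \<subseteq> \<phi>) powi (-2)
                  * ((yt \<bullet> yt')\<^sup>2 + Lambda_g p \<omega>1 \<omega>2 yt yt' y y') \<ge> 0)"
    unfolding Let_def q cond PW q11_def[symmetric] q22_def[symmetric] q12_def[symmetric]
  proof (intro conjI allI impI, goal_cases)
    case 1
    \<comment> \<open>The Cauchy-Schwarz inequality for the three values of q is read off from the
      pair inequality, as the left side there is a product of probabilities.\<close>
    have "0 \<le> W * w2" using W nonneg by simp
    then have "q12\<^sup>2 \<le> q11 * q22" using key by linarith
    then show ?case using two_vectors_with_gram[OF assms(1) nonneg(1,2)] by metis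
  next
    case (2 yt yt')
    then have "(yt \<bullet> yt')\<^sup>2 + Lambda_g p (proc_wedge p a A1) (proc_wedge p a A2) yt yt' (proc_vec p a i0) (proc_vec p a j0)
      = q11 * q22 - W * w2" using L by blast
    then show ?case unfolding powi using W by (simp add: field_simps power2_eq_square)
  next
    case (3 yt yt')
    then have "(yt \<bullet> yt')\<^sup>2 + Lambda_g p (proc_wedge p a A1) (proc_wedge p a A2) yt yt' (proc_vec p a i0) (proc_vec p a j0)
      = q11 * q22 - W * w2" using L by blast
    moreover have "0 \<le> q11 * q22 - W * w2" using key zero_le_power2[of q12] by linarith
    ultimately show ?case unfolding powi by simp
  qed
next
  fix A A1 A2 A3
  let ?M = "measure_pmf (det_process N p a)"
  assume H: "A \<subseteq> {..<N} \<and> A1 \<subseteq> {..<N} \<and> A2 \<subseteq> {..<N} \<and> A3 \<subseteq> {..<N}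
        \<and> A \<inter> A1 = {} \<and> A \<inter> A2 = {} \<and> A \<inter> A3 = {}
        \<and> A1 \<inter> A2 = {} \<and> A1 \<inter> A3 = {} \<and> A2 \<inter> A3 = {}
        \<and> \<P>(\<phi> in det_process N p a. \<not> A1 \<subseteq> \<phi> \<and> \<not> A2 \<subseteq> \<phi> \<and> \<not> A3 \<subseteq> \<phi>) > 0"
  define w where "w B = measure ?M {\<phi>. B \<subseteq> \<phi> \<and> \<not> A1 \<subseteq> \<phi> \<and> \<not> A2 \<subseteq> \<phi>}" for B
  \<comment> \<open>After clearing denominators and cancelling common terms, the claim about
    conditional probabilities is exactly this inequality.\<close>
  have sub: "w (A \<union> A3) * w {} \<le> w A * w A3"
  proof (rule log_submodular_disjoint[where U = "{..<N} - A1 - A2"])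
    show "0 \<le> w X" for X by (simp add: w_def)
    show "w Y \<le> w X" if "X \<subseteq> Y" for X Y
      unfolding w_def by (rule measure_pmf.finite_measure_mono) (use that in auto)
    show "w (insert i (insert j X)) * w X \<le> w (insert i X) * w (insert j X)"
      if "X \<subseteq> {..<N} - A1 - A2" "i \<in> {..<N} - A1 - A2 - X" "j \<in> {..<N} - A1 - A2 - X" "i \<noteq> j" for X i j
      unfolding w_def by (rule prob_excl_log_submodular[OF assms(3) _ _ _ that]) (use H in auto)
  qed (use H finite_subset[OF _ finite_lessThan] in auto)
  have diff: "measure ?M {\<phi>. P \<phi> \<and> \<not> B \<subseteq> \<phi>} = measure ?M {\<phi>. P \<phi>} - measure ?M {\<phi>. B \<subseteq> \<phi> \<and> P \<phi>}" for P B
  proof -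
    have "{\<phi>. P \<phi> \<and> \<not> B \<subseteq> \<phi>} = {\<phi>. P \<phi>} - {\<phi>. B \<subseteq> \<phi> \<and> P \<phi>}" by auto
    then show ?thesis by (simp only:) (rule measure_pmf.finite_measure_Diff, auto)
  qed
  define E where "E \<phi> \<longleftrightarrow> \<not> A1 \<subseteq> \<phi> \<and> \<not> A2 \<subseteq> \<phi>" for \<phi>
  have wE: "measure ?M {\<phi>. B \<subseteq> \<phi> \<and> E \<phi>} = w B" for B by (simp add: w_def E_def)
  have E0: "measure ?M {\<phi>. E \<phi>} = w {}" by (simp add: w_def E_def)
  have m123: "measure ?M {\<phi>. E \<phi> \<and> \<not> A3 \<subseteq> \<phi>} = w {} - w A3"
    unfolding diff[of E A3] wE E0 ..
  have m12: "measure ?M {\<phi>. E \<phi> \<and> \<not> A \<subseteq> \<phi>} = w {} - w A"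
    unfolding diff[of E A] wE E0 ..
  have mA: "measure ?M {\<phi>. A \<subseteq> \<phi> \<and> E \<phi> \<and> \<not> A3 \<subseteq> \<phi>} = w A - w (A \<union> A3)"
  proof -
    have "{\<phi>. A3 \<subseteq> \<phi> \<and> A \<subseteq> \<phi> \<and> E \<phi>} = {\<phi>. A \<union> A3 \<subseteq> \<phi> \<and> E \<phi>}" by auto
    then show ?thesis using diff[of "\<lambda>\<phi>. A \<subseteq> \<phi> \<and> E \<phi>" A3] unfolding wE conj_assoc by (simp only: wE)
  qed
  have m: "measure ?M {\<phi>. (E \<phi> \<and> \<not> A3 \<subseteq> \<phi>) \<and> \<not> A \<subseteq> \<phi>} = w {} - w A3 - (w A - w (A \<union> A3))"
    unfolding diff[of "\<lambda>\<phi>. E \<phi> \<and> \<not> A3 \<subseteq> \<phi>" A] m123 mA ..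
  have "0 < measure ?M {\<phi>. E \<phi> \<and> \<not> A3 \<subseteq> \<phi>}" using H by (simp add: E_def)
  then have pos: "0 < w {} - w A3" unfolding m123 .
  have "0 \<le> w A3" by (simp add: w_def)
  with pos have pos0: "0 < w {}" by linarith
  have "\<P>(\<phi> in det_process N p a. \<not> A \<subseteq> \<phi> \<bar> \<not> A1 \<subseteq> \<phi> \<and> \<not> A2 \<subseteq> \<phi> \<and> \<not> A3 \<subseteq> \<phi>)
      = measure ?M {\<phi>. (E \<phi> \<and> \<not> A3 \<subseteq> \<phi>) \<and> \<not> A \<subseteq> \<phi>} / measure ?M {\<phi>. E \<phi> \<and> \<not> A3 \<subseteq> \<phi>}"
    unfolding cond_prob_def
    by (intro arg_cong2[where f = "(/)"] arg_cong[where f = "measure ?M"]) (auto simp: E_def)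
  moreover have "\<P>(\<phi> in det_process N p a. \<not> A \<subseteq> \<phi> \<bar> \<not> A1 \<subseteq> \<phi> \<and> \<not> A2 \<subseteq> \<phi>)
      = measure ?M {\<phi>. E \<phi> \<and> \<not> A \<subseteq> \<phi>} / measure ?M {\<phi>. E \<phi>}"
    unfolding cond_prob_def
    by (intro arg_cong2[where f = "(/)"] arg_cong[where f = "measure ?M"]) (auto simp: E_def)
  moreover have "(w {} - w A3 - (w A - w (A \<union> A3))) * w {} \<le> (w {} - w A) * (w {} - w A3)"
    using sub by (simp add: algebra_simps)
  then have "(w {} - w A3 - (w A - w (A \<union> A3))) / (w {} - w A3) \<le> (w {} - w A) / w {}"
    using pos pos0 by (simp add: divide_le_eq le_divide_eq)
  ultimately show "\<P>(\<phi> in det_process N p a. \<not> A \<subseteq> \<phi> \<bar> \<not> A1 \<subseteq> \<phi> \<and> \<not> A2 \<subseteq> \<phi> \<and> \<not> A3 \<subseteq> \<phi>)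
        \<le> \<P>(\<phi> in det_process N p a. \<not> A \<subseteq> \<phi> \<bar> \<not> A1 \<subseteq> \<phi> \<and> \<not> A2 \<subseteq> \<phi>)"
    by (simp only: m m123 m12 E0)
qed

end
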